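(* Let $k\ge2$ and $\alpha,\beta>0$, and consider the dihedral group $I_{2k}$ with multiplicity $\kappa=(\alpha,\beta)$. For $z=|z|e^{i\phi_1}$, $w=|w|e^{i\phi_2}$, $u,v\in[-1,1]$ put $q=q_{u,v}(k\phi_1,k\phi_2)$ and $$a_j^+=|zw|\cos\Big(\frac{q-2j\pi}{k}\Big),\qquad a_j^-=|zw|\cos\Big(\frac{\pi-q-2j\pi}{k}\Big),\qquad j=0,\dots,k-1.$$ Then $$\mathcal J_\kappa(z,w)=\frac{\Gamma(k(\alpha+\beta))}{2\Gamma(\alpha+\beta)^k}\int_{-1}^1\int_{-1}^1\int_{T^{k-1}}\Big(e^{\sum_{j=0}^{k-1}a_j^+t_j}+e^{\sum_{j=0}^{k-1}a_j^-t_j}\Big)\prod_{j=0}^{k-1}t_j^{\alpha+\beta-1}\,dt_1\cdots dt_{k-1}\,d\nu^\alpha(u)\,d\nu^\beta(v),$$ where $(t_1,\dots,t_{k-1})$ ranges over $T^{k-1}$ and $t_0=1-\sum_{j=1}^{k-1}t_j$.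
   Context: Identify $\mathbb{R}^2$ with $\mathbb{C}$, with inner product $\langle z,w\rangle=\mathrm{Re}(z\bar w)$, and write $z=|z|e^{i\phi_1}$, $w=|w|e^{i\phi_2}$. The dihedral group $I_{2k}$ (order $4k$) contains the reflections $z\mapsto\bar ze^{ij\pi/k}$, $j=0,\dots,2k-1$, which form two conjugacy classes ($j$ even, containing $z\mapsto\bar z$; and $j$ odd); the multiplicity $\kappa=(\alpha,\beta)$ takes the value $\alpha$ on the roots of the class with $j$ even and $\beta$ on the class with $j$ odd. Dunkl operators: $T_jf(x)=\partial_jf(x)+\sum_{\alpha\in R_+}\kappa(\alpha)\alpha_j\frac{f(x)-f(\sigma_\alpha x)}{\langle\alpha,x\rangle}$; the Dunkl kernel $E_\kappa(x,y)$ is the joint eigenfunction $T_j^{(x)}E_\kappa=y_jE_\kappa$, $E_\kappa(0,y)=1$; the generalized Bessel function is $\mathcal J_\kappa(x,y)=\frac1{|G|}\sum_{g\in G}E_\kappa(x,gy)$. Measures on $[-1,1]$: $d\nu^\alpha(u)=\frac{\Gamma(\alpha+1/2)}{\sqrt\pi\,\Gamma(\alpha)}(1-u^2)^{\alpha-1}du$. Notation: $\xi_{u,v}(\theta_1,\theta_2)=v\cos\theta_1\cos\theta_2+u\sin\theta_1\sin\theta_2$ and $q_{u,v}(\theta_1,\theta_2)=\arccos\xi_{u,v}(\theta_1,\theta_2)\in[0,\pi]$. $T^{n}=\{(t_1,\dots,t_n):t_j>0,\ \sum t_j<1\}$ is the open unit simplex in $\mathbb{R}^n$. *)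

theory Defs
  imports "HOL-Analysis.Analysis"
begin

text \<open>R^2 is identified with the type complex; the inner product on complex
  (real_inner instance) is x \<bullet> y = Re x * Re y + Im x * Im y = Re (x * cnj y).\<close>

definition dih_refl :: "nat \<Rightarrow> nat \<Rightarrow> complex \<Rightarrow> complex" where
  "dih_refl k j z = cnj z * cis (real j * pi / real k)"

definition dih_rot :: "nat \<Rightarrow> nat \<Rightarrow> complex \<Rightarrow> complex" where
  "dih_rot k j z = z * cis (real j * pi / real k)"

text \<open>A (unit) root of the reflection dih_refl k j: sigma_alpha x = x - 2 (alpha.x) alpha.\<close>
definition dih_root :: "nat \<Rightarrow> nat \<Rightarrow> complex" where
  "dih_root k j = \<i> * cis (real j * pi / (2 * real k))"

definition dih_mult :: "nat \<Rightarrow> real \<Rightarrow> real \<Rightarrow> nat \<Rightarrow> real" where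
  "dih_mult k a b j = (if even j then a else b)"

definition dunkl_op :: "nat \<Rightarrow> real \<Rightarrow> real \<Rightarrow> complex \<Rightarrow> (complex \<Rightarrow> real) \<Rightarrow> complex \<Rightarrow> real" where
  "dunkl_op k a b e f x = frechet_derivative f (at x) e
     + (\<Sum>j<2*k. dih_mult k a b j * (dih_root k j \<bullet> e)
          * (f x - f (dih_refl k j x)) / (dih_root k j \<bullet> x))"

text \<open>Points off all mirrors (where the difference quotients are literally defined).\<close>
definition dih_regular :: "nat \<Rightarrow> complex \<Rightarrow> bool" where
  "dih_regular k x \<longleftrightarrow> (\<forall>j<2*k. dih_root k j \<bullet> x \<noteq> 0)"

definition dunkl_kernel :: "nat \<Rightarrow> real \<Rightarrow> real \<Rightarrow> complex \<Rightarrow> complex \<Rightarrow> real" where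
  "dunkl_kernel k a b x y =
     (THE f. (\<forall>p. f differentiable (at p)) \<and> f 0 = 1 \<and>
        (\<forall>p. dih_regular k p \<longrightarrow>
           dunkl_op k a b 1 f p = Re y * f p \<and> dunkl_op k a b \<i> f p = Im y * f p)) x"

definition gen_bessel :: "nat \<Rightarrow> real \<Rightarrow> real \<Rightarrow> complex \<Rightarrow> complex \<Rightarrow> real" where
  "gen_bessel k a b x y =
     (\<Sum>j<2*k. dunkl_kernel k a b x (dih_rot k j y) + dunkl_kernel k a b x (dih_refl k j y))
       / (4 * real k)"

definition nu_density :: "real \<Rightarrow> real \<Rightarrow> real" where
  "nu_density a u = Gamma (a + 1/2) / (sqrt pi * Gamma a) * (1 - u\<^sup>2) powr (a - 1)"

definition xi_uv :: "real \<Rightarrow> real \<Rightarrow> real \<Rightarrow> real \<Rightarrow> real" where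
  "xi_uv u v t1 t2 = v * cos t1 * cos t2 + u * sin t1 * sin t2"

definition q_uv :: "real \<Rightarrow> real \<Rightarrow> real \<Rightarrow> real \<Rightarrow> real" where
  "q_uv u v t1 t2 = arccos (xi_uv u v t1 t2)"

text \<open>Open unit simplex T^n, coordinates indexed by {1..n} (extensional functions,
  i.e. points of the space of PiM {1..n} (\<lambda>_. lborel)).\<close>
definition unit_simplex :: "nat \<Rightarrow> (nat \<Rightarrow> real) set" where
  "unit_simplex n = {t \<in> {1..n} \<rightarrow>\<^sub>E UNIV. (\<forall>j\<in>{1..n}. 0 < t j) \<and> (\<Sum>j=1..n. t j) < 1}"

definition simplex_ext :: "nat \<Rightarrow> (nat \<Rightarrow> real) \<Rightarrow> nat \<Rightarrow> real" where
  "simplex_ext n t j = (if j = 0 then 1 - (\<Sum>i=1..n. t i) else t j)"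

end

theory Submission
  imports Defs "HOL-Complex_Analysis.Cauchy_Integral_Formula" "HOL-Probability.Probability_Measure"
begin

text \<open>The Dunkl kernel is the sum of its homogeneous components, each obtained from the previous one by
  inverting \<open>n + \<Sum>\<^sub>j \<kappa>\<^sub>j (1 - \<sigma>\<^sub>j)\<close>. At two unit vectors, the components weighted with the Pochhammer
  symbols of \<open>k (\<alpha> + \<beta>) + 1\<close> are the coefficients of a power series whose value at \<open>2 t / (1 + t\<^sup>2)\<close> solves
  a first-order equation in \<open>t\<close> coupling the points of an orbit; by an energy estimate the solution is unique.
  An explicit solution is, up to an elementary factor, the classical Poisson kernel times the quotient of
  Dunkl's Poisson kernel of the four-element dihedral group and the classical one, taken at the \<open>k\<close>-th powers.
  Summed over an orbit, it becomes an integral of the power \<open>- (\<alpha> + \<beta>) - 1\<close> of \<open>1 - 2 t\<^sup>k cos q + t\<^sup>2\<^sup>k\<close>.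
  This polynomial splits into \<open>k\<close> quadratic factors, so the Feynman parametrization turns the integral into
  the expectation of the power \<open>- k (\<alpha> + \<beta>) - 1\<close> of \<open>1 - \<Phi> 2 t / (1 + t\<^sup>2)\<close>, where \<open>\<Phi>\<close> is the sum of the
  \<open>cos ((q - 2 j \<pi>) / k) t\<^sub>j\<close>. Comparing coefficients gives the moments of \<open>\<Phi>\<close>, hence the expectation of its
  exponential.\<close>

section \<open>The dihedral group acting on the plane\<close>

lemma periodic_mod:
  fixes h :: "int \<Rightarrow> 'a"
  assumes "\<And>i. h (i + int N) = h i"
  shows "h (i mod int N) = h i"
proof -
  interpret periodic_fun_simple h "int N" by unfold_locales (rule assms)
  show ?thesis
    using plus_of_int[of "i mod int N" "i div int N"] by (simp add: mult.commute)
qed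

lemma range_periodic:
  fixes h :: "int \<Rightarrow> 'a"
  assumes "N > 0" "\<And>i. h (i + int N) = h i"
  shows "range h = (\<lambda>i. h (int i)) ` {..<N}"
proof -
  have "h i \<in> (\<lambda>i. h (int i)) ` {..<N}" for i
    using periodic_mod[of h N i, OF assms(2)] \<open>N > 0\<close>
    by (intro image_eqI[of _ _ "nat (i mod int N)"]) (auto simp: nat_less_iff)
  then show ?thesis by auto
qed

lemma sum_periodic_reflect:
  fixes h :: "int \<Rightarrow> 'a :: comm_monoid_add"
  assumes "\<And>i. h (i + int N) = h i"
  shows "(\<Sum>i<N. h (m - int i)) = (\<Sum>i<N. h (int i))"
proof (rule sum.reindex_bij_witness[of _ "\<lambda>i. nat ((m - int i) mod int N)" "\<lambda>i. nat ((m - int i) mod int N)"])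
  fix i assume "i \<in> {..<N}"
  then have i: "0 < N" "int i mod int N = int i" by auto
  show "nat ((m - int i) mod int N) \<in> {..<N}" using i by (simp add: nat_less_iff)
  show "nat ((m - int (nat ((m - int i) mod int N))) mod int N) = i"
    using i by (simp add: mod_diff_right_eq)
  show "h (int (nat ((m - int i) mod int N))) = h (m - int i)"
    using i periodic_mod[of h N "m - int i", OF assms] by simp
qed (auto simp: nat_less_iff mod_diff_right_eq)

lemma sum_periodic_shift:
  fixes h :: "int \<Rightarrow> 'a :: comm_monoid_add"
  assumes "\<And>i. h (i + int N) = h i"
  shows "(\<Sum>i<N. h (int i + m)) = (\<Sum>i<N. h (int i))"
proof -
  interpret periodic_fun_simple h "int N" by unfold_locales (rule assms)
  have "h (m - (i + int N)) = h (m - i)" for i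
    using minus_1[of "m - i"] by (simp add: algebra_simps)
  then have "(\<Sum>i<N. h (m - (0 - int i))) = (\<Sum>i<N. h (m - int i))"
    by (rule sum_periodic_reflect)
  also have "\<dots> = (\<Sum>i<N. h (int i))" by (rule sum_periodic_reflect) (rule assms)
  finally show ?thesis by (simp add: add.commute)
qed

lemma inner_mult_unit:
  assumes "cmod u = 1"
  shows "(r * u) \<bullet> (x * u) = r \<bullet> x"
proof -
  have "(r * u) \<bullet> (x * u) = (r \<bullet> x) * (cmod u)\<^sup>2"
    unfolding cmod_power2 by (simp add: inner_complex_def power2_eq_square algebra_simps)
  with assms show ?thesis by simp
qed

lemma inner_cnj_left: "cnj r \<bullet> x = r \<bullet> cnj x"
  by (simp add: inner_complex_def)

locale dihedral_group =
  fixes k :: nat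
  assumes k_pos [simp]: "k > 0"
begin

definition zeta :: "int \<Rightarrow> complex" where
  "zeta i = cis (of_int i * pi / real k)"

definition rot :: "int \<Rightarrow> complex \<Rightarrow> complex" where
  "rot i x = x * zeta i"

definition rfl :: "int \<Rightarrow> complex \<Rightarrow> complex" where
  "rfl i x = cnj x * zeta i"

definition orbit :: "complex \<Rightarrow> complex set" where
  "orbit x = range (\<lambda>i. rot i x) \<union> range (\<lambda>i. rfl i x)"

definition orbit_sum :: "(complex \<Rightarrow> real) \<Rightarrow> complex \<Rightarrow> real" where
  "orbit_sum f x = (\<Sum>i<2 * k. f (rot (int i) x) + f (rfl (int i) x))"

lemma zeta_add: "zeta (i + j) = zeta i * zeta j"
  by (simp add: zeta_def cis_mult ring_distribs add_divide_distrib)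

lemma zeta_0 [simp]: "zeta 0 = 1"
  by (simp add: zeta_def)

lemma zeta_period [simp]: "zeta (i + 2 * int k) = zeta i"
proof -
  have "of_int (2 * int k) * pi / real k = 2 * pi" using k_pos by simp
  then have "zeta (2 * int k) = 1" unfolding zeta_def by (simp only: cis_2pi)
  then show ?thesis by (simp add: zeta_add)
qed

lemma cnj_zeta: "cnj (zeta i) = zeta (- i)"
  by (simp add: zeta_def cis_cnj)

lemma norm_zeta [simp]: "cmod (zeta i) = 1"
  by (simp add: zeta_def)

lemma zeta_even: "zeta (2 * int i) = cis (2 * pi * real i / real k)"
  by (simp add: zeta_def mult_ac)

lemma zeta_power: "zeta i ^ k = (if even i then 1 else - 1)"
proof -
  have "zeta i ^ k = cis (of_int i * pi)"
    unfolding zeta_def Complex.DeMoivre using k_pos by simp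
  also have "\<dots> = (if even i then 1 else - 1)"
    by (simp add: complex_eq_iff mult.commute[of _ pi])
  finally show ?thesis .
qed

lemma norm_rot [simp]: "cmod (rot i x) = cmod x"
  by (simp add: rot_def norm_mult)

lemma norm_rfl [simp]: "cmod (rfl i x) = cmod x"
  by (simp add: rfl_def norm_mult)

lemma rot_0 [simp]: "rot 0 x = x"
  by (simp add: rot_def)

lemma rot_period [simp]: "rot (i + 2 * int k) x = rot i x"
  by (simp add: rot_def)

lemma rfl_period [simp]: "rfl (i + 2 * int k) x = rfl i x"
  by (simp add: rfl_def)

lemma rot_rot: "rot j (rot i x) = rot (j + i) x"
  by (simp add: rot_def zeta_add mult_ac)

lemma rot_rfl: "rot j (rfl i x) = rfl (j + i) x"
  by (simp add: rfl_def rot_def zeta_add mult_ac)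

lemma rfl_rot: "rfl j (rot i x) = rfl (j - i) x"
  by (simp add: rfl_def rot_def cnj_zeta diff_conv_add_uminus zeta_add mult_ac del: add_uminus_conv_diff)

lemma rfl_rfl: "rfl j (rfl i x) = rot (j - i) x"
  by (simp add: rfl_def rot_def cnj_zeta diff_conv_add_uminus zeta_add mult_ac del: add_uminus_conv_diff)

lemma rot_scaleR: "rot i (t *\<^sub>R x) = t *\<^sub>R rot i x"
  by (simp add: rot_def)

lemma rfl_scaleR: "rfl i (t *\<^sub>R x) = t *\<^sub>R rfl i x"
  by (simp add: rfl_def)

lemma rot_power: "rot j x ^ k = (if even j then x ^ k else - (x ^ k))"
  by (simp add: rot_def power_mult_distrib zeta_power)

lemma rfl_power: "rfl j x ^ k = (if even j then cnj (x ^ k) else - cnj (x ^ k))"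
  by (simp add: rfl_def power_mult_distrib zeta_power)

lemma inner_rfl_left: "rfl j x \<bullet> y = x \<bullet> rfl j y"
proof -
  have "zeta j * cnj (zeta j) = 1" by (simp add: complex_norm_square[symmetric])
  then have "rfl j x = (cnj x * zeta j)" "y = (y * cnj (zeta j)) * zeta j"
    by (simp_all add: rfl_def mult_ac)
  then have "rfl j x \<bullet> y = cnj x \<bullet> (y * cnj (zeta j))"
    by (metis inner_mult_unit norm_zeta)
  then show ?thesis by (simp add: inner_cnj_left rfl_def)
qed

lemma has_derivative_rot: "(rot i has_derivative rot i) (at x)"
  unfolding rot_def[abs_def] by (auto intro!: derivative_eq_intros)

lemma has_derivative_rfl: "(rfl i has_derivative rfl i) (at x)"
  unfolding rfl_def[abs_def]
  by (auto intro!: derivative_eq_intros bounded_linear.has_derivative[OF bounded_linear_cnj])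

lemma self_in_orbit: "x \<in> orbit x"
  using rot_0[of x] unfolding orbit_def by (metis UnI1 rangeI)

lemma rfl_in_orbit: "p \<in> orbit x \<Longrightarrow> rfl j p \<in> orbit x"
  by (auto simp: orbit_def rfl_rot rfl_rfl)

lemma norm_orbit: "p \<in> orbit x \<Longrightarrow> cmod p = cmod x"
  by (auto simp: orbit_def)

lemma finite_orbit: "finite (orbit x)"
proof -
  have "range (\<lambda>i. rot i x) = (\<lambda>i. rot (int i) x) ` {..<2 * k}"
    "range (\<lambda>i. rfl i x) = (\<lambda>i. rfl (int i) x) ` {..<2 * k}"
    by (rule range_periodic; simp)+
  then show ?thesis by (simp add: orbit_def)
qed

lemma orbit_sum_add: "orbit_sum (\<lambda>p. f p + g p) x = orbit_sum f x + orbit_sum g x"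
  by (simp add: orbit_sum_def sum.distrib)

lemma orbit_sum_diff: "orbit_sum (\<lambda>p. f p - g p) x = orbit_sum f x - orbit_sum g x"
  by (simp add: orbit_sum_def sum.distrib sum_subtractf)

lemma orbit_sum_cmult: "orbit_sum (\<lambda>p. r * f p) x = r * orbit_sum f x"
  by (simp add: orbit_sum_def sum_distrib_left ring_distribs)

lemma orbit_sum_sum: "orbit_sum (\<lambda>p. \<Sum>j\<in>J. f j p) x = (\<Sum>j\<in>J. orbit_sum (f j) x)"
  unfolding orbit_sum_def by (subst sum.swap) (simp add: sum.distrib)

lemma orbit_sum_cong: "(\<And>p. p \<in> orbit x \<Longrightarrow> f p = g p) \<Longrightarrow> orbit_sum f x = orbit_sum g x"
  by (simp add: orbit_sum_def orbit_def)

lemma orbit_sum_mono: "(\<And>p. p \<in> orbit x \<Longrightarrow> f p \<le> g p) \<Longrightarrow> orbit_sum f x \<le> orbit_sum g x"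
  unfolding orbit_sum_def orbit_def by (intro sum_mono add_mono) auto

lemma orbit_sum_nonneg: "(\<And>p. p \<in> orbit x \<Longrightarrow> 0 \<le> f p) \<Longrightarrow> 0 \<le> orbit_sum f x"
  unfolding orbit_sum_def orbit_def by (intro sum_nonneg add_nonneg_nonneg) auto

lemma le_orbit_sum:
  assumes "\<And>p. p \<in> orbit x \<Longrightarrow> 0 \<le> f p"
  shows "f x \<le> orbit_sum f x"
proof -
  have "f (rot (int 0) x) + f (rfl (int 0) x) \<le> orbit_sum f x"
    unfolding orbit_sum_def using assms
    by (intro member_le_sum) (auto simp: orbit_def intro!: add_nonneg_nonneg)
  moreover have "0 \<le> f (rfl 0 x)" by (intro assms rfl_in_orbit self_in_orbit)
  ultimately show ?thesis by simp
qed

lemma orbit_sum_rfl: "orbit_sum (\<lambda>p. f (rfl j p)) x = orbit_sum f x"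
proof -
  have "(\<Sum>i<2 * k. f (rfl (j - int i) x)) = (\<Sum>i<2 * k. f (rfl (int i) x))"
    by (rule sum_periodic_reflect[where h = "\<lambda>i. f (rfl i x)"]) simp
  moreover have "(\<Sum>i<2 * k. f (rot (j - int i) x)) = (\<Sum>i<2 * k. f (rot (int i) x))"
    by (rule sum_periodic_reflect[where h = "\<lambda>i. f (rot i x)"]) simp
  ultimately show ?thesis
    by (simp add: orbit_sum_def rfl_rot rfl_rfl sum.distrib)
qed

lemma sums_orbit_sum:
  "(\<And>p. p \<in> orbit x \<Longrightarrow> (\<lambda>n. f n p) sums g p) \<Longrightarrow> (\<lambda>n. orbit_sum (f n) x) sums orbit_sum g x"
  unfolding orbit_sum_def orbit_def by (intro sums_sum sums_add) auto

lemma continuous_on_orbit_sum: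
  "(\<And>p. p \<in> orbit x \<Longrightarrow> continuous_on S (\<lambda>t. F t p)) \<Longrightarrow> continuous_on S (\<lambda>t. orbit_sum (F t) x)"
  unfolding orbit_sum_def orbit_def by (intro continuous_intros) auto

lemma DERIV_orbit_sum:
  assumes "\<And>p. p \<in> orbit x \<Longrightarrow> ((\<lambda>t. F t p) has_real_derivative F' p) (at t)"
  shows "((\<lambda>t. orbit_sum (F t) x) has_real_derivative orbit_sum F' x) (at t)"
  unfolding orbit_sum_def using assms by (intro DERIV_sum DERIV_add) (auto simp: orbit_def)

definition mirror_normal :: "int \<Rightarrow> complex" where
  "mirror_normal i = \<i> * cis (of_int i * pi / (2 * real k))"

lemma dih_root_eq: "dih_root k j = mirror_normal (int j)"
  by (simp add: dih_root_def mirror_normal_def)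

lemma mirror_normal_period: "mirror_normal (i + 2 * int k) = - mirror_normal i"
proof -
  have angle: "of_int (i + 2 * int k) * pi / (2 * real k) = of_int i * pi / (2 * real k) + pi"
    by (simp add: field_simps)
  show ?thesis unfolding mirror_normal_def angle by (simp add: cis_mult[symmetric])
qed

lemma mirror_normal_add: "mirror_normal (i + 2 * j) = mirror_normal i * zeta j"
  by (simp add: mirror_normal_def zeta_def cis_mult add_divide_distrib ring_distribs)

lemma cnj_mirror_normal: "cnj (mirror_normal i) = - mirror_normal (- i)"
  by (simp add: mirror_normal_def cis_cnj)

lemma mirror_normal_inner_rot: "mirror_normal i \<bullet> rot j x = mirror_normal (i - 2 * j) \<bullet> x"
  using mirror_normal_add[of "i - 2 * j" j] by (simp add: rot_def inner_mult_unit)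

lemma mirror_normal_inner_rfl: "mirror_normal i \<bullet> rfl j x = - (mirror_normal (2 * j - i) \<bullet> x)"
proof -
  have "mirror_normal i \<bullet> rfl j x = cnj (mirror_normal (i - 2 * j)) \<bullet> x"
    using mirror_normal_inner_rot[of i j "cnj x"] by (simp add: rot_def rfl_def inner_cnj_left)
  then show ?thesis by (simp add: cnj_mirror_normal)
qed

lemma rfl_eq_reflection: "rfl j x = x - (2 * (mirror_normal j \<bullet> x)) *\<^sub>R mirror_normal j"
proof -
  define t where "t = of_int j * pi / (2 * real k)"
  have zeta: "zeta j = cis t * cis t"
    by (simp add: zeta_def t_def cis_mult mult.commute)
  have normal: "mirror_normal j = \<i> * cis t"
    by (simp only: mirror_normal_def t_def)
  have unit: "cos t * cos t + sin t * sin t = 1"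
    by (rule sin_cos_squared_add3)
  have "Re (rfl j x) = Re x * (cos t * cos t - sin t * sin t) + Im x * (2 * sin t * cos t)"
    "Im (rfl j x) = Re x * (2 * sin t * cos t) - Im x * (cos t * cos t - sin t * sin t)"
    by (simp_all add: rfl_def zeta algebra_simps)
  moreover have "cos t * cos t - sin t * sin t = 1 - 2 * (sin t * sin t)"
    "cos t * cos t - sin t * sin t = 2 * (cos t * cos t) - 1"
    using unit by linarith+
  ultimately have "Re (rfl j x) = Re x * (1 - 2 * (sin t * sin t)) + Im x * (2 * sin t * cos t)"
    "Im (rfl j x) = Re x * (2 * sin t * cos t) - Im x * (2 * (cos t * cos t) - 1)"
    by simp_all
  then show ?thesis
    by (simp add: complex_eq_iff normal inner_complex_def algebra_simps)
qed

lemma dih_regular_iff: "dih_regular k x \<longleftrightarrow> (\<forall>i. mirror_normal i \<bullet> x \<noteq> 0)"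
proof -
  have "range (\<lambda>i. mirror_normal i \<bullet> x = 0) = (\<lambda>i. mirror_normal (int i) \<bullet> x = 0) ` {..<2 * k}"
    by (rule range_periodic) (simp_all add: mirror_normal_period)
  then have "True \<in> range (\<lambda>i. mirror_normal i \<bullet> x = 0)
      \<longleftrightarrow> True \<in> (\<lambda>i. mirror_normal (int i) \<bullet> x = 0) ` {..<2 * k}"
    by (rule arg_cong)
  then show ?thesis by (auto simp: dih_regular_def dih_root_eq image_iff)
qed

lemma dih_regular_orbit: "dih_regular k x \<Longrightarrow> p \<in> orbit x \<Longrightarrow> dih_regular k p"
  by (auto simp: dih_regular_iff orbit_def mirror_normal_inner_rot mirror_normal_inner_rfl)

lemma dih_regular_scaleR: "dih_regular k x \<Longrightarrow> t \<noteq> 0 \<Longrightarrow> dih_regular k (t *\<^sub>R x)"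
  by (auto simp: dih_regular_def)

lemma closure_dih_regular: "closure {x. dih_regular k x} = UNIV"
proof -
  have "negligible (\<Union>j<2 * k. {x. mirror_normal (int j) \<bullet> x = 0})"
    by (intro negligible_Union) (auto simp: mirror_normal_def intro!: negligible_hyperplane)
  also have "(\<Union>j<2 * k. {x. mirror_normal (int j) \<bullet> x = 0}) = - {x. dih_regular k x}"
    by (auto simp: dih_regular_def dih_root_eq)
  finally have "interior (- {x. dih_regular k x}) = {}"
    using open_not_negligible[OF open_interior] negligible_subset[OF _ interior_subset] by blast
  then show ?thesis by (simp add: closure_interior)
qed

end

section \<open>Dunkl operators and uniqueness of the Dunkl kernel\<close>

lemma gronwall_zero:
  fixes V V' :: "real \<Rightarrow> real"
  assumes cont: "continuous_on {0..d} V" and V_0: "V 0 = 0"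
    and nonneg: "\<And>t. 0 \<le> t \<Longrightarrow> t \<le> d \<Longrightarrow> 0 \<le> V t"
    and deriv: "\<And>t. 0 < t \<Longrightarrow> t < d \<Longrightarrow> (V has_real_derivative V' t) (at t)"
    and bound: "\<And>t. 0 < t \<Longrightarrow> t < d \<Longrightarrow> V' t \<le> C * V t"
    and t: "0 \<le> t" "t \<le> d"
  shows "V t = 0"
proof -
  define W where "W s = V s * exp (- C * s)" for s
  have "W t \<le> W 0"
  proof (rule DERIV_nonpos_imp_decreasing_open[where f = W])
    show "0 \<le> t" by fact
    show "\<exists>y. (W has_real_derivative y) (at s) \<and> y \<le> 0" if "0 < s" "s < t" for s
    proof (intro exI conjI)
      show "(W has_real_derivative (V' s - C * V s) * exp (- C * s)) (at s)"
        unfolding W_def using that t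
        by (auto intro!: derivative_eq_intros deriv simp: algebra_simps)
      show "(V' s - C * V s) * exp (- C * s) \<le> 0"
        using bound[of s] that t by (intro mult_nonpos_nonneg) auto
    qed
    show "continuous_on {0..t} W"
      unfolding W_def using t
      by (intro continuous_intros continuous_on_subset[OF cont]) auto
  qed
  then have "V t \<le> 0" by (simp add: W_def V_0 mult_le_0_iff)
  with nonneg t show ?thesis by (simp add: antisym)
qed

lemma sum_parity:
  fixes u v :: real
  shows "(\<Sum>j<2 * m. if even j then u else v) = real m * (u + v)"
  by (induction m) (auto simp: algebra_simps)

locale multiplicity_pair =
  fixes a b :: real
  assumes a_pos: "a > 0" and b_pos: "b > 0"
begin

abbreviation lam :: real where "lam \<equiv> a + b"

lemma lam_pos: "lam > 0"
  using a_pos b_pos by simp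

end

locale dihedral = dihedral_group k + multiplicity_pair a b
  for k :: nat and a b :: real
begin

abbreviation index :: real where "index \<equiv> real k * lam"

definition kappa :: "int \<Rightarrow> real" where
  "kappa i = (if even i then a else b)"

definition refl_diff :: "(complex \<Rightarrow> real) \<Rightarrow> complex \<Rightarrow> real" where
  "refl_diff f x = (\<Sum>j<2 * k. kappa (int j) * (f x - f (rfl (int j) x)))"

lemma index_pos: "index > 0"
  using lam_pos by simp

lemma kappa_nonneg: "0 \<le> kappa i"
  using a_pos b_pos by (simp add: kappa_def)

lemma sum_kappa: "(\<Sum>j<2 * k. kappa (int j)) = index"
  by (simp add: kappa_def sum_parity)

lemma refl_diff_eq:
  "refl_diff f x = index * f x - (\<Sum>j<2 * k. kappa (int j) * f (rfl (int j) x))"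
  by (simp add: refl_diff_def right_diff_distrib sum_subtractf sum_distrib_right[symmetric] sum_kappa)

lemma refl_diff_add: "refl_diff (\<lambda>x. f x + g x) x = refl_diff f x + refl_diff g x"
  by (simp add: refl_diff_def sum.distrib[symmetric] algebra_simps)

lemma refl_diff_diff: "refl_diff (\<lambda>x. f x - g x) x = refl_diff f x - refl_diff g x"
  by (simp add: refl_diff_def sum_subtractf[symmetric] algebra_simps)

lemma refl_diff_cmult: "refl_diff (\<lambda>x. r * f x) x = r * refl_diff f x"
  by (simp add: refl_diff_def sum_distrib_left algebra_simps)

lemma orbit_sum_mult_refl_diff:
  "2 * orbit_sum (\<lambda>p. f p * refl_diff f p) x
    = (\<Sum>j<2 * k. kappa (int j) * orbit_sum (\<lambda>p. (f p - f (rfl (int j) p))\<^sup>2) x)"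
proof -
  have sym: "2 * orbit_sum (\<lambda>p. f p * (f p - f (rfl j p))) x
      = orbit_sum (\<lambda>p. (f p - f (rfl j p))\<^sup>2) x" for j
  proof -
    have "2 * orbit_sum (\<lambda>p. f p * (f p - f (rfl j p))) x
        = orbit_sum (\<lambda>p. (f p - f (rfl j p))\<^sup>2) x
          + (orbit_sum (\<lambda>p. (f p)\<^sup>2) x - orbit_sum (\<lambda>p. (f (rfl j p))\<^sup>2) x)"
      unfolding orbit_sum_cmult[symmetric] orbit_sum_add[symmetric] orbit_sum_diff[symmetric]
      by (intro orbit_sum_cong) (simp add: power2_eq_square algebra_simps)
    then show ?thesis by (simp add: orbit_sum_rfl[of "\<lambda>p. (f p)\<^sup>2"])
  qed
  have "orbit_sum (\<lambda>p. f p * refl_diff f p) x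
      = (\<Sum>j<2 * k. kappa (int j) * orbit_sum (\<lambda>p. f p * (f p - f (rfl (int j) p))) x)"
    unfolding orbit_sum_cmult[symmetric] orbit_sum_sum[symmetric] refl_diff_def
    by (simp add: sum_distrib_left mult_ac)
  then show ?thesis
    by (simp add: sym[symmetric] sum_distrib_left mult.left_commute)
qed

lemma orbit_sum_mult_refl_diff_nonneg: "0 \<le> orbit_sum (\<lambda>p. f p * refl_diff f p) x"
proof -
  have "0 \<le> (\<Sum>j<2 * k. kappa (int j) * orbit_sum (\<lambda>p. (f p - f (rfl (int j) p))\<^sup>2) x)"
    by (intro sum_nonneg mult_nonneg_nonneg kappa_nonneg orbit_sum_nonneg) auto
  then show ?thesis using orbit_sum_mult_refl_diff[of f x] by linarith
qed

text \<open>The weighted energy \<open>V t = orbit_sum (\<lambda>p. w t p * (F t p)\<^sup>2) x\<close> satisfies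
  \<open>V' \<le> C * V\<close>, because the singular term contributes with a good sign.\<close>

lemma radial_equation_unique:
  fixes F F' w w' c :: "real \<Rightarrow> complex \<Rightarrow> real" and e :: "real \<Rightarrow> real"
  assumes cont_F: "\<And>p. p \<in> orbit x \<Longrightarrow> continuous_on {0..d} (\<lambda>t. F t p)"
    and cont_w: "\<And>p. p \<in> orbit x \<Longrightarrow> continuous_on {0..d} (\<lambda>t. w t p)"
    and F_0: "\<And>p. p \<in> orbit x \<Longrightarrow> F 0 p = 0"
    and F': "\<And>t p. 0 < t \<Longrightarrow> t < d \<Longrightarrow> p \<in> orbit x \<Longrightarrow>
      ((\<lambda>t. F t p) has_real_derivative F' t p) (at t)"
    and w': "\<And>t p. 0 < t \<Longrightarrow> t < d \<Longrightarrow> p \<in> orbit x \<Longrightarrow>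
      ((\<lambda>t. w t p) has_real_derivative w' t p) (at t)"
    and w_pos: "\<And>t p. 0 \<le> t \<Longrightarrow> t \<le> d \<Longrightarrow> p \<in> orbit x \<Longrightarrow> 0 < w t p"
    and e: "\<And>t. 0 < t \<Longrightarrow> t < d \<Longrightarrow> 0 \<le> e t"
    and eq: "\<And>t p. 0 < t \<Longrightarrow> t < d \<Longrightarrow> p \<in> orbit x \<Longrightarrow>
      t * (w t p * F' t p) = t * (c t p * F t p) - e t * refl_diff (F t) p"
    and bound: "\<And>t p. 0 < t \<Longrightarrow> t < d \<Longrightarrow> p \<in> orbit x \<Longrightarrow> w' t p + 2 * c t p \<le> C * w t p"
    and t: "0 \<le> t" "t \<le> d"
  shows "F t x = 0"
proof -
  define V where "V t = orbit_sum (\<lambda>p. w t p * (F t p)\<^sup>2) x" for t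
  define V' where "V' t = orbit_sum (\<lambda>p. w' t p * (F t p)\<^sup>2 + 2 * F t p * (w t p * F' t p)) x" for t
  have nonneg: "0 \<le> w t p * (F t p)\<^sup>2" if "0 \<le> t" "t \<le> d" "p \<in> orbit x" for t p
    using w_pos[OF that] by simp
  have "V t = 0"
  proof (rule gronwall_zero[where V = V and V' = V' and C = C and d = d])
    show "continuous_on {0..d} V"
      unfolding V_def by (intro continuous_on_orbit_sum continuous_intros cont_F cont_w)
    show "V 0 = 0"
      using orbit_sum_cong[of x "\<lambda>p. w 0 p * (F 0 p)\<^sup>2" "\<lambda>_. 0"] F_0 by (simp add: V_def orbit_sum_def)
    show "0 \<le> V t" if "0 \<le> t" "t \<le> d" for t
      unfolding V_def by (intro orbit_sum_nonneg nonneg that)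
  next
    fix t assume t: "0 < t" "t < d"
    show "(V has_real_derivative V' t) (at t)"
      unfolding V_def V'_def using t
      by (intro DERIV_orbit_sum) (auto intro!: derivative_eq_intros F' w')
    have wF': "w t p * F' t p = c t p * F t p - e t / t * refl_diff (F t) p" if "p \<in> orbit x" for p
      using eq[OF t that] t by (simp add: field_simps)
    have "V' t = orbit_sum (\<lambda>p. (w' t p + 2 * c t p) * (F t p)\<^sup>2
        - 2 * (e t / t) * (F t p * refl_diff (F t) p)) x"
      unfolding V'_def
      by (intro orbit_sum_cong, simp only: wF') (simp add: power2_eq_square algebra_simps)
    also have "\<dots> \<le> orbit_sum (\<lambda>p. (w' t p + 2 * c t p) * (F t p)\<^sup>2) x"
      unfolding orbit_sum_diff orbit_sum_cmult
      using orbit_sum_mult_refl_diff_nonneg[of "F t" x] e[OF t] t by simp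
    also have "\<dots> \<le> orbit_sum (\<lambda>p. C * (w t p * (F t p)\<^sup>2)) x"
      using bound[OF t] by (intro orbit_sum_mono) (simp add: mult_right_mono mult.assoc[symmetric])
    finally show "V' t \<le> C * V t" by (simp add: V_def orbit_sum_cmult)
  qed (use t in auto)
  moreover have "w t x * (F t x)\<^sup>2 \<le> V t"
    unfolding V_def by (intro le_orbit_sum nonneg t)
  ultimately show ?thesis
    using w_pos[OF t self_in_orbit] by (auto simp: mult_le_0_iff)
qed

lemma dunkl_op_eq:
  assumes "(f has_derivative f') (at x)"
  shows "dunkl_op k a b e f x = f' e
    + (\<Sum>j<2 * k. kappa (int j) * (mirror_normal (int j) \<bullet> e)
        * (f x - f (rfl (int j) x)) / (mirror_normal (int j) \<bullet> x))"
proof -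
  have "dih_mult k a b j = kappa (int j)" "dih_refl k j x = rfl (int j) x" for j
    by (simp_all add: dih_mult_def kappa_def dih_refl_def rfl_def zeta_def)
  then show ?thesis
    by (simp add: dunkl_op_def dih_root_eq frechet_derivative_at[OF assms, symmetric])
qed

lemma linear_dunkl_op:
  assumes "f differentiable (at x)"
  shows "linear (\<lambda>e. dunkl_op k a b e f x)"
proof -
  from assms obtain f' where f': "(f has_derivative f') (at x)"
    by (auto simp: differentiable_def)
  interpret linear f' by (rule has_derivative_linear[OF f'])
  show ?thesis
    by (intro linearI; simp add: dunkl_op_eq[OF f'] add scale inner_add_right ring_distribs
        add_divide_distrib sum.distrib sum_distrib_left mult_ac)
qed

lemma dunkl_op_add:
  assumes "f differentiable (at x)" "g differentiable (at x)"
  shows "dunkl_op k a b e (\<lambda>x. f x + g x) x = dunkl_op k a b e f x + dunkl_op k a b e g x"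
proof -
  obtain f' g' where f': "(f has_derivative f') (at x)" and g': "(g has_derivative g') (at x)"
    using assms by (auto simp: differentiable_def)
  show ?thesis
    unfolding dunkl_op_eq[OF has_derivative_add[OF f' g']] dunkl_op_eq[OF f'] dunkl_op_eq[OF g']
    by (simp add: sum.distrib[symmetric] add_divide_distrib[symmetric] algebra_simps)
qed

lemma dunkl_op_cmult:
  assumes "f differentiable (at x)"
  shows "dunkl_op k a b e (\<lambda>x. r * f x) x = r * dunkl_op k a b e f x"
proof -
  obtain f' where f': "(f has_derivative f') (at x)"
    using assms by (auto simp: differentiable_def)
  show ?thesis
    unfolding dunkl_op_eq[OF has_derivative_mult_right[OF f']] dunkl_op_eq[OF f']
    by (simp add: sum_distrib_left algebra_simps)
qed

lemma dunkl_op_diff: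
  assumes f: "f differentiable (at x)" and g: "g differentiable (at x)"
  shows "dunkl_op k a b e (\<lambda>x. f x - g x) x = dunkl_op k a b e f x - dunkl_op k a b e g x"
proof -
  have "(\<lambda>x. (- 1) * g x) differentiable (at x)" using g by simp
  from dunkl_op_add[OF f this, of e] show ?thesis by (simp only: dunkl_op_cmult[OF g]) simp
qed

lemma dunkl_op_const: "dunkl_op k a b e (\<lambda>_. r) x = 0"
  by (simp add: dunkl_op_eq[OF has_derivative_const])

lemma dunkl_op_sum:
  assumes "\<And>j. f j differentiable (at x)"
  shows "dunkl_op k a b e (\<lambda>x. \<Sum>j<(m :: nat). f j x) x = (\<Sum>j<m. dunkl_op k a b e (f j) x)"
proof (induction m)
  case (Suc m)
  have "(\<lambda>x. \<Sum>j<m. f j x) differentiable (at x)"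
    by (intro differentiable_sum) (auto simp: assms)
  with Suc show ?case by (simp add: dunkl_op_add assms)
qed (simp add: dunkl_op_const)

lemma dunkl_op_radial:
  assumes "dih_regular k x" "f differentiable (at x)"
  shows "dunkl_op k a b x f x = frechet_derivative f (at x) x + refl_diff f x"
proof -
  have "mirror_normal (int j) \<bullet> x \<noteq> 0" for j
    using assms(1) by (simp add: dih_regular_iff)
  then show ?thesis
    using assms(2) by (simp add: dunkl_op_eq frechet_derivative_works refl_diff_def)
qed

definition dunkl_eigen :: "complex \<Rightarrow> (complex \<Rightarrow> real) \<Rightarrow> bool" where
  "dunkl_eigen y f \<longleftrightarrow> (\<forall>x. f differentiable (at x)) \<and>
     (\<forall>x e. dih_regular k x \<longrightarrow> dunkl_op k a b e f x = (e \<bullet> y) * f x)"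

lemma dunkl_kernel_eq: "dunkl_kernel k a b x y = (THE f. dunkl_eigen y f \<and> f 0 = 1) x"
proof -
  have "(dunkl_op k a b 1 f x = Re y * f x \<and> dunkl_op k a b \<i> f x = Im y * f x)
      \<longleftrightarrow> (\<forall>e. dunkl_op k a b e f x = (e \<bullet> y) * f x)" if "f differentiable (at x)" for f x
  proof
    assume coordinates: "dunkl_op k a b 1 f x = Re y * f x \<and> dunkl_op k a b \<i> f x = Im y * f x"
    interpret linear "\<lambda>e. dunkl_op k a b e f x" by (rule linear_dunkl_op[OF that])
    show "\<forall>e. dunkl_op k a b e f x = (e \<bullet> y) * f x"
    proof
      fix e
      have "dunkl_op k a b e f x = dunkl_op k a b (Re e *\<^sub>R 1 + Im e *\<^sub>R \<i>) f x"
        by (rule arg_cong[where f = "\<lambda>e. dunkl_op k a b e f x"]) (simp add: complex_eq_iff)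
      also have "\<dots> = Re e * dunkl_op k a b 1 f x + Im e * dunkl_op k a b \<i> f x"
        by (simp only: add scale real_scaleR_def)
      finally show "dunkl_op k a b e f x = (e \<bullet> y) * f x"
        using coordinates by (simp add: inner_complex_def algebra_simps)
    qed
  next
    assume "\<forall>e. dunkl_op k a b e f x = (e \<bullet> y) * f x"
    then show "dunkl_op k a b 1 f x = Re y * f x \<and> dunkl_op k a b \<i> f x = Im y * f x"
      by (simp add: inner_complex_def)
  qed
  then have "(\<forall>x. f differentiable (at x)) \<and> f 0 = 1 \<and> (\<forall>x. dih_regular k x \<longrightarrow>
        dunkl_op k a b 1 f x = Re y * f x \<and> dunkl_op k a b \<i> f x = Im y * f x)
      \<longleftrightarrow> dunkl_eigen y f \<and> f 0 = 1" for f
    unfolding dunkl_eigen_def by blast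
  then show ?thesis unfolding dunkl_kernel_def by simp
qed

lemma dunkl_eigen_diff:
  assumes "dunkl_eigen y f" "dunkl_eigen y g"
  shows "dunkl_eigen y (\<lambda>x. f x - g x)"
  using assms by (auto simp: dunkl_eigen_def dunkl_op_diff right_diff_distrib intro: differentiable_diff)

lemma dunkl_eigen_zero_regular:
  assumes f: "dunkl_eigen y f" and f_0: "f 0 = 0" and x: "dih_regular k x"
  shows "f x = 0"
proof -
  let ?D = "\<lambda>p. frechet_derivative f (at p)"
  have diff: "f differentiable (at p)" for p
    using f by (simp add: dunkl_eigen_def)
  have ray: "((\<lambda>t. f (t *\<^sub>R p)) has_real_derivative ?D (t *\<^sub>R p) p) (at t)" for t p
  proof -
    have "(f has_derivative ?D (t *\<^sub>R p)) (at (t *\<^sub>R p))"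
      using diff frechet_derivative_works by blast
    then have "((\<lambda>t. f (t *\<^sub>R p)) has_derivative (\<lambda>h. ?D (t *\<^sub>R p) (h *\<^sub>R p))) (at t)"
      by (rule has_derivative_compose[rotated]) (auto intro!: derivative_eq_intros)
    then show ?thesis
      using linear_scale[OF linear_frechet_derivative[OF diff]]
      by (simp add: has_field_derivative_def mult.commute[of "?D (t *\<^sub>R p) p"] mult_commute_abs)
  qed
  have "f (1 *\<^sub>R x) = 0"
  proof (rule radial_equation_unique[where F = "\<lambda>t p. f (t *\<^sub>R p)" and w = "\<lambda>_ _. 1" and e = "\<lambda>_. 1"
        and c = "\<lambda>_ p. p \<bullet> y" and F' = "\<lambda>t p. ?D (t *\<^sub>R p) p" and w' = "\<lambda>_ _. 0" and d = 1])
    show "continuous_on {0..1} (\<lambda>t. f (t *\<^sub>R p))" for p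
      by (rule DERIV_continuous_on[OF has_field_derivative_at_within[OF ray]])
    show "t * (1 * ?D (t *\<^sub>R p) p)
        = t * ((p \<bullet> y) * f (t *\<^sub>R p)) - 1 * refl_diff (\<lambda>p. f (t *\<^sub>R p)) p"
      if t: "0 < t" and "p \<in> orbit x" for t p
    proof -
      have reg: "dih_regular k (t *\<^sub>R p)"
        using t x \<open>p \<in> orbit x\<close> by (auto intro: dih_regular_scaleR dih_regular_orbit)
      have "?D (t *\<^sub>R p) (t *\<^sub>R p) + refl_diff f (t *\<^sub>R p) = (t *\<^sub>R p \<bullet> y) * f (t *\<^sub>R p)"
        using f reg dunkl_op_radial[OF reg diff] by (simp add: dunkl_eigen_def)
      moreover have "?D (t *\<^sub>R p) (t *\<^sub>R p) = t * ?D (t *\<^sub>R p) p"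
        using linear_scale[OF linear_frechet_derivative[OF diff]] by simp
      moreover have "refl_diff f (t *\<^sub>R p) = refl_diff (\<lambda>p. f (t *\<^sub>R p)) p"
        by (simp add: refl_diff_def rfl_scaleR)
      ultimately show ?thesis by simp
    qed
    show "0 + 2 * (p \<bullet> y) \<le> (2 * (cmod x * cmod y)) * 1" if "p \<in> orbit x" for p
      using norm_cauchy_schwarz[of p y] norm_orbit[OF that] by simp
  qed (use f_0 ray in auto)
  then show ?thesis by simp
qed

lemma dunkl_eigen_unique:
  assumes f: "dunkl_eigen y f" and g: "dunkl_eigen y g" and "f 0 = g 0"
  shows "f = g"
proof
  fix x
  have diff: "dunkl_eigen y (\<lambda>x. f x - g x)" by (rule dunkl_eigen_diff[OF f g])
  then have "closed {x. f x - g x = 0}"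
    using differentiable_imp_continuous_within[of _ _ UNIV]
    by (intro closed_Collect_eq) (auto simp: dunkl_eigen_def continuous_on_eq_continuous_within)
  then have "closure {x. dih_regular k x} \<subseteq> {x. f x - g x = 0}"
    using dunkl_eigen_zero_regular[OF diff] assms(3) by (intro closure_minimal) auto
  then show "f x = g x" by (auto simp: closure_dih_regular)
qed

lemma dunkl_kernel_eqI:
  assumes "dunkl_eigen y f" "f 0 = 1"
  shows "dunkl_kernel k a b x y = f x"
proof -
  have "(THE f. dunkl_eigen y f \<and> f 0 = 1) = f"
    using assms by (intro the_equality) (auto intro!: dunkl_eigen_unique)
  then show ?thesis by (simp add: dunkl_kernel_eq)
qed

end

section \<open>Inverting the radial operator\<close>

definition deriv_bounded :: "('a :: real_normed_vector \<Rightarrow> 'b :: real_normed_vector) \<Rightarrow> 'a \<Rightarrow> real \<Rightarrow> bool" where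
  "deriv_bounded f x M \<longleftrightarrow> (\<exists>f'. (f has_derivative f') (at x) \<and> (\<forall>h. norm (f' h) \<le> M * norm h))"

lemma deriv_bounded_const: "deriv_bounded (\<lambda>_. r) x 0"
  unfolding deriv_bounded_def by (intro exI[of _ "\<lambda>_. 0"]) auto

lemma deriv_bounded_nonneg:
  fixes f :: "complex \<Rightarrow> 'b :: real_normed_vector"
  assumes "deriv_bounded f x M"
  shows "0 \<le> M"
proof -
  from assms obtain f' :: "complex \<Rightarrow> 'b" where "\<And>h. norm (f' h) \<le> M * cmod h"
    by (auto simp: deriv_bounded_def)
  from order_trans[OF norm_ge_zero this[of 1]] show ?thesis by simp
qed

lemma deriv_bounded_mono: "deriv_bounded f x M \<Longrightarrow> M \<le> N \<Longrightarrow> deriv_bounded f x N"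
  unfolding deriv_bounded_def by (meson mult_right_mono norm_ge_zero order_trans)

lemma deriv_bounded_add:
  assumes "deriv_bounded f x M" "deriv_bounded g x N"
  shows "deriv_bounded (\<lambda>x. f x + g x) x (M + N)"
proof -
  from assms obtain f' g' where "(f has_derivative f') (at x)" "\<And>h. norm (f' h) \<le> M * norm h"
    "(g has_derivative g') (at x)" "\<And>h. norm (g' h) \<le> N * norm h"
    by (auto simp: deriv_bounded_def)
  then show ?thesis unfolding deriv_bounded_def
    by (intro exI[of _ "\<lambda>h. f' h + g' h"])
      (auto intro!: has_derivative_add norm_triangle_le add_mono simp: distrib_right)
qed

lemma deriv_bounded_sum:
  assumes "finite A" "\<And>i. i \<in> A \<Longrightarrow> deriv_bounded (f i) x (M i)"
  shows "deriv_bounded (\<lambda>x. \<Sum>i\<in>A. f i x) x (\<Sum>i\<in>A. M i)"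
  using assms by (induction A rule: finite_induct) (auto intro: deriv_bounded_const deriv_bounded_add)

lemma deriv_bounded_mult:
  fixes f g :: "'a :: real_normed_vector \<Rightarrow> real"
  assumes "deriv_bounded f x M" "deriv_bounded g x N"
  shows "deriv_bounded (\<lambda>x. f x * g x) x (\<bar>f x\<bar> * N + \<bar>g x\<bar> * M)"
proof -
  from assms obtain f' g' where f': "(f has_derivative f') (at x)" "\<And>h. norm (f' h) \<le> M * norm h"
    and g': "(g has_derivative g') (at x)" "\<And>h. norm (g' h) \<le> N * norm h"
    by (auto simp: deriv_bounded_def)
  have "norm (f x * g' h + f' h * g x) \<le> (\<bar>f x\<bar> * N + \<bar>g x\<bar> * M) * norm h" for h
  proof -
    have "norm (f x * g' h + f' h * g x) \<le> \<bar>f x\<bar> * norm (g' h) + \<bar>g x\<bar> * norm (f' h)"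
      by (rule norm_triangle_le) (simp add: abs_mult)
    also have "\<dots> \<le> \<bar>f x\<bar> * (N * norm h) + \<bar>g x\<bar> * (M * norm h)"
      by (intro add_mono mult_left_mono f' g') auto
    finally show ?thesis by (simp add: algebra_simps)
  qed
  with has_derivative_mult[OF f'(1) g'(1)] show ?thesis
    unfolding deriv_bounded_def by blast
qed

lemma deriv_bounded_cmult:
  fixes f :: "'a :: real_normed_vector \<Rightarrow> real"
  assumes "deriv_bounded f x M" "\<bar>r\<bar> \<le> R" "0 \<le> M"
  shows "deriv_bounded (\<lambda>x. r * f x) x (R * M)"
  using deriv_bounded_mult[OF deriv_bounded_const[of r x] assms(1)] assms(2,3)
  by (auto elim!: deriv_bounded_mono intro: mult_right_mono)

lemma deriv_bounded_inner: "deriv_bounded (\<lambda>x. x \<bullet> y) x (norm y)"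
  unfolding deriv_bounded_def using Cauchy_Schwarz_ineq2[of _ y]
  by (intro exI[of _ "\<lambda>h. h \<bullet> y"]) (auto intro!: derivative_eq_intros simp: mult.commute[of "norm y"])

lemma deriv_bounded_compose_isometry:
  assumes "deriv_bounded f (g x) M" "(g has_derivative g') (at x)" "\<And>h. norm (g' h) = norm h"
  shows "deriv_bounded (\<lambda>x. f (g x)) x M"
proof -
  from assms(1) obtain f' where f': "(f has_derivative f') (at (g x))" "\<And>h. norm (f' h) \<le> M * norm h"
    by (auto simp: deriv_bounded_def)
  have "norm (f' (g' h)) \<le> M * norm h" for h
    using f'(2)[of "g' h"] assms(3) by simp
  with has_derivative_compose[OF assms(2) f'(1)] show ?thesis
    unfolding deriv_bounded_def by blast
qed

context dihedral
begin

lemma orbit_maximum_principle: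
  assumes n: "n > 0"
    and le: "\<And>p. p \<in> orbit x \<Longrightarrow>
      (n + index) * \<bar>g p\<bar> \<le> M + (\<Sum>j<2 * k. kappa (int j) * \<bar>g (rfl (int j) p)\<bar>)"
  shows "n * \<bar>g x\<bar> \<le> M"
proof -
  define G where "G = Max ((\<lambda>p. \<bar>g p\<bar>) ` orbit x)"
  have G_upper: "\<bar>g p\<bar> \<le> G" if "p \<in> orbit x" for p
    unfolding G_def using that finite_orbit by (intro Max_ge) auto
  have "G \<in> (\<lambda>p. \<bar>g p\<bar>) ` orbit x"
    unfolding G_def using finite_orbit self_in_orbit by (intro Max_in) auto
  then obtain q where q: "q \<in> orbit x" "\<bar>g q\<bar> = G" by auto
  have "(\<Sum>j<2 * k. kappa (int j) * \<bar>g (rfl (int j) q)\<bar>) \<le> (\<Sum>j<2 * k. kappa (int j) * G)"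
    using q by (intro sum_mono mult_left_mono G_upper rfl_in_orbit kappa_nonneg)
  also have "\<dots> = index * G" by (simp add: sum_distrib_right[symmetric] sum_kappa)
  finally have "n * G \<le> M" using le[OF q(1)] q(2) by (simp add: distrib_right)
  moreover have "n * \<bar>g x\<bar> \<le> n * G"
    using n by (intro mult_left_mono G_upper self_in_orbit) auto
  ultimately show ?thesis by linarith
qed

lemma radial_solution_bound:
  assumes n: "n > 0"
    and eq: "\<And>p. p \<in> orbit x \<Longrightarrow> n * g p + refl_diff g p = f p"
    and f: "\<And>p. p \<in> orbit x \<Longrightarrow> \<bar>f p\<bar> \<le> M"
  shows "\<bar>g x\<bar> \<le> M / n"
proof -
  have "n * \<bar>g x\<bar> \<le> M"
  proof (rule orbit_maximum_principle[OF n])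
    fix p assume p: "p \<in> orbit x"
    have "(n + index) * \<bar>g p\<bar> = \<bar>(n + index) * g p\<bar>"
      using n index_pos by (simp add: abs_mult)
    also have "(n + index) * g p = f p + (\<Sum>j<2 * k. kappa (int j) * g (rfl (int j) p))"
      using eq[OF p] by (simp add: refl_diff_eq algebra_simps)
    also have "\<bar>\<dots>\<bar> \<le> M + (\<Sum>j<2 * k. \<bar>kappa (int j) * g (rfl (int j) p)\<bar>)"
      by (intro order.trans[OF abs_triangle_ineq] add_mono f p sum_abs)
    finally show "(n + index) * \<bar>g p\<bar> \<le> M + (\<Sum>j<2 * k. kappa (int j) * \<bar>g (rfl (int j) p)\<bar>)"
      by (simp add: abs_mult kappa_nonneg)
  qed
  then show ?thesis using n by (simp add: field_simps)
qed

text \<open>For signs \<open>e\<close> and \<open>d\<close> there is a character of the group with the value \<open>e\<close> on the reflections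
  of one class and \<open>d\<close> on those of the other.\<close>

definition rot_sign :: "real \<Rightarrow> real \<Rightarrow> int \<Rightarrow> real" where
  "rot_sign e d i = (if even i then 1 else e * d)"

definition rfl_sign :: "real \<Rightarrow> real \<Rightarrow> int \<Rightarrow> real" where
  "rfl_sign e d i = (if even i then e else d)"

definition char_mean :: "real \<Rightarrow> real \<Rightarrow> (complex \<Rightarrow> real) \<Rightarrow> complex \<Rightarrow> real" where
  "char_mean e d f x = (\<Sum>i<2 * k. rot_sign e d (int i) * f (rot (int i) x)
     + rfl_sign e d (int i) * f (rfl (int i) x)) / (4 * real k)"

definition char_eigenvalue :: "real \<Rightarrow> real \<Rightarrow> real" where
  "char_eigenvalue e d = real k * (a * (1 - e) + b * (1 - d))"

lemma char_mean_rfl: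
  assumes sgn: "e \<in> {1, -1}" "d \<in> {1, -1}"
  shows "char_mean e d f (rfl j x) = rfl_sign e d j * char_mean e d f x"
proof -
  have "(\<Sum>i<2 * k. rot_sign e d (int i) * f (rfl (int i + j) x))
      = (\<Sum>i<2 * k. rfl_sign e d j * (rfl_sign e d (int i + j) * f (rfl (int i + j) x)))"
    using sgn by (intro sum.cong) (auto simp: rot_sign_def rfl_sign_def)
  also have "\<dots> = (\<Sum>i<2 * k. rfl_sign e d j * (rfl_sign e d (int i) * f (rfl (int i) x)))"
    by (rule sum_periodic_shift[where h = "\<lambda>i. rfl_sign e d j * (rfl_sign e d i * f (rfl i x))"])
      (simp add: rfl_sign_def)
  finally have rot: "(\<Sum>i<2 * k. rot_sign e d (int i) * f (rfl (int i + j) x)) = \<dots>" .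
  have "(\<Sum>i<2 * k. rfl_sign e d (int i) * f (rot (int i - j) x))
      = (\<Sum>i<2 * k. rfl_sign e d j * (rot_sign e d (int i + - j) * f (rot (int i + - j) x)))"
    using sgn by (intro sum.cong) (auto simp: rot_sign_def rfl_sign_def)
  also have "\<dots> = (\<Sum>i<2 * k. rfl_sign e d j * (rot_sign e d (int i) * f (rot (int i) x)))"
    by (rule sum_periodic_shift[where h = "\<lambda>i. rfl_sign e d j * (rot_sign e d i * f (rot i x))"])
      (simp add: rot_sign_def)
  finally show ?thesis
    unfolding char_mean_def rot_rfl rfl_rfl sum.distrib rot
    by (simp add: sum_distrib_left[symmetric] distrib_left)
qed

lemma refl_diff_char_mean:
  assumes "e \<in> {1, -1}" "d \<in> {1, -1}"
  shows "refl_diff (char_mean e d f) x = char_eigenvalue e d * char_mean e d f x"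
proof -
  have "refl_diff (char_mean e d f) x
      = (\<Sum>j<2 * k. if even j then a * (1 - e) else b * (1 - d)) * char_mean e d f x"
    unfolding refl_diff_def char_mean_rfl[OF assms] sum_distrib_right
    by (intro sum.cong) (auto simp: kappa_def rfl_sign_def algebra_simps)
  then show ?thesis by (simp add: sum_parity char_eigenvalue_def)
qed

lemma sum_kappa_rfl_eq_char_means:
  "(\<Sum>j<2 * k. kappa (int j) * f (rfl (int j) x))
    = (\<Sum>e\<in>{1, -1}. \<Sum>d\<in>{1, -1}. real k * (a * e + b * d) * char_mean e d f x)"
proof -
  have "real k * r * char_mean e d f x = (\<Sum>i<2 * k. r / 4 *
      (rot_sign e d (int i) * f (rot (int i) x) + rfl_sign e d (int i) * f (rfl (int i) x)))" for r e d
    unfolding char_mean_def sum_distrib_left[symmetric] by simp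
  then have "(\<Sum>e\<in>{1, -1}. \<Sum>d\<in>{1, -1}. real k * (a * e + b * d) * char_mean e d f x)
      = (\<Sum>i<2 * k. \<Sum>e\<in>{1, -1}. \<Sum>d\<in>{1, -1}. (a * e + b * d) / 4 *
          (rot_sign e d (int i) * f (rot (int i) x) + rfl_sign e d (int i) * f (rfl (int i) x)))"
    by (simp only:) (simp add: sum.distrib)
  also have "\<dots> = (\<Sum>j<2 * k. kappa (int j) * f (rfl (int j) x))"
    by (intro sum.cong) (auto simp: rot_sign_def rfl_sign_def kappa_def field_simps)
  finally show ?thesis ..
qed

definition resolvent :: "real \<Rightarrow> (complex \<Rightarrow> real) \<Rightarrow> complex \<Rightarrow> real" where
  "resolvent n f x =
     1 / (n + index) * (f x + (\<Sum>e\<in>{1, -1}. \<Sum>d\<in>{1, -1}. - 1 * char_mean e d f x))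
     + (\<Sum>e\<in>{1, -1}. \<Sum>d\<in>{1, -1}. 1 / (n + char_eigenvalue e d) * char_mean e d f x)"

lemma refl_diff_sum: "refl_diff (\<lambda>x. \<Sum>i\<in>I. g i x) x = (\<Sum>i\<in>I. refl_diff (g i) x)"
  unfolding refl_diff_def sum_subtractf[symmetric] sum_distrib_left by (rule sum.swap)

lemma char_eigenvalue_nonneg:
  assumes "e \<in> {1, -1}" "d \<in> {1, -1}"
  shows "0 \<le> char_eigenvalue e d"
  using assms a_pos b_pos by (auto simp: char_eigenvalue_def)

text \<open>The means over the four characters span the functions that are invariant under \<open>rot 2\<close>; on the
  complement \<open>refl_diff\<close> is multiplication by \<open>index\<close>.\<close>

lemma resolvent_eq:
  assumes n: "n > 0"
  shows "n * resolvent n f x + refl_diff (resolvent n f) x = f x"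
proof -
  let ?P = "\<lambda>e d. char_mean e d f x" and ?m = char_eigenvalue and ?S = "{1, -1} :: real set"
  define T where "T = (\<Sum>e\<in>?S. \<Sum>d\<in>?S. ?P e d)"
  have pos: "n + index > 0" "\<And>e d. e \<in> ?S \<Longrightarrow> d \<in> ?S \<Longrightarrow> n + ?m e d > 0"
    using n index_pos char_eigenvalue_nonneg by (auto intro: add_pos_nonneg)
  have "refl_diff f x - (\<Sum>e\<in>?S. \<Sum>d\<in>?S. ?m e d * ?P e d)
      = index * f x - (\<Sum>e\<in>?S. \<Sum>d\<in>?S. (real k * (a * e + b * d) + ?m e d) * ?P e d)"
    unfolding refl_diff_eq sum_kappa_rfl_eq_char_means by (simp add: distrib_right sum.distrib)
  also have "\<dots> = index * (f x - T)"
    unfolding T_def by (simp add: char_eigenvalue_def algebra_simps)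
  finally have complement: "refl_diff f x - (\<Sum>e\<in>?S. \<Sum>d\<in>?S. ?m e d * ?P e d) = index * (f x - T)" .
  have "refl_diff (resolvent n f) x
      = 1 / (n + index) * (refl_diff f x + (\<Sum>e\<in>?S. \<Sum>d\<in>?S. - 1 * (?m e d * ?P e d)))
        + (\<Sum>e\<in>?S. \<Sum>d\<in>?S. 1 / (n + ?m e d) * (?m e d * ?P e d))"
    unfolding resolvent_def[abs_def] refl_diff_add refl_diff_cmult refl_diff_sum
    by (simp add: refl_diff_char_mean)
  also have "refl_diff f x + (\<Sum>e\<in>?S. \<Sum>d\<in>?S. - 1 * (?m e d * ?P e d)) = index * (f x - T)"
    unfolding complement[symmetric] by simp
  finally have refl_diff_resolvent: "refl_diff (resolvent n f) x
      = 1 / (n + index) * (index * (f x - T)) + (\<Sum>e\<in>?S. \<Sum>d\<in>?S. 1 / (n + ?m e d) * (?m e d * ?P e d))" .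
  have resolvent: "resolvent n f x = 1 / (n + index) * (f x - T) + (\<Sum>e\<in>?S. \<Sum>d\<in>?S. 1 / (n + ?m e d) * ?P e d)"
    by (simp add: resolvent_def T_def)
  have "n * resolvent n f x + refl_diff (resolvent n f) x
      = 1 / (n + index) * ((n + index) * (f x - T))
        + (\<Sum>e\<in>?S. \<Sum>d\<in>?S. 1 / (n + ?m e d) * ((n + ?m e d) * ?P e d))"
    unfolding refl_diff_resolvent resolvent by (simp add: algebra_simps add_divide_distrib diff_divide_distrib)
  also have "\<dots> = (f x - T) + T"
    unfolding T_def using pos by (simp add: order_less_imp_not_eq2)
  finally show ?thesis by simp
qed

lemma deriv_bounded_char_mean:
  assumes f: "\<And>p. p \<in> orbit x \<Longrightarrow> deriv_bounded f p M" and "\<bar>e\<bar> \<le> 1" "\<bar>d\<bar> \<le> 1"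
  shows "deriv_bounded (char_mean e d f) x M"
proof -
  have M: "0 \<le> M" using f[OF self_in_orbit] by (rule deriv_bounded_nonneg)
  have "\<bar>e * d\<bar> \<le> 1" using assms by (simp add: abs_mult mult_le_one)
  then have sgn: "\<bar>rot_sign e d i\<bar> \<le> 1" "\<bar>rfl_sign e d i\<bar> \<le> 1" for i
    using assms by (auto simp: rot_sign_def rfl_sign_def)
  have "deriv_bounded (\<lambda>x. 1 / (4 * real k) * (\<Sum>i<2 * k. rot_sign e d (int i) * f (rot (int i) x)
     + rfl_sign e d (int i) * f (rfl (int i) x))) x (1 / (4 * real k) * (\<Sum>i<2 * k. 1 * M + 1 * M))"
    using M by (intro deriv_bounded_cmult deriv_bounded_sum deriv_bounded_add sgn sum_nonneg
        deriv_bounded_compose_isometry[OF f has_derivative_rot]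
        deriv_bounded_compose_isometry[OF f has_derivative_rfl]) (auto simp: orbit_def)
  then show ?thesis by (simp add: char_mean_def[abs_def] field_simps)
qed

lemma deriv_bounded_resolvent:
  assumes n: "n > 0" and f: "\<And>p. p \<in> orbit x \<Longrightarrow> deriv_bounded f p M"
  shows "deriv_bounded (resolvent n f) x (9 * M / n)"
proof -
  let ?S = "{1, -1} :: real set"
  have M: "0 \<le> M" using f[OF self_in_orbit] by (rule deriv_bounded_nonneg)
  have "\<bar>1 / (n + s)\<bar> \<le> 1 / n" if "0 \<le> s" for s
    using n that by (simp add: abs_divide frac_le)
  then have coeff: "\<bar>1 / (n + index)\<bar> \<le> 1 / n"
    "\<And>e d. e \<in> ?S \<Longrightarrow> d \<in> ?S \<Longrightarrow> \<bar>1 / (n + char_eigenvalue e d)\<bar> \<le> 1 / n"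
    using index_pos char_eigenvalue_nonneg by auto
  have "deriv_bounded (resolvent n f) x (1 / n * (M + (\<Sum>e\<in>?S. \<Sum>d\<in>?S. 1 * M))
      + (\<Sum>e\<in>?S. \<Sum>d\<in>?S. 1 / n * M))"
    unfolding resolvent_def[abs_def] using M
    by (intro deriv_bounded_add deriv_bounded_cmult deriv_bounded_sum deriv_bounded_char_mean
        coeff f self_in_orbit) auto
  moreover have "1 / n * (M + (\<Sum>e\<in>?S. \<Sum>d\<in>?S. 1 * M)) + (\<Sum>e\<in>?S. \<Sum>d\<in>?S. 1 / n * M) = 9 * M / n"
    by simp
  ultimately show ?thesis by simp
qed

end

section \<open>Existence of the Dunkl kernel\<close>

lemma has_derivative_suminf:
  fixes f :: "nat \<Rightarrow> 'a :: real_normed_vector \<Rightarrow> 'b :: banach"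
  assumes S: "convex S" "open S" and x: "x \<in> S"
    and deriv: "\<And>n x. x \<in> S \<Longrightarrow> (f n has_derivative f' n x) (at x)"
    and bound: "\<And>n x h. x \<in> S \<Longrightarrow> norm (f' n x h) \<le> B n * norm h" and B: "summable B"
    and summable: "summable (\<lambda>n. f n x)"
  shows "((\<lambda>x. \<Sum>n. f n x) has_derivative (\<lambda>h. \<Sum>n. f' n x h)) (at x)"
proof -
  have summable': "summable (\<lambda>n. f' n p h)" if "p \<in> S" for p h
    by (rule summable_comparison_test[OF _ summable_mult2[OF B]]) (use bound[OF that] in auto)
  have "\<exists>g. \<forall>p\<in>S. (\<lambda>n. f n p) sums g p \<and> (g has_derivative (\<lambda>h. \<Sum>n. f' n p h)) (at p within S)"
  proof (rule has_derivative_series)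
    show "convex S" "x \<in> S" "(\<lambda>n. f n x) sums (\<Sum>n. f n x)"
      by (fact S(1) x summable_sums[OF summable])+
    show "(f n has_derivative f' n p) (at p within S)" if "p \<in> S" for n p
      using deriv[OF that] by (rule has_derivative_at_withinI)
    fix e :: real assume "e > 0"
    with suminf_exist_split2[OF B] have "\<forall>\<^sub>F N in sequentially. (\<Sum>n. B (n + N)) < e"
      by (rule order_tendstoD(2))
    then show "\<forall>\<^sub>F N in sequentially. \<forall>p\<in>S. \<forall>h. norm ((\<Sum>i<N. f' i p h) - (\<Sum>n. f' n p h)) \<le> e * norm h"
    proof (rule eventually_mono, intro ballI allI)
      fix N p h assume N: "(\<Sum>n. B (n + N)) < e" and p: "p \<in> S"
      have B_tail: "summable (\<lambda>n. B (n + N))"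
        by (intro summable_ignore_initial_segment B)
      have "norm ((\<Sum>i<N. f' i p h) - (\<Sum>n. f' n p h)) = norm (\<Sum>n. f' (n + N) p h)"
        using suminf_split_initial_segment[OF summable'[OF p, of h], of N]
        by (simp add: norm_minus_commute)
      also have "\<dots> \<le> (\<Sum>n. B (n + N) * norm h)"
        by (rule norm_suminf_le[OF bound[OF p] summable_mult2[OF B_tail]])
      also have "\<dots> = (\<Sum>n. B (n + N)) * norm h"
        by (rule suminf_mult2[OF B_tail, symmetric])
      also have "\<dots> \<le> e * norm h" using N by (intro mult_right_mono) auto
      finally show "norm ((\<Sum>i<N. f' i p h) - (\<Sum>n. f' n p h)) \<le> e * norm h" .
    qed
  qed
  then obtain g where g: "\<And>p. p \<in> S \<Longrightarrow> (\<lambda>n. f n p) sums g p"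
    "(g has_derivative (\<lambda>h. \<Sum>n. f' n x h)) (at x within S)"
    using x by blast
  have "(g has_derivative (\<lambda>h. \<Sum>n. f' n x h)) (at x)"
    using g(2) by (simp add: at_within_open[OF x \<open>open S\<close>])
  then show ?thesis
    by (rule has_derivative_transform_within_open[OF _ \<open>open S\<close> x]) (use g(1) in \<open>simp add: sums_iff\<close>)
qed

lemma complex_orthogonal_decomposition:
  assumes "x \<noteq> 0"
  shows "e = ((e \<bullet> x) / (x \<bullet> x)) *\<^sub>R x + ((e \<bullet> (\<i> * x)) / (x \<bullet> x)) *\<^sub>R (\<i> * x)"
proof -
  have "e = inverse (x \<bullet> x) *\<^sub>R ((x \<bullet> x) *\<^sub>R e)"
    using assms by simp
  also have "(x \<bullet> x) *\<^sub>R e = (e \<bullet> x) *\<^sub>R x + (e \<bullet> (\<i> * x)) *\<^sub>R (\<i> * x)"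
    by (simp add: complex_eq_iff inner_complex_def algebra_simps)
  finally show ?thesis by (simp add: scaleR_add_right divide_inverse mult.commute)
qed

context dihedral
begin

primrec kernel_comp :: "complex \<Rightarrow> nat \<Rightarrow> complex \<Rightarrow> real" where
  "kernel_comp y 0 = (\<lambda>x. 1)"
| "kernel_comp y (Suc n) = resolvent (real (Suc n)) (\<lambda>x. (x \<bullet> y) * kernel_comp y n x)"

declare kernel_comp.simps(2) [simp del]

lemma kernel_comp_radial:
  "real (Suc n) * kernel_comp y (Suc n) x + refl_diff (kernel_comp y (Suc n)) x
    = (x \<bullet> y) * kernel_comp y n x"
  unfolding kernel_comp.simps by (rule resolvent_eq) simp

lemma refl_diff_const: "refl_diff (\<lambda>_. r) x = 0"
  by (simp add: refl_diff_def)

lemma resolvent_scaleR: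
  assumes "\<And>p. g (t *\<^sub>R p) = s * f p"
  shows "resolvent n g (t *\<^sub>R x) = s * resolvent n f x"
proof -
  have "char_mean e d g (t *\<^sub>R x) = s * char_mean e d f x" for e d
    by (simp add: char_mean_def rot_scaleR rfl_scaleR assms sum_distrib_left algebra_simps)
  then show ?thesis by (simp add: resolvent_def assms algebra_simps)
qed

lemma kernel_comp_scaleR: "kernel_comp y n (t *\<^sub>R x) = t ^ n * kernel_comp y n x"
proof (induction n arbitrary: x)
  case (Suc n)
  show ?case unfolding kernel_comp.simps
    by (rule resolvent_scaleR) (simp add: Suc algebra_simps)
qed simp

lemma kernel_comp_scaleR_right: "kernel_comp (t *\<^sub>R y) n x = t ^ n * kernel_comp y n x"
proof (induction n arbitrary: x)
  case (Suc n)
  have "resolvent (real (Suc n)) (\<lambda>x. (x \<bullet> t *\<^sub>R y) * kernel_comp (t *\<^sub>R y) n x) (1 *\<^sub>R x)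
      = t ^ Suc n * resolvent (real (Suc n)) (\<lambda>x. (x \<bullet> y) * kernel_comp y n x) x"
    by (rule resolvent_scaleR) (simp add: Suc algebra_simps)
  then show ?case by (simp add: kernel_comp.simps)
qed simp

lemma kernel_comp_at_0: "kernel_comp y n 0 = (if n = 0 then 1 else 0)"
  using kernel_comp_scaleR[of y n 0 0] by (cases n) simp_all

lemma kernel_comp_bound: "\<bar>kernel_comp y n x\<bar> \<le> (cmod x * cmod y) ^ n / fact n"
proof (induction n arbitrary: x)
  case (Suc n)
  have "\<bar>kernel_comp y (Suc n) x\<bar> \<le> (cmod x * cmod y) * ((cmod x * cmod y) ^ n / fact n) / real (Suc n)"
  proof (rule radial_solution_bound[OF _ kernel_comp_radial])
    show "\<bar>(p \<bullet> y) * kernel_comp y n p\<bar> \<le> (cmod x * cmod y) * ((cmod x * cmod y) ^ n / fact n)"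
      if "p \<in> orbit x" for p
      unfolding abs_mult using Suc[of p] Cauchy_Schwarz_ineq2[of p y] norm_orbit[OF that]
      by (intro mult_mono) auto
  qed simp
  then show ?case by (simp add: mult_ac)
qed simp

lemma deriv_bounded_kernel_comp:
  "deriv_bounded (kernel_comp y n) x (real n * (9 * (cmod y * (1 + cmod x))) ^ n / fact n)"
proof (induction n arbitrary: x)
  case 0
  show ?case using deriv_bounded_const[of 1 x] by simp
next
  case (Suc n)
  define C where "C = 9 * (cmod y * (1 + cmod x))"
  define B where "B = C ^ n / fact n"
  have "0 \<le> C" by (simp add: C_def)
  then have B: "0 \<le> B" by (simp add: B_def)
  have "deriv_bounded (\<lambda>x. (x \<bullet> y) * kernel_comp y n x) p (cmod y * (1 + cmod x) * (real (Suc n) * B))"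
    if p: "p \<in> orbit x" for p
  proof (rule deriv_bounded_mono[OF deriv_bounded_mult[OF deriv_bounded_inner Suc.IH]])
    note norm = norm_orbit[OF p]
    have "\<bar>kernel_comp y n p\<bar> \<le> (cmod p * cmod y) ^ n / fact n" by (rule kernel_comp_bound)
    also have "\<dots> \<le> B"
      unfolding B_def C_def norm by (intro divide_right_mono power_mono) (auto simp: algebra_simps)
    finally have comp: "\<bar>kernel_comp y n p\<bar> * cmod y \<le> B * cmod y" by (rule mult_right_mono) simp
    have "\<bar>p \<bullet> y\<bar> * (real n * B) \<le> (cmod x * cmod y) * (real n * B)"
      using Cauchy_Schwarz_ineq2[of p y] norm B by (intro mult_right_mono) auto
    with comp have "\<bar>p \<bullet> y\<bar> * (real n * B) + \<bar>kernel_comp y n p\<bar> * cmod y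
        \<le> (cmod x * cmod y) * (real n * B) + B * cmod y" by (rule add_mono[rotated])
    also have "\<dots> \<le> cmod y * (1 + cmod x) * (real (Suc n) * B)"
      using B by (simp add: algebra_simps)
    finally show "\<bar>p \<bullet> y\<bar> * (real n * (9 * (cmod y * (1 + cmod p))) ^ n / fact n) + \<bar>kernel_comp y n p\<bar> * cmod y
        \<le> cmod y * (1 + cmod x) * (real (Suc n) * B)"
      by (simp add: B_def C_def norm)
  qed
  then have "deriv_bounded (kernel_comp y (Suc n)) x (9 * (cmod y * (1 + cmod x) * (real (Suc n) * B)) / real (Suc n))"
    unfolding kernel_comp.simps by (intro deriv_bounded_resolvent) auto
  moreover have "9 * (cmod y * (1 + cmod x) * (real (Suc n) * B)) / real (Suc n)
      = real (Suc n) * C ^ Suc n / fact (Suc n)"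
    by (simp add: B_def C_def field_simps)
  ultimately show ?case by (simp only: C_def)
qed

lemma kernel_comp_differentiable: "kernel_comp y n differentiable (at x)"
  using deriv_bounded_kernel_comp[of y n x] by (auto simp: deriv_bounded_def differentiable_def)

lemma kernel_comp_has_derivative:
  "(kernel_comp y n has_derivative frechet_derivative (kernel_comp y n) (at x)) (at x)"
  using kernel_comp_differentiable by (simp only: frechet_derivative_works)

lemma frechet_derivative_kernel_comp_bound:
  "\<bar>frechet_derivative (kernel_comp y n) (at x) h\<bar>
    \<le> real n * (9 * (cmod y * (1 + cmod x))) ^ n / fact n * cmod h"
proof -
  obtain D where "(kernel_comp y n has_derivative D) (at x)"
    "\<And>h. \<bar>D h\<bar> \<le> real n * (9 * (cmod y * (1 + cmod x))) ^ n / fact n * cmod h"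
    using deriv_bounded_kernel_comp[of y n x] by (auto simp: deriv_bounded_def)
  then show ?thesis by (simp add: frechet_derivative_at[symmetric])
qed

lemma kernel_comp_Euler: "frechet_derivative (kernel_comp y n) (at x) x = real n * kernel_comp y n x"
proof -
  let ?D = "frechet_derivative (kernel_comp y n) (at x)"
  have "((\<lambda>t. kernel_comp y n (t *\<^sub>R x)) has_derivative (\<lambda>h. ?D (h *\<^sub>R x))) (at 1)"
    by (rule has_derivative_compose[where f = "\<lambda>t. t *\<^sub>R x"])
      (auto intro!: derivative_eq_intros kernel_comp_has_derivative)
  then have "((\<lambda>t. t ^ n * kernel_comp y n x) has_derivative (\<lambda>h. ?D (h *\<^sub>R x))) (at 1)"
    by (simp add: kernel_comp_scaleR)
  moreover have "((\<lambda>t. t ^ n * kernel_comp y n x) has_derivative (\<lambda>h. real n * kernel_comp y n x * h)) (at 1)"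
    by (auto intro!: derivative_eq_intros)
  ultimately have "(\<lambda>h. ?D (h *\<^sub>R x)) = (\<lambda>h. real n * kernel_comp y n x * h)"
    by (rule has_derivative_unique)
  from fun_cong[OF this, of 1] show ?thesis by simp
qed

lemma dunkl_op_rfl:
  assumes f: "f differentiable (at (rfl j x))"
  shows "dunkl_op k a b e (\<lambda>p. f (rfl j p)) x = dunkl_op k a b (rfl j e) f (rfl j x)"
proof -
  obtain f' where f': "(f has_derivative f') (at (rfl j x))"
    using f by (auto simp: differentiable_def)
  let ?h = "\<lambda>i. kappa i * (mirror_normal i \<bullet> rfl j e) * (f (rfl j x) - f (rfl i (rfl j x)))
    / (mirror_normal i \<bullet> rfl j x)"
  have "(\<Sum>i<2 * k. ?h (int i)) = (\<Sum>i<2 * k. ?h (2 * j - int i))"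
    by (rule sum_periodic_reflect[where h = ?h, symmetric]) (simp add: mirror_normal_period kappa_def)
  also have "\<dots> = (\<Sum>i<2 * k. kappa (int i) * (mirror_normal (int i) \<bullet> e)
      * (f (rfl j x) - f (rfl j (rfl (int i) x))) / (mirror_normal (int i) \<bullet> x))"
    by (intro sum.cong) (auto simp: mirror_normal_inner_rfl rfl_rfl kappa_def)
  finally show ?thesis
    unfolding dunkl_op_eq[OF f'] dunkl_op_eq[OF has_derivative_compose[OF has_derivative_rfl f']] by simp
qed

lemma dunkl_op_inner_mult:
  assumes x: "dih_regular k x" and f: "f differentiable (at x)"
  shows "dunkl_op k a b e (\<lambda>x. (x \<bullet> y) * f x) x = (e \<bullet> y) * f x + (x \<bullet> y) * dunkl_op k a b e f x
    + (\<Sum>j<2 * k. kappa (int j) * (e \<bullet> y - rfl (int j) e \<bullet> y) * f (rfl (int j) x))"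
proof -
  obtain f' where f': "(f has_derivative f') (at x)"
    using f by (auto simp: differentiable_def)
  have deriv: "((\<lambda>x. (x \<bullet> y) * f x) has_derivative (\<lambda>h. (x \<bullet> y) * f' h + (h \<bullet> y) * f x)) (at x)"
    using f' by (auto intro!: derivative_eq_intros)
  let ?n = "\<lambda>j. mirror_normal (int j)"
  have quotient: "kappa (int j) * (?n j \<bullet> e) *
        ((x \<bullet> y) * f x - (rfl (int j) x \<bullet> y) * f (rfl (int j) x)) / (?n j \<bullet> x)
      = (x \<bullet> y) * (kappa (int j) * (?n j \<bullet> e) * (f x - f (rfl (int j) x)) / (?n j \<bullet> x))
        + kappa (int j) * (e \<bullet> y - rfl (int j) e \<bullet> y) * f (rfl (int j) x)" for j
  proof -
    have "?n j \<bullet> x \<noteq> 0" using x by (simp add: dih_regular_iff)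
    moreover have rfl: "rfl (int j) p \<bullet> y = p \<bullet> y - 2 * (?n j \<bullet> p) * (?n j \<bullet> y)" for p
      by (simp add: rfl_eq_reflection[of "int j" p] inner_diff_left)
    ultimately show ?thesis unfolding rfl[of x] rfl[of e] by (simp add: field_simps)
  qed
  show ?thesis
    unfolding dunkl_op_eq[OF deriv] dunkl_op_eq[OF f'] quotient
    by (simp only: sum.distrib sum_distrib_left distrib_left add_ac)
qed

abbreviation angular_op :: "(complex \<Rightarrow> real) \<Rightarrow> complex \<Rightarrow> real" where
  "angular_op f x \<equiv> dunkl_op k a b (\<i> * x) f x"

lemma i_mult_rfl: "\<i> * rfl j x = - rfl j (\<i> * x)"
  by (simp add: rfl_def)

lemma angular_op_rfl:
  assumes "f differentiable (at (rfl j x))"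
  shows "angular_op (\<lambda>p. f (rfl j p)) x = - angular_op f (rfl j x)"
proof -
  have "angular_op (\<lambda>p. f (rfl j p)) x = dunkl_op k a b (- (\<i> * rfl j x)) f (rfl j x)"
    unfolding dunkl_op_rfl[OF assms] i_mult_rfl by simp
  also have "\<dots> = - angular_op f (rfl j x)"
    by (rule linear_neg[OF linear_dunkl_op[OF assms]])
  finally show ?thesis .
qed

text \<open>Reflections reverse the orientation, so they anticommute with the angular operator. Applied to the
  radial recursion, the angular operator therefore turns \<open>n + \<Sum>\<^sub>j \<kappa>\<^sub>j (1 - \<sigma>\<^sub>j)\<close> into
  \<open>n + \<Sum>\<^sub>j \<kappa>\<^sub>j (1 + \<sigma>\<^sub>j)\<close>, which is injective by the maximum principle.\<close>

lemma angular_op_radial: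
  assumes f: "\<And>x. f differentiable (at x)"
  shows "angular_op (\<lambda>p. n * f p + refl_diff f p) x
    = (n + index) * angular_op f x + (\<Sum>j<2 * k. kappa (int j) * angular_op f (rfl (int j) x))"
proof -
  have rfl: "(\<lambda>p. f (rfl j p)) differentiable (at x)" for j
    using differentiable_chain_at[OF differentiableI[OF has_derivative_rfl] f] by (simp add: comp_def)
  then have kappa_rfl: "(\<lambda>p. (- kappa j) * f (rfl j p)) differentiable (at x)" for j
    by (intro differentiable_mult differentiable_const)
  have "angular_op (\<lambda>p. n * f p + refl_diff f p) x
      = angular_op (\<lambda>p. (n + index) * f p + (\<Sum>j<2 * k. (- kappa (int j)) * f (rfl (int j) p))) x"
    by (simp add: refl_diff_eq sum_negf algebra_simps)
  also have "\<dots> = angular_op (\<lambda>p. (n + index) * f p) x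
      + angular_op (\<lambda>p. \<Sum>j<2 * k. (- kappa (int j)) * f (rfl (int j) p)) x"
    by (intro dunkl_op_add differentiable_mult differentiable_const differentiable_sum f kappa_rfl
        finite_lessThan ballI)
  also have "\<dots> = (n + index) * angular_op f x
      + (\<Sum>j<2 * k. (- kappa (int j)) * angular_op (\<lambda>p. f (rfl (int j) p)) x)"
    by (simp only: dunkl_op_sum[OF kappa_rfl] dunkl_op_cmult[OF f] dunkl_op_cmult[OF rfl])
  finally show ?thesis by (simp add: angular_op_rfl[OF f])
qed

lemma angular_op_inner_mult:
  assumes "dih_regular k x" "f differentiable (at x)"
  shows "angular_op (\<lambda>x. (x \<bullet> y) * f x) x
    = ((\<i> * x) \<bullet> y) * ((1 + index) * f x - refl_diff f x) + (x \<bullet> y) * angular_op f x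
      + (\<Sum>j<2 * k. kappa (int j) * (((\<i> * rfl (int j) x) \<bullet> y) * f (rfl (int j) x)))"
  unfolding dunkl_op_inner_mult[OF assms] refl_diff_eq
  by (simp add: i_mult_rfl left_diff_distrib right_diff_distrib sum_subtractf sum_negf sum_distrib_left
      algebra_simps)

lemma angular_op_kernel_comp_step:
  assumes prev: "\<And>p. dih_regular k p \<Longrightarrow> (p \<bullet> y) * angular_op (kernel_comp y n) p
      = ((\<i> * p) \<bullet> y) * (real n * kernel_comp y n p + refl_diff (kernel_comp y n) p)"
    and x: "dih_regular k x"
  shows "angular_op (kernel_comp y (Suc n)) x = ((\<i> * x) \<bullet> y) * kernel_comp y n x"
proof -
  let ?N = "real (Suc n)" and ?\<Theta> = "angular_op (kernel_comp y (Suc n))"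
    and ?g = "\<lambda>p. ((\<i> * p) \<bullet> y) * kernel_comp y n p"
  have "?N * \<bar>?\<Theta> x - ?g x\<bar> \<le> 0"
  proof (rule orbit_maximum_principle)
    fix p assume "p \<in> orbit x"
    then have p: "dih_regular k p" by (rule dih_regular_orbit[OF x])
    have "(?N + index) * ?\<Theta> p + (\<Sum>j<2 * k. kappa (int j) * ?\<Theta> (rfl (int j) p))
        = angular_op (\<lambda>p. (p \<bullet> y) * kernel_comp y n p) p"
      unfolding angular_op_radial[OF kernel_comp_differentiable, symmetric] kernel_comp_radial ..
    also have "\<dots> = (?N + index) * ?g p + (\<Sum>j<2 * k. kappa (int j) * ?g (rfl (int j) p))"
      unfolding angular_op_inner_mult[OF p kernel_comp_differentiable] prev[OF p]
      by (simp add: algebra_simps)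
    finally have "(?N + index) * (?\<Theta> p - ?g p)
        = - (\<Sum>j<2 * k. kappa (int j) * (?\<Theta> (rfl (int j) p) - ?g (rfl (int j) p)))"
      by (simp add: right_diff_distrib sum_subtractf)
    then have "\<bar>(?N + index) * (?\<Theta> p - ?g p)\<bar>
        \<le> (\<Sum>j<2 * k. \<bar>kappa (int j) * (?\<Theta> (rfl (int j) p) - ?g (rfl (int j) p))\<bar>)"
      by (simp only: abs_minus_cancel sum_abs)
    then show "(?N + index) * \<bar>?\<Theta> p - ?g p\<bar>
        \<le> 0 + (\<Sum>j<2 * k. kappa (int j) * \<bar>?\<Theta> (rfl (int j) p) - ?g (rfl (int j) p)\<bar>)"
      using index_pos by (simp add: abs_mult kappa_nonneg)
  qed simp
  then show ?thesis by (simp add: mult_le_0_iff)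
qed

lemma angular_op_kernel_comp:
  "dih_regular k x \<Longrightarrow> angular_op (kernel_comp y (Suc n)) x = ((\<i> * x) \<bullet> y) * kernel_comp y n x"
proof (induction n arbitrary: x)
  case 0
  show ?case
    by (rule angular_op_kernel_comp_step[OF _ 0]) (simp add: dunkl_op_const refl_diff_const)
next
  case (Suc n)
  show ?case
  proof (rule angular_op_kernel_comp_step[OF _ Suc.prems])
    fix p assume "dih_regular k p"
    from Suc.IH[OF this] show "(p \<bullet> y) * angular_op (kernel_comp y (Suc n)) p
        = ((\<i> * p) \<bullet> y) * (real (Suc n) * kernel_comp y (Suc n) p + refl_diff (kernel_comp y (Suc n)) p)"
      by (simp only: kernel_comp_radial mult.left_commute)
  qed
qed

lemma dunkl_op_kernel_comp_Suc:
  assumes x: "dih_regular k x"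
  shows "dunkl_op k a b e (kernel_comp y (Suc n)) x = (e \<bullet> y) * kernel_comp y n x"
proof -
  interpret linear "\<lambda>e. dunkl_op k a b e (kernel_comp y (Suc n)) x"
    by (rule linear_dunkl_op[OF kernel_comp_differentiable])
  define r s where "r = (e \<bullet> x) / (x \<bullet> x)" and "s = (e \<bullet> (\<i> * x)) / (x \<bullet> x)"
  have "x \<noteq> 0" using x by (auto simp: dih_regular_iff)
  then have e: "e = r *\<^sub>R x + s *\<^sub>R (\<i> * x)"
    unfolding r_def s_def by (rule complex_orthogonal_decomposition)
  have "dunkl_op k a b x (kernel_comp y (Suc n)) x = (x \<bullet> y) * kernel_comp y n x"
    unfolding dunkl_op_radial[OF x kernel_comp_differentiable] kernel_comp_Euler
    by (rule kernel_comp_radial)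
  then show ?thesis
    unfolding e add scale angular_op_kernel_comp[OF x]
    by (simp add: inner_add_left algebra_simps)
qed

definition kernel_series :: "complex \<Rightarrow> complex \<Rightarrow> real" where
  "kernel_series y x = (\<Sum>n. kernel_comp y n x)"

lemma summable_kernel_comp: "summable (\<lambda>n. kernel_comp y n x)"
proof (rule summable_comparison_test[OF _ summable_exp[of "cmod x * cmod y"]])
  show "\<exists>N. \<forall>n\<ge>N. norm (kernel_comp y n x) \<le> inverse (fact n) * (cmod x * cmod y) ^ n"
    using kernel_comp_bound[of y _ x] by (simp add: field_simps)
qed

lemma kernel_series_sums: "(\<lambda>n. kernel_comp y n x) sums kernel_series y x"
  unfolding kernel_series_def by (rule summable_sums[OF summable_kernel_comp])

lemma kernel_series_has_derivative:
  "summable (\<lambda>n. frechet_derivative (kernel_comp y n) (at x) h)"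
  "(kernel_series y has_derivative (\<lambda>h. \<Sum>n. frechet_derivative (kernel_comp y n) (at x) h)) (at x)"
proof -
  define C where "C = 9 * (cmod y * (1 + (cmod x + 1)))"
  define B where "B n = real n * C ^ n / fact n" for n
  have "B (Suc n) = C * (inverse (fact n) * C ^ n)" for n
    unfolding B_def by (simp add: divide_inverse fact_Suc del: of_nat_Suc)
  then have "summable (\<lambda>n. B (Suc n))" by (simp only: summable_mult summable_exp)
  then have B: "summable B" by (simp only: summable_Suc_iff)
  have bound: "norm (frechet_derivative (kernel_comp y n) (at p) h) \<le> B n * cmod h"
    if "p \<in> ball 0 (cmod x + 1)" for n p h
  proof -
    have "norm (frechet_derivative (kernel_comp y n) (at p) h)
        \<le> real n * (9 * (cmod y * (1 + cmod p))) ^ n / fact n * cmod h"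
      using frechet_derivative_kernel_comp_bound by simp
    also have "\<dots> \<le> B n * cmod h"
      unfolding B_def C_def using that
      by (intro mult_right_mono divide_right_mono mult_left_mono power_mono) auto
    finally show ?thesis .
  qed
  show "summable (\<lambda>n. frechet_derivative (kernel_comp y n) (at x) h)"
    by (rule summable_comparison_test[OF _ summable_mult2[OF B, of "cmod h"]])
      (use bound[of x] in auto)
  show "(kernel_series y has_derivative (\<lambda>h. \<Sum>n. frechet_derivative (kernel_comp y n) (at x) h)) (at x)"
    unfolding kernel_series_def[abs_def]
    by (rule has_derivative_suminf[where S = "ball 0 (cmod x + 1)", OF _ _ _ _ bound B summable_kernel_comp])
      (auto intro: kernel_comp_has_derivative)
qed

lemma dunkl_op_kernel_series:
  assumes x: "dih_regular k x"
  shows "dunkl_op k a b e (kernel_series y) x = (e \<bullet> y) * kernel_series y x"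
proof -
  have "(\<lambda>n. dunkl_op k a b e (kernel_comp y n) x) sums dunkl_op k a b e (kernel_series y) x"
    unfolding dunkl_op_eq[OF kernel_series_has_derivative(2)]
      dunkl_op_eq[OF kernel_comp_has_derivative]
    by (intro sums_add sums_sum sums_divide sums_mult sums_diff kernel_series_sums
        summable_sums kernel_series_has_derivative(1))
  then have "(\<lambda>n. dunkl_op k a b e (kernel_comp y (Suc n)) x) sums dunkl_op k a b e (kernel_series y) x"
    by (subst sums_Suc_iff) (simp add: dunkl_op_const)
  moreover have "(\<lambda>n. (e \<bullet> y) * kernel_comp y n x) sums ((e \<bullet> y) * kernel_series y x)"
    by (intro sums_mult kernel_series_sums)
  ultimately show ?thesis by (simp add: dunkl_op_kernel_comp_Suc[OF x] sums_unique2)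
qed

lemma dunkl_kernel_eq_series: "dunkl_kernel k a b x y = kernel_series y x"
proof (rule dunkl_kernel_eqI)
  show "kernel_series y 0 = 1"
    unfolding kernel_series_def kernel_comp_at_0 by (subst suminf_finite[of "{0}"]) auto
  show "dunkl_eigen y (kernel_series y)"
    unfolding dunkl_eigen_def
    using differentiableI[OF kernel_series_has_derivative(2)] dunkl_op_kernel_series by blast
qed

end

section \<open>The Poisson kernel and roots of unity\<close>

definition poisson_denom :: "real \<Rightarrow> real \<Rightarrow> real" where
  "poisson_denom r c = 1 - 2 * r * c + r\<^sup>2"

lemma poisson_denom_ge:
  assumes "\<bar>c\<bar> \<le> 1"
  shows "(1 - \<bar>r\<bar>)\<^sup>2 \<le> poisson_denom r c"
proof -
  have "r * c \<le> \<bar>r\<bar> * \<bar>c\<bar>" by (simp add: abs_mult[symmetric])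
  also have "\<dots> \<le> \<bar>r\<bar>" using assms by (simp add: mult_left_le)
  finally show ?thesis by (simp add: poisson_denom_def power2_diff)
qed

lemma poisson_denom_pos:
  assumes "\<bar>c\<bar> \<le> 1" "\<bar>r\<bar> < 1"
  shows "0 < poisson_denom r c"
proof -
  have "0 < (1 - \<bar>r\<bar>)\<^sup>2" using assms(2) by simp
  then show ?thesis using poisson_denom_ge[OF assms(1)] by (rule less_le_trans)
qed

lemma norm_one_minus_mult_unit:
  assumes "cmod t = 1"
  shows "(cmod (1 - of_real r * t))\<^sup>2 = poisson_denom r (Re t)"
proof -
  have "(cmod (1 - of_real r * t))\<^sup>2 = 1 - 2 * r * Re t + r\<^sup>2 * (cmod t)\<^sup>2"
    unfolding cmod_power2 by (simp add: power2_eq_square algebra_simps)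
  with assms show ?thesis by (simp add: poisson_denom_def)
qed

lemma poisson_kernel_eq_Re:
  assumes "cmod t = 1" "\<bar>r\<bar> < 1"
  shows "(1 - r\<^sup>2) / poisson_denom r (Re t) = 2 * Re (1 / (1 - of_real r * t)) - 1"
proof -
  have "Re (1 / (1 - of_real r * t)) = (1 - r * Re t) / poisson_denom r (Re t)"
    unfolding norm_one_minus_mult_unit[OF assms(1), symmetric] by (simp add: Re_divide cmod_power2)
  moreover have "0 < poisson_denom r (Re t)"
    using assms abs_Re_le_cmod[of t] by (intro poisson_denom_pos) auto
  ultimately show ?thesis by (simp add: field_simps) (simp add: poisson_denom_def)
qed

lemma abs_power_lt_1: "\<bar>r\<bar> < 1 \<Longrightarrow> 0 < n \<Longrightarrow> \<bar>r ^ n\<bar> < (1 :: real)"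
  by (simp add: power_abs power_less_one_iff)

lemma cis_root_unity_power: "k > 0 \<Longrightarrow> cis (2 * pi * real i / real k) ^ k = 1"
  using bij_betw_apply[OF Complex.bij_betw_roots_unity, of k "i mod k"]
  by (simp add: Complex.DeMoivre cis_multiple_2pi)

lemma sum_powers_root_unity:
  assumes "m < k"
  shows "(\<Sum>i<k. cis (2 * pi * real m / real k) ^ i) = (if m = 0 then of_nat k else 0)"
proof (cases "m = 0")
  case False
  have "inj_on (\<lambda>i. cis (2 * pi * real i / real k)) {..<k}"
    using assms by (intro bij_betw_imp_inj_on[OF Complex.bij_betw_roots_unity]) simp
  from inj_onD[OF this, of m 0] have "cis (2 * pi * real m / real k) \<noteq> 1"
    using assms False by auto
  then show ?thesis
    using geometric_sum[of "cis (2 * pi * real m / real k)" k] assms False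
    by (simp add: cis_root_unity_power)
qed simp

lemma sum_inverse_one_minus_roots_unity:
  assumes k: "k > 0" and z: "cmod z < 1"
  shows "(\<Sum>i<k. 1 / (1 - z * cis (2 * pi * real i / real k))) = of_nat k / (1 - z ^ k)"
proof -
  let ?w = "\<lambda>i. cis (2 * pi * real i / real k)"
  have "1 - z ^ k \<noteq> 0"
    using z k power_less_one_iff[of "cmod z" k] by (auto simp: norm_power[symmetric])
  have geometric: "1 / (1 - z * ?w i) = (\<Sum>m<k. z ^ m * ?w m ^ i) / (1 - z ^ k)" for i
  proof -
    have "?w i ^ m = ?w m ^ i" for m by (simp add: Complex.DeMoivre mult_ac)
    then have "1 - z ^ k = (1 - z * ?w i) * (\<Sum>m<k. z ^ m * ?w m ^ i)"
      using one_diff_power_eq[of "z * ?w i" k]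
      by (simp add: power_mult_distrib cis_root_unity_power[OF k])
    with \<open>1 - z ^ k \<noteq> 0\<close> show ?thesis by (auto simp: field_simps)
  qed
  have "(\<Sum>i<k. 1 / (1 - z * ?w i)) = (\<Sum>i<k. \<Sum>m<k. z ^ m * ?w m ^ i) / (1 - z ^ k)"
    by (simp only: geometric sum_divide_distrib)
  also have "(\<Sum>i<k. \<Sum>m<k. z ^ m * ?w m ^ i) = (\<Sum>m<k. z ^ m * (\<Sum>i<k. ?w m ^ i))"
    by (subst sum.swap) (simp add: sum_distrib_left)
  also have "\<dots> = (\<Sum>m<k. if m = 0 then of_nat k else 0)"
    by (intro sum.cong) (auto simp: sum_powers_root_unity)
  also have "\<dots> = of_nat k" using k by simp
  finally show ?thesis .
qed

lemma prod_linear_factors_roots_unity: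
  assumes k: "k > 0"
  shows "(\<Prod>w | w ^ k = 1. [:- w, 1:]) = (monom 1 k - 1 :: complex poly)"
proof (rule poly_eqI_degree_lead_coeff[where A = "{w. w ^ k = 1}" and n = k])
  have card: "card {w :: complex. w ^ k = 1} = k" by (rule card_roots_unity_eq[OF k])
  have degree: "degree (\<Prod>w | w ^ k = 1. [:- w, 1:] :: complex poly) = k"
    by (subst degree_prod_eq_sum_degree) (simp_all add: card)
  show "coeff (\<Prod>w | w ^ k = 1. [:- w, 1:] :: complex poly) k = coeff (monom 1 k - 1) k"
    using lead_coeff_prod[of "\<lambda>w. [:- w, 1:]" "{w :: complex. w ^ k = 1}"] k by (simp add: degree)
  show "degree (\<Prod>w | w ^ k = 1. [:- w, 1:] :: complex poly) \<le> k" by (simp add: degree)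
  show "degree (monom 1 k - 1 :: complex poly) \<le> k"
    by (intro degree_diff_le) (simp_all add: degree_monom_le)
  show "poly (\<Prod>w | w ^ k = 1. [:- w, 1:]) z = poly (monom 1 k - 1) z" if "z \<in> {w. w ^ k = 1}" for z :: complex
    using that k by (auto simp: poly_prod poly_monom intro!: prod_zero finite_roots_unity)
qed (simp add: card_roots_unity_eq[OF k])

lemma prod_one_minus_roots_unity:
  assumes k: "k > 0"
  shows "(\<Prod>i<k. 1 - z * cis (2 * pi * real i / real k)) = 1 - z ^ k"
proof (cases "z = 0")
  case True
  then show ?thesis using k by simp
next
  case False
  have "(\<Prod>i<k. 1 - z * cis (2 * pi * real i / real k)) = (\<Prod>w | w ^ k = 1. 1 - z * w)"
    by (rule prod.reindex_bij_betw[OF Complex.bij_betw_roots_unity[OF k]])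
  also have "\<dots> = (\<Prod>w | w ^ k = 1. z * (1 / z - w))"
    using False by (simp add: right_diff_distrib)
  also have "\<dots> = z ^ k * poly (\<Prod>w | w ^ k = 1. [:- w, 1:]) (1 / z)"
    by (simp add: prod.distrib card_roots_unity_eq[OF k] poly_prod)
  also have "\<dots> = 1 - z ^ k"
    unfolding prod_linear_factors_roots_unity[OF k]
    using False by (simp add: poly_monom power_divide right_diff_distrib)
  finally show ?thesis .
qed

lemma sum_poisson_kernel:
  assumes k: "k > 0" and t: "cmod t = 1" and r: "\<bar>r\<bar> < 1"
  shows "(\<Sum>i<k. (1 - r\<^sup>2) / poisson_denom r (Re (t * cis (2 * pi * real i / real k))))
    = real k * (1 - (r ^ k)\<^sup>2) / poisson_denom (r ^ k) (Re (t ^ k))"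
proof -
  let ?w = "\<lambda>i. cis (2 * pi * real i / real k)"
  have unit: "cmod (t * ?w i) = 1" "cmod (t ^ k) = 1" for i
    using t by (simp_all add: norm_mult norm_power)
  have "(\<Sum>i<k. (1 - r\<^sup>2) / poisson_denom r (Re (t * ?w i)))
      = (\<Sum>i<k. 2 * Re (1 / (1 - of_real r * (t * ?w i))) - 1)"
    by (simp only: poisson_kernel_eq_Re[OF unit(1) r])
  also have "\<dots> = 2 * Re (\<Sum>i<k. 1 / (1 - of_real r * t * ?w i)) - real k"
    by (simp add: sum_subtractf sum_distrib_left mult.assoc)
  also have "\<dots> = 2 * Re (of_nat k * (1 / (1 - of_real (r ^ k) * t ^ k))) - real k"
    using sum_inverse_one_minus_roots_unity[OF k, of "of_real r * t"] r t
    by (simp add: norm_mult power_mult_distrib)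
  also have "\<dots> = real k * (2 * Re (1 / (1 - of_real (r ^ k) * t ^ k)) - 1)"
  proof -
    have "2 * Re (of_nat k * z) - real k = real k * (2 * Re z - 1)" for z
      by (simp add: algebra_simps)
    then show ?thesis .
  qed
  also have "\<dots> = real k * ((1 - (r ^ k)\<^sup>2) / poisson_denom (r ^ k) (Re (t ^ k)))"
    by (simp only: poisson_kernel_eq_Re[OF unit(2) abs_power_lt_1[OF r k]])
  finally show ?thesis by simp
qed

lemma prod_poisson_denom:
  assumes k: "k > 0" and t: "cmod t = 1"
  shows "(\<Prod>i<k. poisson_denom r (Re (t * cis (2 * pi * real i / real k))))
    = poisson_denom (r ^ k) (Re (t ^ k))"
proof -
  let ?w = "\<lambda>i. cis (2 * pi * real i / real k)"
  have unit: "cmod (t * ?w i) = 1" "cmod (t ^ k) = 1" for i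
    using t by (simp_all add: norm_mult norm_power)
  have "(\<Prod>i<k. poisson_denom r (Re (t * ?w i))) = (\<Prod>i<k. (cmod (1 - of_real r * (t * ?w i)))\<^sup>2)"
    by (simp only: norm_one_minus_mult_unit[OF unit(1)])
  also have "\<dots> = (cmod (\<Prod>i<k. 1 - of_real r * t * ?w i))\<^sup>2"
    by (simp only: prod_norm prod_power_distrib[symmetric] mult.assoc)
  also have "(\<Prod>i<k. 1 - of_real r * t * ?w i) = 1 - of_real (r ^ k) * t ^ k"
    by (simp add: prod_one_minus_roots_unity[OF k] power_mult_distrib)
  finally show ?thesis by (simp only: norm_one_minus_mult_unit[OF unit(2)])
qed

section \<open>The measures on the interval\<close>

lemma nn_integral_one_minus_square_powr:
  assumes "c > 0"
  shows "(\<integral>\<^sup>+u. ennreal (indicator {-1..1} u * (1 - u\<^sup>2) powr (c - 1)) \<partial>lborel) = ennreal (Beta (1/2) c)"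
proof -
  define h where "h u = (1 - u\<^sup>2) powr (c - 1)" for u :: real
  have [measurable]: "h \<in> borel_measurable borel" unfolding h_def[abs_def] by measurable
  have h: "0 \<le> h u" "h (- u) = h u" for u by (simp_all add: h_def)
  define H where "H = (\<integral>\<^sup>+u. ennreal (indicator {0..1} u * h u) \<partial>lborel)"
  have reflect: "(\<integral>\<^sup>+u. ennreal (indicator {-1..0} u * h u) \<partial>lborel) = H"
    unfolding H_def by (subst nn_integral_real_affine[where c = "-1" and t = 0])
      (auto simp: h intro!: nn_integral_cong arg_cong[where f = ennreal] split: split_indicator)
  have "ennreal (Beta (1/2) c)
      = (\<integral>\<^sup>+x. ennreal (x powr (- 1/2) * (1 - x) powr (c - 1) * indicator {0\<^sup>2..1\<^sup>2} x) \<partial>lborel)"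
    using nn_integral_has_integral_lebesgue[OF _ has_integral_Beta_real[of "1/2" c]] assms
    by (simp add: mult_ac)
  also have "\<dots> = (\<integral>\<^sup>+u. ennreal (u\<^sup>2 powr (- 1/2) * (1 - u\<^sup>2) powr (c - 1) * (2 * u) * indicator {0..1} u) \<partial>lborel)"
    by (rule nn_integral_substitution)
      (auto intro!: derivative_eq_intros continuous_intros simp: set_borel_measurable_def)
  also have "\<dots> = (\<integral>\<^sup>+u. 2 * ennreal (indicator {0..1} u * h u) \<partial>lborel)"
  proof (rule nn_integral_cong_AE, rule AE_I')
    show "{0} \<in> null_sets lborel" by (rule countable_imp_null_set_lborel) simp
    have "ennreal (u\<^sup>2 powr (- 1/2) * (1 - u\<^sup>2) powr (c - 1) * (2 * u) * indicator {0..1} u)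
        = 2 * ennreal (indicator {0..1} u * h u)" if "u \<noteq> 0" for u
    proof (cases "u \<in> {0..1}")
      case True
      with that have eq: "u\<^sup>2 powr (- 1/2) * (1 - u\<^sup>2) powr (c - 1) * (2 * u) = 2 * h u"
        by (simp add: h_def powr_minus_divide powr_half_sqrt)
      show ?thesis unfolding eq using True by (simp add: ennreal_mult')
    qed simp
    then show "{u \<in> space lborel. \<not> ennreal (u\<^sup>2 powr (- 1/2) * (1 - u\<^sup>2) powr (c - 1) * (2 * u) * indicator {0..1} u)
        = 2 * ennreal (indicator {0..1} u * h u)} \<subseteq> {0}" by auto
  qed
  also have "\<dots> = H + (\<integral>\<^sup>+u. ennreal (indicator {-1..0} u * h u) \<partial>lborel)"
    by (subst nn_integral_cmult) (simp_all add: H_def[symmetric] reflect mult_2)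
  also have "\<dots> = (\<integral>\<^sup>+u. ennreal (indicator {0..1} u * h u) + ennreal (indicator {-1..0} u * h u) \<partial>lborel)"
    unfolding H_def by (rule nn_integral_add[symmetric]) auto
  also have "\<dots> = (\<integral>\<^sup>+u. ennreal (indicator {-1..1} u * h u) \<partial>lborel)"
    by (intro nn_integral_cong_AE AE_I'[of "{0}"])
      (auto intro: countable_imp_null_set_lborel split: split_indicator)
  finally show ?thesis by (simp add: h_def)
qed

definition nu_measure :: "real \<Rightarrow> real measure" where
  "nu_measure c = density lborel (\<lambda>u. ennreal (indicator {-1..1} u * nu_density c u))"

lemma nu_density_measurable [measurable]: "nu_density c \<in> borel_measurable borel"
  unfolding nu_density_def[abs_def] by measurable

lemma nu_density_nonneg: "c > 0 \<Longrightarrow> 0 \<le> nu_density c u"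
  by (simp add: nu_density_def)

lemma sets_nu_measure [measurable_cong, simp]: "sets (nu_measure c) = sets borel"
  by (simp add: nu_measure_def)

lemma prob_space_nu_measure:
  assumes c: "c > 0"
  shows "prob_space (nu_measure c)"
proof
  let ?K = "Gamma (c + 1/2) / (sqrt pi * Gamma c)"
  have "emeasure (nu_measure c) (space (nu_measure c))
      = (\<integral>\<^sup>+u. ennreal ?K * ennreal (indicator {-1..1} u * (1 - u\<^sup>2) powr (c - 1)) \<partial>lborel)"
    using c by (simp add: nu_measure_def emeasure_density nu_density_def ennreal_mult'[symmetric] mult_ac)
  also have "\<dots> = ennreal (?K * Beta (1/2) c)"
    using c
    by (subst nn_integral_cmult) (simp_all add: nn_integral_one_minus_square_powr ennreal_mult'[symmetric])
  also have "?K * Beta (1/2) c = 1"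
    using c Gamma_real_pos[of c, THEN less_imp_neq] Gamma_real_pos[of "c + 1/2", THEN less_imp_neq]
    by (simp add: Beta_def Gamma_one_half_real add.commute)
  finally show "emeasure (nu_measure c) (space (nu_measure c)) = 1" by simp
qed

lemma AE_nu_measure: "AE u in nu_measure c. u \<in> {-1..1}"
  unfolding nu_measure_def by (subst AE_density) (auto simp: indicator_def)

lemma LINT_nu_measure:
  fixes f :: "real \<Rightarrow> real"
  assumes "c > 0" "f \<in> borel_measurable borel"
  shows "(LINT u|nu_measure c. f u) = (LINT u:{-1..1}|lborel. nu_density c u * f u)"
  unfolding nu_measure_def set_lebesgue_integral_def using assms nu_density_nonneg
  by (subst integral_density) (auto simp: mult_ac)

lemma distr_nu_measure_uminus: "distr (nu_measure c) borel uminus = nu_measure c"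
proof -
  define h where "h u = ennreal (indicator {-1..1} u * nu_density c u)" for u
  have "h (- u) = h u" for u by (auto simp: h_def nu_density_def indicator_def)
  moreover have "h \<in> borel_measurable borel" unfolding h_def[abs_def] by measurable
  ultimately show ?thesis
    using density_distr[of h borel "uminus :: real \<Rightarrow> real" lborel]
    by (simp add: nu_measure_def h_def[abs_def, symmetric] lborel_distr_uminus)
qed

lemma nu_measure_by_parts:
  fixes f f' :: "real \<Rightarrow> real"
  assumes c: "c > 0" and [measurable]: "f \<in> borel_measurable borel" "f' \<in> borel_measurable borel"
    and deriv: "\<And>u. u \<in> {-1..1} \<Longrightarrow> (f has_real_derivative f' u) (at u)"
    and cont': "continuous_on {-1..1} f'"
  shows "(LINT u|nu_measure c. - 2 * c * u * f u + (1 - u\<^sup>2) * f' u) = 0"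
proof -
  define K where "K = Gamma (c + 1/2) / (sqrt pi * Gamma c)"
  define g where "g u = - 2 * c * u * f u + (1 - u\<^sup>2) * f' u" for u
  have [measurable]: "g \<in> borel_measurable borel" unfolding g_def[abs_def] by measurable
  have cont: "continuous_on {-1..1} f"
    using deriv by (meson DERIV_continuous_on has_field_derivative_at_within)
  interpret prob_space "nu_measure c" by (rule prob_space_nu_measure[OF c])
  have "continuous_on {-1..1} g" unfolding g_def by (intro continuous_intros cont cont')
  then obtain B where "\<And>u. u \<in> {-1..1} \<Longrightarrow> norm (g u) \<le> B"
    by (rule continuous_on_compact_bound[OF compact_Icc]) blast
  then have "AE u in nu_measure c. norm (g u) \<le> B"
    by (intro eventually_mono[OF AE_nu_measure[of c]]) auto
  then have "integrable (nu_measure c) g" by (rule integrable_const_bound) simp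
  then have "set_integrable lborel {-1..1} (\<lambda>u. nu_density c u * g u)"
    unfolding nu_measure_def set_integrable_def using nu_density_nonneg[OF c]
    by (subst (asm) integrable_density) (auto simp: mult_ac)
  then have "(LINT u|nu_measure c. g u) = integral {-1..1} (\<lambda>u. nu_density c u * g u)"
    using LINT_nu_measure[OF c, of g] set_borel_integral_eq_integral(2) by simp
  also have "((\<lambda>u. nu_density c u * g u) has_integral
      (K * ((1 - 1\<^sup>2) powr c * f 1) - K * ((1 - (- 1)\<^sup>2) powr c * f (- 1)))) {-1..1}"
  proof (rule fundamental_theorem_of_calculus_interior)
    show "continuous_on {-1..1} (\<lambda>u. K * ((1 - u\<^sup>2) powr c * f u))"
      using c by (intro continuous_on_mult continuous_on_const cont continuous_on_powr')
        (auto intro!: continuous_intros simp: abs_square_le_1 abs_le_iff)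
    fix u :: real assume u: "u \<in> {-1<..<1}"
    then have pos: "1 - u\<^sup>2 > 0" by (simp add: abs_square_less_1 abs_less_iff)
    then have powr: "(1 - u\<^sup>2) powr c = (1 - u\<^sup>2) powr (c - 1) * (1 - u\<^sup>2)"
      by (simp add: powr_diff)
    have "((\<lambda>u. K * ((1 - u\<^sup>2) powr c * f u)) has_real_derivative
        K * (c * (1 - u\<^sup>2) powr (c - 1) * (- (2 * u)) * f u + (1 - u\<^sup>2) powr c * f' u)) (at u)"
      using pos u deriv[of u] by (auto intro!: derivative_eq_intros simp: powr_diff field_simps)
    also have "K * (c * (1 - u\<^sup>2) powr (c - 1) * (- (2 * u)) * f u + (1 - u\<^sup>2) powr c * f' u)
        = nu_density c u * g u"
      unfolding powr nu_density_def K_def[symmetric] g_def by (simp add: algebra_simps)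
    finally show "((\<lambda>u. K * ((1 - u\<^sup>2) powr c * f u)) has_vector_derivative nu_density c u * g u) (at u)"
      by (simp add: has_real_derivative_iff_has_vector_derivative)
  qed simp
  then have "integral {-1..1} (\<lambda>u. nu_density c u * g u) = 0" by (simp add: integral_unique)
  finally show ?thesis by (simp add: g_def)
qed

section \<open>Gegenbauer integrals\<close>

lemma integral_dominated_convergence_at:
  fixes f :: "'a :: metric_space \<Rightarrow> 'x \<Rightarrow> 'b :: {banach, second_countable_topology}" and w :: "'x \<Rightarrow> real"
  assumes meas: "\<forall>\<^sub>F h in at x. f h \<in> borel_measurable M" "g \<in> borel_measurable M"
    and w: "integrable M w"
    and lim: "AE y in M. ((\<lambda>h. f h y) \<longlongrightarrow> g y) (at x)"
    and bound: "\<forall>\<^sub>F h in at x. AE y in M. norm (f h y) \<le> w y"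
  shows "((\<lambda>h. LINT y|M. f h y) \<longlongrightarrow> (LINT y|M. g y)) (at x)"
  unfolding tendsto_at_iff_sequentially
proof (intro allI impI)
  fix X :: "nat \<Rightarrow> 'a"
  assume X: "\<forall>i. X i \<in> UNIV - {x}" "X \<longlonglongrightarrow> x"
  then have X_at: "filterlim X (at x) sequentially" by (auto simp: filterlim_at)
  then have "\<forall>\<^sub>F i in sequentially. f (X i) \<in> borel_measurable M \<and> (AE y in M. norm (f (X i) y) \<le> w y)"
    by (intro eventually_conj eventually_compose_filterlim[OF _ X_at] meas(1) bound)
  then obtain N where N: "\<And>i. i \<ge> N \<Longrightarrow> f (X i) \<in> borel_measurable M"
    "\<And>i. i \<ge> N \<Longrightarrow> AE y in M. norm (f (X i) y) \<le> w y"
    by (auto simp: eventually_sequentially)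
  have "(\<lambda>i. LINT y|M. f (X (i + N)) y) \<longlonglongrightarrow> (LINT y|M. g y)"
  proof (rule integral_dominated_convergence[OF meas(2) _ w])
    show "AE y in M. (\<lambda>i. f (X (i + N)) y) \<longlonglongrightarrow> g y"
      using lim by eventually_elim (intro LIMSEQ_ignore_initial_segment filterlim_compose[OF _ X_at])
  qed (use N in auto)
  then show "((\<lambda>h. LINT y|M. f h y) \<circ> X) \<longlonglongrightarrow> (LINT y|M. g y)"
    unfolding comp_def by (rule LIMSEQ_offset)
qed

lemma has_real_derivative_LINT:
  fixes f f' :: "real \<Rightarrow> 'x \<Rightarrow> real"
  assumes "finite_measure M" and \<delta>: "\<delta> > 0"
    and int: "\<And>r. \<bar>r - r0\<bar> < \<delta> \<Longrightarrow> integrable M (f r)"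
    and meas': "f' r0 \<in> borel_measurable M"
    and deriv: "AE y in M. \<forall>r. \<bar>r - r0\<bar> < \<delta> \<longrightarrow>
      ((\<lambda>r. f r y) has_real_derivative f' r y) (at r) \<and> \<bar>f' r y\<bar> \<le> B"
  shows "((\<lambda>r. LINT y|M. f r y) has_real_derivative (LINT y|M. f' r0 y)) (at r0)"
proof -
  interpret finite_measure M by fact
  define q where "q h y = (f (r0 + h) y - f r0 y) / h" for h y
  have near: "\<forall>\<^sub>F h in at 0. P h" if "\<And>h. h \<noteq> 0 \<Longrightarrow> \<bar>h\<bar> < \<delta> \<Longrightarrow> P h" for P :: "real \<Rightarrow> bool"
    unfolding eventually_at using \<delta> that by (intro exI[of _ \<delta>]) auto
  have "((\<lambda>h. LINT y|M. q h y) \<longlongrightarrow> (LINT y|M. f' r0 y)) (at 0)"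
  proof (rule integral_dominated_convergence_at[where w = "\<lambda>_. B"])
    show "\<forall>\<^sub>F h in at 0. q h \<in> borel_measurable M"
      using \<delta> unfolding q_def[abs_def]
      by (intro near borel_measurable_divide borel_measurable_diff borel_measurable_integrable int) auto
    show "AE y in M. ((\<lambda>h. q h y) \<longlongrightarrow> f' r0 y) (at 0)"
      using deriv by eventually_elim (use \<delta> in \<open>simp add: DERIV_def q_def\<close>)
    show "\<forall>\<^sub>F h in at 0. AE y in M. norm (q h y) \<le> B"
    proof (rule near)
      fix h :: real assume h: "h \<noteq> 0" "\<bar>h\<bar> < \<delta>"
      show "AE y in M. norm (q h y) \<le> B"
        using deriv
      proof eventually_elim
        case (elim y)
        have "norm (f (r0 + h) y - f r0 y) \<le> B * norm (r0 + h - r0)"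
          using elim h \<delta>
          by (intro field_differentiable_bound[where S = "ball r0 \<delta>" and f' = "\<lambda>r. f' r y"])
            (auto simp: dist_real_def abs_minus_commute intro: has_field_derivative_at_within)
        then show ?case using h by (simp add: q_def abs_divide divide_le_eq)
      qed
    qed
  qed (use meas' in auto)
  moreover have "\<forall>\<^sub>F h in at 0. (LINT y|M. q h y) = ((LINT y|M. f (r0 + h) y) - (LINT y|M. f r0 y)) / h"
    unfolding q_def using \<delta> by (intro near) (simp add: Bochner_Integration.integral_diff int)
  ultimately show ?thesis unfolding DERIV_def by (rule Lim_transform_eventually)
qed

definition xi_form :: "real \<Rightarrow> real \<Rightarrow> real \<times> real \<Rightarrow> real" where
  "xi_form p s q = snd q * p + fst q * s"

abbreviation unit_square :: "(real \<times> real) set" where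
  "unit_square \<equiv> {-1..1} \<times> {-1..1}"

lemma xi_form_measurable [measurable]: "xi_form p s \<in> borel_measurable (borel \<Otimes>\<^sub>M borel)"
  unfolding xi_form_def[abs_def] by measurable

lemma poisson_denom_measurable [measurable (raw)]:
  assumes [measurable]: "f \<in> borel_measurable M" "g \<in> borel_measurable M"
  shows "(\<lambda>x. poisson_denom (f x) (g x)) \<in> borel_measurable M"
  unfolding poisson_denom_def by measurable

lemma abs_xi_form_le:
  assumes "\<bar>p\<bar> + \<bar>s\<bar> \<le> 1" "q \<in> unit_square"
  shows "\<bar>xi_form p s q\<bar> \<le> 1"
proof -
  have "\<bar>snd q * p\<bar> \<le> \<bar>p\<bar>" "\<bar>fst q * s\<bar> \<le> \<bar>s\<bar>"
    using assms(2) by (auto simp: abs_mult abs_le_iff intro!: mult_left_le_one_le)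
  with assms(1) show ?thesis unfolding xi_form_def by linarith
qed

lemma continuous_on_poisson_denom_powr:
  assumes "\<bar>p\<bar> + \<bar>s\<bar> \<le> 1" "continuous_on X g" "continuous_on X h"
    and "\<And>x. x \<in> X \<Longrightarrow> \<bar>g x\<bar> < 1" "\<And>x. x \<in> X \<Longrightarrow> h x \<in> unit_square"
  shows "continuous_on X (\<lambda>x. poisson_denom (g x) (xi_form p s (h x)) powr c)"
proof (rule continuous_on_powr)
  show "continuous_on X (\<lambda>x. poisson_denom (g x) (xi_form p s (h x)))"
    unfolding poisson_denom_def xi_form_def using assms(2,3) by (intro continuous_intros)
  show "\<forall>x\<in>X. poisson_denom (g x) (xi_form p s (h x)) \<noteq> 0"
    using assms(1,4,5) by (metis abs_xi_form_le less_irrefl poisson_denom_pos)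
qed simp

lemma DERIV_poisson_denom_powr:
  assumes "(g has_real_derivative g') (at x)" "(h has_real_derivative h') (at x)"
    and "\<bar>g x\<bar> < 1" "\<bar>h x\<bar> \<le> 1"
  shows "((\<lambda>x. poisson_denom (g x) (h x) powr c) has_real_derivative
    c * poisson_denom (g x) (h x) powr (c - 1) * (2 * (g x - h x) * g' - 2 * g x * h')) (at x)"
proof -
  have "((\<lambda>x. poisson_denom (g x) (h x)) has_real_derivative (2 * (g x - h x) * g' - 2 * g x * h')) (at x)"
    unfolding poisson_denom_def using assms(1,2)
    by (auto intro!: derivative_eq_intros simp: algebra_simps)
  from DERIV_fun_powr[OF this poisson_denom_pos[OF assms(4,3)], of c] show ?thesis by simp
qed

context multiplicity_pair
begin

definition nu_pair :: "(real \<times> real) measure" where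
  "nu_pair = nu_measure a \<Otimes>\<^sub>M nu_measure b"

sublocale nu_a: prob_space "nu_measure a"
  by (rule prob_space_nu_measure[OF a_pos])

sublocale nu_b: prob_space "nu_measure b"
  by (rule prob_space_nu_measure[OF b_pos])

sublocale nu_ab: pair_prob_space "nu_measure a" "nu_measure b" ..

sublocale nu: prob_space nu_pair
  unfolding nu_pair_def by unfold_locales

lemma sets_nu_pair [measurable_cong, simp]: "sets nu_pair = sets (borel \<Otimes>\<^sub>M borel)"
  unfolding nu_pair_def by (rule sets_pair_measure_cong) simp_all

lemma AE_nu_pair: "AE q in nu_pair. q \<in> unit_square"
  unfolding nu_pair_def
proof (rule nu_ab.AE_pair_measure)
  show "{q \<in> space (nu_measure a \<Otimes>\<^sub>M nu_measure b). q \<in> unit_square} \<in> sets (nu_measure a \<Otimes>\<^sub>M nu_measure b)"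
    by measurable
  show "AE u in nu_measure a. AE v in nu_measure b. (u, v) \<in> unit_square"
    using AE_nu_measure[of a]
  proof eventually_elim
    case (elim u)
    then show ?case using AE_nu_measure[of b] by (auto elim: eventually_mono)
  qed
qed

lemma LINT_nu_pair_cong:
  assumes "f \<in> borel_measurable (borel \<Otimes>\<^sub>M borel)" "g \<in> borel_measurable (borel \<Otimes>\<^sub>M borel)"
    and "\<And>q. q \<in> unit_square \<Longrightarrow> f q = g q"
  shows "(LINT q|nu_pair. f q) = (LINT q|nu_pair. g q :: real)"
  using AE_nu_pair assms by (intro integral_cong_AE) (auto elim!: eventually_mono)

lemma integrable_nu_pair:
  fixes f :: "real \<times> real \<Rightarrow> real"
  assumes "continuous_on unit_square f" "f \<in> borel_measurable (borel \<Otimes>\<^sub>M borel)"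
  shows "integrable nu_pair f"
proof -
  have "compact unit_square" by (intro compact_Times) auto
  then obtain B where "\<And>q. q \<in> unit_square \<Longrightarrow> norm (f q) \<le> B"
    using assms(1) by (rule continuous_on_compact_bound) blast
  then have "AE q in nu_pair. norm (f q) \<le> B"
    by (intro eventually_mono[OF AE_nu_pair]) blast
  then show ?thesis using assms(2) by (intro nu.integrable_const_bound) auto
qed

lemma LINT_nu_pair_map:
  fixes f :: "real \<times> real \<Rightarrow> real"
  assumes f: "f \<in> borel_measurable (borel \<Otimes>\<^sub>M borel)"
    and [measurable]: "g \<in> borel_measurable borel" "h \<in> borel_measurable borel"
    and g: "distr (nu_measure a) borel g = nu_measure a" and h: "distr (nu_measure b) borel h = nu_measure b"
  shows "(LINT q|nu_pair. f (g (fst q), h (snd q))) = (LINT q|nu_pair. f q)"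
proof -
  have "nu_pair = distr (nu_measure a) borel g \<Otimes>\<^sub>M distr (nu_measure b) borel h"
    by (simp add: nu_pair_def g h)
  also have "\<dots> = distr nu_pair (borel \<Otimes>\<^sub>M borel) (\<lambda>(u, v). (g u, h v))"
    unfolding nu_pair_def
    by (rule pair_measure_distr) (auto simp: h intro: nu_b.sigma_finite_measure_axioms)
  finally have "nu_pair = distr nu_pair (borel \<Otimes>\<^sub>M borel) (\<lambda>(u, v). (g u, h v))" .
  then have "(LINT q|nu_pair. f q) = (LINT q|distr nu_pair (borel \<Otimes>\<^sub>M borel) (\<lambda>(u, v). (g u, h v)). f q)"
    by simp
  also have "\<dots> = (LINT q|nu_pair. f (g (fst q), h (snd q)))"
    using f by (subst integral_distr) (auto simp: case_prod_beta')
  finally show ?thesis ..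
qed

lemma LINT_nu_pair_flip_fst:
  fixes f :: "real \<times> real \<Rightarrow> real"
  assumes "f \<in> borel_measurable (borel \<Otimes>\<^sub>M borel)"
  shows "(LINT q|nu_pair. f (- fst q, snd q)) = (LINT q|nu_pair. f q)"
  using LINT_nu_pair_map[OF assms, of uminus "\<lambda>v. v"] by (simp add: distr_nu_measure_uminus distr_id2)

lemma LINT_nu_pair_flip_snd:
  fixes f :: "real \<times> real \<Rightarrow> real"
  assumes "f \<in> borel_measurable (borel \<Otimes>\<^sub>M borel)"
  shows "(LINT q|nu_pair. f (fst q, - snd q)) = (LINT q|nu_pair. f q)"
  using LINT_nu_pair_map[OF assms, of "\<lambda>u. u" uminus] by (simp add: distr_nu_measure_uminus distr_id2)

lemma nu_pair_by_parts_fst: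
  fixes f f' :: "real \<times> real \<Rightarrow> real"
  assumes [measurable]: "f \<in> borel_measurable (borel \<Otimes>\<^sub>M borel)" "f' \<in> borel_measurable (borel \<Otimes>\<^sub>M borel)"
    and deriv: "\<And>u v. u \<in> {-1..1} \<Longrightarrow> v \<in> {-1..1} \<Longrightarrow> ((\<lambda>u. f (u, v)) has_real_derivative f' (u, v)) (at u)"
    and cont: "continuous_on unit_square f" "continuous_on unit_square f'"
  shows "(LINT q|nu_pair. - 2 * a * fst q * f q + (1 - (fst q)\<^sup>2) * f' q) = 0"
proof -
  define F where "F q = - 2 * a * fst q * f q + (1 - (fst q)\<^sup>2) * f' q" for q
  have [measurable]: "F \<in> borel_measurable (borel \<Otimes>\<^sub>M borel)" unfolding F_def[abs_def] by measurable
  have "integrable nu_pair F"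
    unfolding F_def[abs_def] by (intro integrable_nu_pair continuous_intros cont) measurable
  then have int: "integrable (nu_measure a \<Otimes>\<^sub>M nu_measure b) (\<lambda>(u, v). F (u, v))"
    by (simp add: nu_pair_def case_prod_eta)
  have "(LINT q|nu_pair. F q) = (LINT v|nu_measure b. LINT u|nu_measure a. F (u, v))"
    using nu_ab.integral_snd[OF int] by (simp add: nu_pair_def)
  also have "\<dots> = (LINT v|nu_measure b. 0)"
  proof (rule integral_cong_AE)
    show "AE v in nu_measure b. (LINT u|nu_measure a. F (u, v)) = 0"
    proof (rule eventually_mono[OF AE_nu_measure])
      fix v :: real assume v: "v \<in> {-1..1}"
      have "continuous_on {-1..1} (\<lambda>u. f' (u, v))"
        using v by (intro continuous_on_compose2[OF cont(2)] continuous_intros) auto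
      then show "(LINT u|nu_measure a. F (u, v)) = 0"
        using nu_measure_by_parts[OF a_pos, of "\<lambda>u. f (u, v)" "\<lambda>u. f' (u, v)"] deriv v
        by (simp add: F_def)
    qed
  qed (use nu_ab.borel_measurable_lebesgue_integral in measurable)
  finally show ?thesis by (simp add: F_def)
qed

lemma nu_pair_by_parts_snd:
  fixes f f' :: "real \<times> real \<Rightarrow> real"
  assumes [measurable]: "f \<in> borel_measurable (borel \<Otimes>\<^sub>M borel)" "f' \<in> borel_measurable (borel \<Otimes>\<^sub>M borel)"
    and deriv: "\<And>u v. u \<in> {-1..1} \<Longrightarrow> v \<in> {-1..1} \<Longrightarrow> ((\<lambda>v. f (u, v)) has_real_derivative f' (u, v)) (at v)"
    and cont: "continuous_on unit_square f" "continuous_on unit_square f'"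
  shows "(LINT q|nu_pair. - 2 * b * snd q * f q + (1 - (snd q)\<^sup>2) * f' q) = 0"
proof -
  interpret swapped: multiplicity_pair b a by unfold_locales (rule b_pos a_pos)+
  have swap: "continuous_on unit_square (\<lambda>q. g (snd q, fst q))" if "continuous_on unit_square g"
    for g :: "real \<times> real \<Rightarrow> real"
    by (rule continuous_on_compose2[OF that]) (auto intro!: continuous_intros)
  let ?F = "\<lambda>q. - 2 * b * snd q * f q + (1 - (snd q)\<^sup>2) * f' q"
  have "0 = (LINT q|(nu_measure b \<Otimes>\<^sub>M nu_measure a). (case q of (v, u) \<Rightarrow> ?F (u, v)))"
    using swapped.nu_pair_by_parts_fst[of "\<lambda>q. f (snd q, fst q)" "\<lambda>q. f' (snd q, fst q)"] deriv cont
    by (simp add: swap swapped.nu_pair_def case_prod_beta')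
  also have "\<dots> = (LINT q|nu_pair. ?F q)"
    unfolding nu_pair_def by (rule nu_ab.integral_product_swap) measurable
  finally show ?thesis ..
qed

definition gegenbauer_kernel :: "real \<Rightarrow> real \<Rightarrow> real \<Rightarrow> real \<Rightarrow> real \<times> real \<Rightarrow> real" where
  "gegenbauer_kernel c p s r q = poisson_denom r (xi_form p s q) powr (- lam - c)"

lemma gegenbauer_kernel_measurable [measurable]:
  "gegenbauer_kernel c p s r \<in> borel_measurable (borel \<Otimes>\<^sub>M borel)"
  unfolding gegenbauer_kernel_def[abs_def] by measurable

lemma continuous_on_gegenbauer_kernel:
  assumes "\<bar>p\<bar> + \<bar>s\<bar> \<le> 1" "\<bar>r\<bar> < 1"
  shows "continuous_on unit_square (gegenbauer_kernel c p s r)"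
  unfolding gegenbauer_kernel_def[abs_def]
  by (rule continuous_on_poisson_denom_powr[OF assms(1)]) (use assms(2) in \<open>auto intro: continuous_intros\<close>)

lemma DERIV_gegenbauer_kernel:
  assumes "\<bar>p\<bar> + \<bar>s\<bar> \<le> 1" "\<bar>r\<bar> < 1"
    and "((\<lambda>x. xi_form p s (g x)) has_real_derivative h') (at x)" "g x \<in> unit_square"
  shows "((\<lambda>x. gegenbauer_kernel 1 p s r (g x)) has_real_derivative
    (lam + 1) * (2 * r * h') * gegenbauer_kernel 2 p s r (g x)) (at x)"
  using DERIV_poisson_denom_powr[OF DERIV_const[of r] assms(3,2) abs_xi_form_le[OF assms(1,4)], of "- lam - 1"]
  by (simp add: gegenbauer_kernel_def algebra_simps)

definition gegenbauer_integral :: "real \<Rightarrow> real \<Rightarrow> real \<Rightarrow> real \<Rightarrow> real \<Rightarrow> real" where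
  "gegenbauer_integral e d p s r = (LINT q|nu_pair.
     (1 + e * fst q) * (1 + d * snd q) * gegenbauer_kernel 1 p s r q)"

lemma gegenbauer_integral_flip_fst: "gegenbauer_integral e d p (- s) r = gegenbauer_integral (- e) d p s r"
proof -
  have "gegenbauer_integral e d p (- s) r = (LINT q|nu_pair.
      (1 + e * - fst q) * (1 + d * snd q) * gegenbauer_kernel 1 p (- s) r (- fst q, snd q))"
    unfolding gegenbauer_integral_def
    by (subst LINT_nu_pair_flip_fst[symmetric]) simp_all
  then show ?thesis by (simp add: gegenbauer_integral_def gegenbauer_kernel_def xi_form_def)
qed

lemma gegenbauer_integral_flip_snd: "gegenbauer_integral e d (- p) s r = gegenbauer_integral e (- d) p s r"
proof -
  have "gegenbauer_integral e d (- p) s r = (LINT q|nu_pair.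
      (1 + e * fst q) * (1 + d * - snd q) * gegenbauer_kernel 1 (- p) s r (fst q, - snd q))"
    unfolding gegenbauer_integral_def
    by (subst LINT_nu_pair_flip_snd[symmetric]) simp_all
  then show ?thesis by (simp add: gegenbauer_integral_def gegenbauer_kernel_def xi_form_def)
qed

lemma integrable_gegenbauer:
  assumes "\<bar>p\<bar> + \<bar>s\<bar> \<le> 1" "\<bar>r\<bar> < 1"
  shows "integrable nu_pair (\<lambda>q. (1 + e * fst q) * (1 + d * snd q) * gegenbauer_kernel c p s r q)"
  by (intro integrable_nu_pair continuous_intros continuous_on_gegenbauer_kernel assms) measurable

lemma sum_signs_gegenbauer_integral:
  assumes "\<bar>p\<bar> + \<bar>s\<bar> \<le> 1" "\<bar>r\<bar> < 1"
  shows "(\<Sum>e\<in>{1, -1}. \<Sum>d\<in>{1, -1}. gegenbauer_integral e d p s r) = 4 * gegenbauer_integral 0 0 p s r"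
proof -
  let ?K = "gegenbauer_kernel 1 p s r"
  have "(\<Sum>e\<in>{1, -1}. \<Sum>d\<in>{1, -1}. gegenbauer_integral e d p s r)
      = (LINT q|nu_pair. (\<Sum>e\<in>{1, -1}. \<Sum>d\<in>{1, -1}. (1 + e * fst q) * (1 + d * snd q) * ?K q))"
    by (simp only: gegenbauer_integral_def Bochner_Integration.integral_sum Bochner_Integration.integrable_sum
        integrable_gegenbauer[OF assms])
  also have "\<dots> = (LINT q|nu_pair. 4 * ?K q)"
    by (intro Bochner_Integration.integral_cong) (simp_all add: algebra_simps)
  finally show ?thesis by (simp add: gegenbauer_integral_def)
qed

lemma gegenbauer_integral_at_0: "gegenbauer_integral 1 1 p s 0 = 1"
proof -
  have mean: "(LINT u|nu_measure c. 1 + u) = 1" if c: "c > 0" for c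
  proof -
    interpret prob_space "nu_measure c" by (rule prob_space_nu_measure[OF c])
    have "AE u in nu_measure c. norm u \<le> 1"
      by (rule eventually_mono[OF AE_nu_measure]) auto
    then have "integrable (nu_measure c) (\<lambda>u. u)" by (rule integrable_const_bound) simp
    moreover have "(LINT u|nu_measure c. u) = (LINT u|distr (nu_measure c) borel uminus. u)"
      by (simp add: distr_nu_measure_uminus)
    then have "(LINT u|nu_measure c. u) = 0" by (simp add: integral_distr)
    ultimately show ?thesis using prob_space by simp
  qed
  have int: "integrable (nu_measure a \<Otimes>\<^sub>M nu_measure b) (\<lambda>(u, v). (1 + u) * (1 + v))"
    using integrable_nu_pair[of "\<lambda>q. (1 + fst q) * (1 + snd q)"]
    by (simp add: nu_pair_def case_prod_beta' continuous_intros)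
  have "gegenbauer_integral 1 1 p s 0 =
      (LINT q|(nu_measure a \<Otimes>\<^sub>M nu_measure b). (case q of (u, v) \<Rightarrow> (1 + u) * (1 + v)))"
    by (simp add: gegenbauer_integral_def gegenbauer_kernel_def poisson_denom_def nu_pair_def case_prod_beta')
  also have "\<dots> = (LINT u|nu_measure a. LINT v|nu_measure b. (1 + u) * (1 + v))"
    using nu_ab.integral_fst[OF int] by simp
  also have "\<dots> = 1" using mean[OF a_pos] mean[OF b_pos] by simp
  finally show ?thesis .
qed

lemma gegenbauer_integral_has_derivative:
  assumes ps: "\<bar>p\<bar> + \<bar>s\<bar> \<le> 1" and r: "\<bar>r\<bar> < 1"
  shows "(gegenbauer_integral e d p s has_real_derivative (LINT q|nu_pair. (1 + e * fst q) * (1 + d * snd q)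
    * ((- lam - 1) * gegenbauer_kernel 2 p s r q * (2 * (r - xi_form p s q))))) (at r)"
proof -
  let ?W = "\<lambda>q :: real \<times> real. (1 + e * fst q) * (1 + d * snd q)"
  let ?f = "\<lambda>r q. ?W q * gegenbauer_kernel 1 p s r q"
  let ?f' = "\<lambda>r q. ?W q * ((- lam - 1) * gegenbauer_kernel 2 p s r q * (2 * (r - xi_form p s q)))"
  define \<delta> where "\<delta> = (1 - \<bar>r\<bar>) / 2"
  have "\<delta> > 0" using r by (simp add: \<delta>_def)
  have \<delta>: "\<bar>r'\<bar> < 1" if "\<bar>r' - r\<bar> \<le> \<delta>" for r'
    using that r abs_triangle_ineq[of "r' - r" r] by (simp add: \<delta>_def)
  define X where "X = cball r \<delta> \<times> unit_square"
  have "compact X" unfolding X_def by (intro compact_Times) auto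
  moreover have "continuous_on X (\<lambda>x. ?f' (fst x) (snd x))"
    unfolding X_def gegenbauer_kernel_def
    by (intro continuous_on_mult continuous_on_poisson_denom_powr ps)
      (auto intro!: continuous_intros \<delta> simp: xi_form_def dist_real_def abs_minus_commute)
  ultimately obtain B where B: "\<And>x. x \<in> X \<Longrightarrow> norm (?f' (fst x) (snd x)) \<le> B"
    by (rule continuous_on_compact_bound) blast
  have "((\<lambda>r. LINT q|nu_pair. ?f r q) has_real_derivative (LINT q|nu_pair. ?f' r q)) (at r)"
  proof (rule has_real_derivative_LINT[OF nu.finite_measure_axioms \<open>\<delta> > 0\<close>])
    show "integrable nu_pair (?f r')" if "\<bar>r' - r\<bar> < \<delta>" for r'
      using that by (intro integrable_gegenbauer ps \<delta>) auto
    show "?f' r \<in> borel_measurable nu_pair" by measurable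
    show "AE q in nu_pair. \<forall>r'. \<bar>r' - r\<bar> < \<delta> \<longrightarrow>
        ((\<lambda>r. ?f r q) has_real_derivative ?f' r' q) (at r') \<and> \<bar>?f' r' q\<bar> \<le> B"
    proof (rule eventually_mono[OF AE_nu_pair], intro allI impI conjI)
      fix q r' assume q: "q \<in> unit_square" and r': "\<bar>r' - r\<bar> < \<delta>"
      have "((\<lambda>r. poisson_denom r (xi_form p s q) powr (- lam - 1)) has_real_derivative
          (- lam - 1) * poisson_denom r' (xi_form p s q) powr (- lam - 1 - 1)
            * (2 * (r' - xi_form p s q) * 1 - 2 * r' * 0)) (at r')"
        using q r' by (intro DERIV_poisson_denom_powr DERIV_ident DERIV_const \<delta> abs_xi_form_le ps) auto
      then show "((\<lambda>r. ?f r q) has_real_derivative ?f' r' q) (at r')"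
        unfolding gegenbauer_kernel_def by (intro DERIV_cmult) simp
      have "(r', q) \<in> X" using q r' by (auto simp: X_def dist_real_def abs_minus_commute)
      from B[OF this] show "\<bar>?f' r' q\<bar> \<le> B" by simp
    qed
  qed
  then show ?thesis by (simp only: gegenbauer_integral_def[abs_def])
qed

lemma gegenbauer_kernel_fst_by_parts:
  assumes ps: "\<bar>p\<bar> + \<bar>s\<bar> \<le> 1" and r: "\<bar>r\<bar> < 1"
  shows "(LINT q|nu_pair. - 2 * a * fst q * ((1 + snd q) * gegenbauer_kernel 1 p s r q)
    + (1 - (fst q)\<^sup>2) * ((1 + snd q) * ((lam + 1) * (2 * r * s) * gegenbauer_kernel 2 p s r q))) = 0"
  by (rule nu_pair_by_parts_fst)
    (auto intro!: derivative_eq_intros DERIV_gegenbauer_kernel[OF ps r] continuous_intros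
      continuous_on_gegenbauer_kernel[OF ps r] simp: xi_form_def)

lemma gegenbauer_kernel_snd_by_parts:
  assumes ps: "\<bar>p\<bar> + \<bar>s\<bar> \<le> 1" and r: "\<bar>r\<bar> < 1"
  shows "(LINT q|nu_pair. - 2 * b * snd q * ((1 + fst q) * gegenbauer_kernel 1 p s r q)
    + (1 - (snd q)\<^sup>2) * ((1 + fst q) * ((lam + 1) * (2 * r * p) * gegenbauer_kernel 2 p s r q))) = 0"
  by (rule nu_pair_by_parts_snd)
    (auto intro!: derivative_eq_intros DERIV_gegenbauer_kernel[OF ps r] continuous_intros
      continuous_on_gegenbauer_kernel[OF ps r] simp: xi_form_def)

lemma gegenbauer_kernel_1_eq:
  assumes "\<bar>p\<bar> + \<bar>s\<bar> \<le> 1" "\<bar>r\<bar> < 1" "q \<in> unit_square"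
  shows "gegenbauer_kernel 1 p s r q = poisson_denom r (xi_form p s q) * gegenbauer_kernel 2 p s r q"
proof -
  have "0 < poisson_denom r (xi_form p s q)"
    using assms by (intro poisson_denom_pos abs_xi_form_le)
  then show ?thesis
    using powr_add[of "poisson_denom r (xi_form p s q)" 1 "- lam - 2"] by (simp add: gegenbauer_kernel_def)
qed

text \<open>The quotient of Dunkl's Poisson kernel of the four-element dihedral group and the classical Poisson
  kernel.\<close>

definition klein_poisson :: "real \<Rightarrow> real \<Rightarrow> real \<Rightarrow> real" where
  "klein_poisson p s r = poisson_denom r (p + s) * gegenbauer_integral 1 1 p s r"

text \<open>The radial equation for \<open>k = 1\<close>: the two sides differ by exact derivatives in \<open>u\<close> and \<open>v\<close>.\<close>

lemma klein_poisson_radial: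
  assumes ps: "\<bar>p\<bar> + \<bar>s\<bar> \<le> 1" and r: "\<bar>r\<bar> < 1"
  obtains M' where
    "(klein_poisson p s has_real_derivative M') (at r)"
    "r * M' = (1 - r\<^sup>2) * (a * gegenbauer_integral (- 1) 1 p s r + b * gegenbauer_integral 1 (- 1) p s r)
      - lam * klein_poisson p s r"
proof -
  define N where "N = poisson_denom r (p + s)"
  let ?G = "\<lambda>e d q. (1 + e * fst q) * (1 + d * snd q) * gegenbauer_kernel 1 p s r q"
  let ?G' = "\<lambda>q. (1 + 1 * fst q) * (1 + 1 * snd q)
      * ((- lam - 1) * gegenbauer_kernel 2 p s r q * (2 * (r - xi_form p s q)))"
  let ?U = "\<lambda>q. - 2 * a * fst q * ((1 + snd q) * gegenbauer_kernel 1 p s r q)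
      + (1 - (fst q)\<^sup>2) * ((1 + snd q) * ((lam + 1) * (2 * r * s) * gegenbauer_kernel 2 p s r q))"
  let ?V = "\<lambda>q. - 2 * b * snd q * ((1 + fst q) * gegenbauer_kernel 1 p s r q)
      + (1 - (snd q)\<^sup>2) * ((1 + fst q) * ((lam + 1) * (2 * r * p) * gegenbauer_kernel 2 p s r q))"
  have int: "integrable nu_pair (?G e d)" "integrable nu_pair ?G'"
    "integrable nu_pair ?U" "integrable nu_pair ?V" for e d
    unfolding xi_form_def
    by (intro integrable_nu_pair continuous_intros continuous_on_gegenbauer_kernel ps r; measurable)+
  define M' where "M' = 2 * (r - (p + s)) * gegenbauer_integral 1 1 p s r + (LINT q|nu_pair. ?G' q) * N"
  have deriv: "(klein_poisson p s has_real_derivative M') (at r)"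
    unfolding klein_poisson_def[abs_def] M'_def N_def poisson_denom_def
    using gegenbauer_integral_has_derivative[OF ps r, of 1 1]
    by (auto intro!: derivative_eq_intros simp: algebra_simps)
  have "r * M' + lam * (N * gegenbauer_integral 1 1 p s r)
      = (lam * N + r * (2 * (r - (p + s)))) * gegenbauer_integral 1 1 p s r + r * N * (LINT q|nu_pair. ?G' q)"
    by (simp add: M'_def algebra_simps)
  also have "\<dots> = (LINT q|nu_pair. (lam * N + r * (2 * (r - (p + s)))) * ?G 1 1 q + r * N * ?G' q)"
    unfolding gegenbauer_integral_def
    by (simp only: int Bochner_Integration.integral_add integrable_mult_right integral_mult_right_zero)
  also have "\<dots> = (LINT q|nu_pair. (1 - r\<^sup>2) * (a * ?G (- 1) 1 q + b * ?G 1 (- 1) q - ?U q - ?V q))"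
  proof (rule LINT_nu_pair_cong)
    fix q assume q: "q \<in> unit_square"
    show "(lam * N + r * (2 * (r - (p + s)))) * ?G 1 1 q + r * N * ?G' q
      = (1 - r\<^sup>2) * (a * ?G (- 1) 1 q + b * ?G 1 (- 1) q - ?U q - ?V q)"
      unfolding gegenbauer_kernel_1_eq[OF ps r q] N_def poisson_denom_def xi_form_def by algebra
  qed measurable
  also have "\<dots> = (1 - r\<^sup>2) * (a * gegenbauer_integral (- 1) 1 p s r + b * gegenbauer_integral 1 (- 1) p s r
      - (LINT q|nu_pair. ?U q) - (LINT q|nu_pair. ?V q))"
    unfolding gegenbauer_integral_def
    by (simp only: int Bochner_Integration.integral_add Bochner_Integration.integral_diff integral_mult_right_zero
        Bochner_Integration.integrable_add Bochner_Integration.integrable_diff integrable_mult_right)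
  finally show thesis
    using that[OF deriv] unfolding gegenbauer_kernel_fst_by_parts[OF ps r] gegenbauer_kernel_snd_by_parts[OF ps r]
    by (simp add: N_def klein_poisson_def)
qed

end

section \<open>The closed form of the generating function\<close>

definition tanh_double :: "real \<Rightarrow> real" where
  "tanh_double t = 2 * t / (1 + t\<^sup>2)"

lemma one_plus_square_pos: "0 < 1 + (t :: real)\<^sup>2"
  by (simp add: add_pos_nonneg)

lemma abs_tanh_double_lt_1:
  assumes "\<bar>t\<bar> < 1"
  shows "\<bar>tanh_double t\<bar> < 1"
proof -
  have "0 < (1 - \<bar>t\<bar>)\<^sup>2" using assms by simp
  then have "2 * \<bar>t\<bar> < 1 + t\<^sup>2" by (simp add: power2_diff)
  then show ?thesis
    using one_plus_square_pos[of t] by (simp add: tanh_double_def abs_mult)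
qed

lemma DERIV_tanh_double: "(tanh_double has_real_derivative 2 * (1 - t\<^sup>2) / (1 + t\<^sup>2)\<^sup>2) (at t)"
  using one_plus_square_pos[of t] unfolding tanh_double_def[abs_def]
  by (auto intro!: derivative_eq_intros simp: field_simps power2_eq_square)

lemma one_minus_tanh_double_mult: "1 - tanh_double t * c = poisson_denom t c / (1 + t\<^sup>2)"
  using one_plus_square_pos[of t] by (simp add: tanh_double_def poisson_denom_def field_simps)

lemma tanh_double_surj:
  assumes "0 \<le> r" "r < 1"
  obtains t where "0 \<le> t" "t < 1" "tanh_double t = r"
proof -
  have "continuous_on {0..1} tanh_double"
    by (intro DERIV_continuous_on[OF has_field_derivative_at_within[OF DERIV_tanh_double]])
  then obtain t where "0 \<le> t" "t \<le> 1" "tanh_double t = r"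
    using IVT'[of tanh_double 0 r 1] assms by (auto simp: tanh_double_def)
  moreover from this have "t \<noteq> 1" using assms by (auto simp: tanh_double_def)
  ultimately show thesis using that by simp
qed

lemma abs_inner_unit_le: "cmod x = 1 \<Longrightarrow> cmod y = 1 \<Longrightarrow> \<bar>x \<bullet> y\<bar> \<le> 1"
  using Cauchy_Schwarz_ineq2[of x y] by simp

lemma sum_even_odd:
  fixes h :: "int \<Rightarrow> 'a :: comm_monoid_add"
  shows "(\<Sum>j<2 * m. h (int j)) = (\<Sum>i<m. h (2 * int i)) + (\<Sum>i<m. h (2 * int i + 1))"
  by (induction m) (auto simp: algebra_simps)

context dihedral_group
begin

lemma orbit_sum_cosets:
  "orbit_sum f y = (\<Sum>i<k. f (rot (2 * int i) y)) + (\<Sum>i<k. f (rot (2 * int i) (rot 1 y)))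
    + (\<Sum>i<k. f (rot (2 * int i) (rfl 0 y))) + (\<Sum>i<k. f (rot (2 * int i) (rfl 1 y)))"
  unfolding orbit_sum_def sum.distrib sum_even_odd[of "\<lambda>i. f (rot i y)"] sum_even_odd[of "\<lambda>i. f (rfl i y)"]
  by (simp add: rot_rot rot_rfl add.assoc)

definition re_prod :: "complex \<Rightarrow> complex \<Rightarrow> real" where
  "re_prod x y = Re (x ^ k) * Re (y ^ k)"

definition im_prod :: "complex \<Rightarrow> complex \<Rightarrow> real" where
  "im_prod x y = Im (x ^ k) * Im (y ^ k)"

lemma re_prod_rot: "re_prod x (rot j y) = (if even j then re_prod x y else - re_prod x y)"
  and im_prod_rot: "im_prod x (rot j y) = (if even j then im_prod x y else - im_prod x y)"
  by (simp_all add: re_prod_def im_prod_def rot_power)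

lemma re_prod_rfl: "re_prod x (rfl j y) = (if even j then re_prod x y else - re_prod x y)"
  and im_prod_rfl: "im_prod x (rfl j y) = (if even j then - im_prod x y else im_prod x y)"
  by (simp_all add: re_prod_def im_prod_def rfl_power del: complex_cnj_power)

lemma re_prod_rfl_left: "re_prod (rfl j x) y = re_prod x (rfl j y)"
  and im_prod_rfl_left: "im_prod (rfl j x) y = im_prod x (rfl j y)"
  by (simp_all add: re_prod_def im_prod_def rfl_power del: complex_cnj_power)

lemma Re_power_cnj_mult: "Re ((cnj x * y) ^ k) = re_prod x y + im_prod x y"
  by (simp add: power_mult_distrib re_prod_def im_prod_def flip: complex_cnj_power)

lemma abs_re_prod_im_prod_le:
  assumes "cmod x = 1" "cmod y = 1"
  shows "\<bar>re_prod x y\<bar> + \<bar>im_prod x y\<bar> \<le> 1"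
proof -
  define X Y where "X = x ^ k" and "Y = y ^ k"
  have "(Re X)\<^sup>2 + (Im X)\<^sup>2 = 1" "(Re Y)\<^sup>2 + (Im Y)\<^sup>2 = 1"
    using assms by (simp_all add: X_def Y_def norm_power cmod_power2[symmetric])
  moreover have "2 * \<bar>Re X\<bar> * \<bar>Re Y\<bar> \<le> \<bar>Re X\<bar>\<^sup>2 + \<bar>Re Y\<bar>\<^sup>2" "2 * \<bar>Im X\<bar> * \<bar>Im Y\<bar> \<le> \<bar>Im X\<bar>\<^sup>2 + \<bar>Im Y\<bar>\<^sup>2"
    by (rule sum_squares_bound)+
  ultimately have "\<bar>Re X\<bar> * \<bar>Re Y\<bar> + \<bar>Im X\<bar> * \<bar>Im Y\<bar> \<le> 1"
    unfolding power2_abs by linarith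
  then show ?thesis by (simp add: re_prod_def im_prod_def X_def Y_def abs_mult)
qed

end

context dihedral
begin

definition closed_form :: "complex \<Rightarrow> real \<Rightarrow> complex \<Rightarrow> real" where
  "closed_form y t x = (1 + t\<^sup>2) powr (index + 1)
     * klein_poisson (re_prod x y) (im_prod x y) (t ^ k) / poisson_denom t (x \<bullet> y)"

definition coset_factor :: "real \<Rightarrow> real" where
  "coset_factor t = (1 + t\<^sup>2) powr (index + 1) * ((1 - (t ^ k)\<^sup>2) / (1 - t\<^sup>2))"

lemma closed_form_rfl: "closed_form y t (rfl j x) = closed_form (rfl j y) t x"
  by (simp add: closed_form_def inner_rfl_left re_prod_rfl_left im_prod_rfl_left)

lemma sum_closed_form_rot:
  assumes x: "cmod x = 1" and y: "cmod y = 1" and t: "\<bar>t\<bar> < 1"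
  shows "(\<Sum>i<k. closed_form (rot (2 * int i) y) t x)
    = real k * coset_factor t * gegenbauer_integral 1 1 (re_prod x y) (im_prod x y) (t ^ k)"
proof -
  define u where "u = cnj x * y"
  have u: "cmod u = 1" "Re (u ^ k) = re_prod x y + im_prod x y"
    using x y by (simp_all add: u_def norm_mult Re_power_cnj_mult)
  define E where "E = (1 + t\<^sup>2) powr (index + 1)"
  define N where "N = poisson_denom (t ^ k) (re_prod x y + im_prod x y)"
  define I where "I = gegenbauer_integral 1 1 (re_prod x y) (im_prod x y) (t ^ k)"
  have "cmod (u ^ k) = 1" using u by (simp add: norm_power)
  then have "0 < N"
    unfolding N_def u(2)[symmetric] using abs_Re_le_cmod[of "u ^ k"]
    by (intro poisson_denom_pos abs_power_lt_1 t k_pos) simp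
  have "1 - t\<^sup>2 > 0" using t by (simp add: abs_square_less_1)
  have "x \<bullet> rot (2 * int i) y = Re (u * cis (2 * pi * real i / real k))" for i
  proof -
    have "x \<bullet> rot (2 * int i) y = Re (cnj x * rot (2 * int i) y)" by (simp add: inner_complex_def)
    then show ?thesis by (simp only: rot_def zeta_even u_def mult.assoc)
  qed
  then have "(\<Sum>i<k. closed_form (rot (2 * int i) y) t x)
      = (\<Sum>i<k. E * (N * I) / (1 - t\<^sup>2)
          * ((1 - t\<^sup>2) / poisson_denom t (Re (u * cis (2 * pi * real i / real k)))))"
    using \<open>1 - t\<^sup>2 > 0\<close>
    by (simp add: closed_form_def klein_poisson_def re_prod_rot im_prod_rot E_def N_def I_def)
  also have "\<dots> = E * (N * I) / (1 - t\<^sup>2) * (real k * (1 - (t ^ k)\<^sup>2) / N)"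
    by (simp only: sum_distrib_left[symmetric] sum_poisson_kernel[OF k_pos u(1) t] u(2) N_def)
  also have "\<dots> = real k * coset_factor t * I"
    using \<open>0 < N\<close> by (simp add: coset_factor_def E_def)
  finally show ?thesis by (simp only: I_def)
qed

lemma sum_kappa_even_odd:
  "(\<Sum>j<2 * k. kappa (int j) * h (int j)) = a * (\<Sum>i<k. h (2 * int i)) + b * (\<Sum>i<k. h (2 * int i + 1))"
  using sum_even_odd[of "\<lambda>j. kappa j * h j" k] by (simp add: kappa_def sum_distrib_left)

lemma sum_kappa_closed_form:
  assumes "cmod x = 1" "cmod y = 1" "\<bar>t\<bar> < 1"
  shows "(\<Sum>j<2 * k. kappa (int j) * closed_form y t (rfl (int j) x))
    = real k * coset_factor t * (a * gegenbauer_integral (- 1) 1 (re_prod x y) (im_prod x y) (t ^ k)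
        + b * gegenbauer_integral 1 (- 1) (re_prod x y) (im_prod x y) (t ^ k))"
proof -
  have "(\<Sum>j<2 * k. kappa (int j) * closed_form y t (rfl (int j) x))
      = a * (\<Sum>i<k. closed_form (rot (2 * int i) (rfl 0 y)) t x)
        + b * (\<Sum>i<k. closed_form (rot (2 * int i) (rfl 1 y)) t x)"
    unfolding closed_form_rfl sum_kappa_even_odd[of "\<lambda>j. closed_form (rfl j y) t x"] by (simp add: rot_rfl)
  also have "\<dots> = a * (real k * coset_factor t * gegenbauer_integral 1 1 (re_prod x y) (- im_prod x y) (t ^ k))
      + b * (real k * coset_factor t * gegenbauer_integral 1 1 (- re_prod x y) (im_prod x y) (t ^ k))"
    using assms by (simp only: sum_closed_form_rot norm_rfl) (simp add: re_prod_rfl im_prod_rfl)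
  finally show ?thesis
    by (simp add: gegenbauer_integral_flip_fst gegenbauer_integral_flip_snd algebra_simps)
qed

lemma orbit_sum_closed_form:
  assumes "cmod x = 1" "cmod y = 1" "\<bar>t\<bar> < 1"
  shows "orbit_sum (\<lambda>y. closed_form y t x) y
    = 4 * real k * coset_factor t * gegenbauer_integral 0 0 (re_prod x y) (im_prod x y) (t ^ k)"
proof -
  have "orbit_sum (\<lambda>y. closed_form y t x) y = real k * coset_factor t
      * (\<Sum>e\<in>{1, -1}. \<Sum>d\<in>{1, -1}. gegenbauer_integral e d (re_prod x y) (im_prod x y) (t ^ k))"
    unfolding orbit_sum_cosets using assms
    by (simp only: sum_closed_form_rot norm_rot norm_rfl)
      (simp add: re_prod_rot im_prod_rot re_prod_rfl im_prod_rfl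
        gegenbauer_integral_flip_fst gegenbauer_integral_flip_snd algebra_simps)
  also have "\<dots> = real k * coset_factor t
      * (4 * gegenbauer_integral 0 0 (re_prod x y) (im_prod x y) (t ^ k))"
    using assms by (simp only: sum_signs_gegenbauer_integral abs_re_prod_im_prod_le abs_power_lt_1 k_pos)
  finally show ?thesis by simp
qed

definition solves_radial_poisson :: "complex \<Rightarrow> (real \<Rightarrow> complex \<Rightarrow> real) \<Rightarrow> real \<Rightarrow> complex \<Rightarrow> bool" where
  "solves_radial_poisson y F t x \<longleftrightarrow> (\<exists>F'. ((\<lambda>t. F t x) has_real_derivative F') (at t) \<and>
     t * (poisson_denom t (x \<bullet> y) * F')
       = (1 - t\<^sup>2) * ((index + 1) * tanh_double t * (x \<bullet> y) * F t x - refl_diff (F t) x))"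

lemma solves_radial_poisson_diff:
  assumes "solves_radial_poisson y F t x" "solves_radial_poisson y G t x"
  shows "solves_radial_poisson y (\<lambda>t x. F t x - G t x) t x"
proof -
  let ?D = "poisson_denom t (x \<bullet> y)"
  from assms obtain F' G' where
    F': "((\<lambda>t. F t x) has_real_derivative F') (at t)"
    "t * (?D * F') = (1 - t\<^sup>2) * ((index + 1) * tanh_double t * (x \<bullet> y) * F t x - refl_diff (F t) x)"
    and G': "((\<lambda>t. G t x) has_real_derivative G') (at t)"
    "t * (?D * G') = (1 - t\<^sup>2) * ((index + 1) * tanh_double t * (x \<bullet> y) * G t x - refl_diff (G t) x)"
    by (auto simp: solves_radial_poisson_def)
  have "t * (?D * (F' - G')) = t * (?D * F') - t * (?D * G')"
    by (simp only: right_diff_distrib)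
  with DERIV_diff[OF F'(1) G'(1)] show ?thesis
    unfolding solves_radial_poisson_def F'(2) G'(2) refl_diff_diff
    by (intro exI[of _ "F' - G'"]) (simp add: algebra_simps)
qed

lemma radial_poisson_growth:
  assumes c: "\<bar>c\<bar> \<le> 1" and u: "0 \<le> u" "u \<le> t" "t < 1"
  shows "2 * (u - c) + 2 * ((1 - u\<^sup>2) * ((index + 1) * (2 / (1 + u\<^sup>2)) * c))
    \<le> (4 + 4 * (index + 1)) / (1 - t)\<^sup>2 * poisson_denom u c" (is "_ + 2 * ?q \<le> ?C / _ * _")
proof -
  have "?q \<le> \<bar>?q\<bar>" by (rule abs_ge_self)
  also have "\<dots> = \<bar>1 - u\<^sup>2\<bar> * ((index + 1) * (2 / (1 + u\<^sup>2)) * \<bar>c\<bar>)"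
    using index_pos by (simp add: abs_mult)
  also have "\<dots> \<le> 1 * ((index + 1) * 2 * 1)"
    using u c index_pos
    by (intro mult_mono mult_nonneg_nonneg)
      (auto simp: divide_le_eq abs_square_le_1 one_plus_square_pos not_less less_imp_le)
  finally have "2 * (u - c) + 2 * ?q \<le> ?C"
    using u c by (simp add: abs_le_iff)
  also have "?C = ?C / (1 - t)\<^sup>2 * (1 - t)\<^sup>2"
    using u by simp
  also have "\<dots> \<le> ?C / (1 - t)\<^sup>2 * poisson_denom u c"
    using u index_pos
    by (intro mult_left_mono order.trans[OF _ poisson_denom_ge[OF c]] power_mono) auto
  finally show ?thesis .
qed

lemma solves_radial_poisson_zero:
  assumes x: "cmod x = 1" and y: "cmod y = 1" and t: "0 \<le> t" "t < 1"
    and F: "\<And>s p. \<bar>s\<bar> < 1 \<Longrightarrow> cmod p = 1 \<Longrightarrow> solves_radial_poisson y F s p"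
    and F_0: "\<And>p. cmod p = 1 \<Longrightarrow> F 0 p = 0"
  shows "F t x = 0"
proof (rule radial_equation_unique[where F = F and d = t and w = "\<lambda>t p. poisson_denom t (p \<bullet> y)"
      and w' = "\<lambda>t p. 2 * (t - p \<bullet> y)" and F' = "\<lambda>t p. deriv (\<lambda>t. F t p) t" and e = "\<lambda>t. 1 - t\<^sup>2"
      and c = "\<lambda>t p. (1 - t\<^sup>2) * ((index + 1) * (2 / (1 + t\<^sup>2)) * (p \<bullet> y))"
      and C = "(4 + 4 * (index + 1)) / (1 - t)\<^sup>2"])
  fix p assume "p \<in> orbit x"
  then have p: "cmod p = 1" using x by (simp add: norm_orbit)
  note py = abs_inner_unit_le[OF p y]
  have F': "((\<lambda>t. F t p) has_real_derivative deriv (\<lambda>t. F t p) s) (at s)"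
    "s * (poisson_denom s (p \<bullet> y) * deriv (\<lambda>t. F t p) s)
      = (1 - s\<^sup>2) * ((index + 1) * tanh_double s * (p \<bullet> y) * F s p - refl_diff (F s) p)" if "\<bar>s\<bar> < 1" for s
    using F[OF that p] by (auto simp: solves_radial_poisson_def dest: DERIV_imp_deriv)
  show "continuous_on {0..t} (\<lambda>t. F t p)"
    using t by (intro DERIV_continuous_on[OF has_field_derivative_at_within[OF F'(1)]]) auto
  show "continuous_on {0..t} (\<lambda>t. poisson_denom t (p \<bullet> y))"
    unfolding poisson_denom_def by (intro continuous_intros)
  show "F 0 p = 0" by (rule F_0[OF p])
  show "0 < poisson_denom u (p \<bullet> y)" if "0 \<le> u" "u \<le> t" for u
    using that t py by (intro poisson_denom_pos) auto
  fix u assume u: "0 < u" "u < t"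
  show "((\<lambda>t. F t p) has_real_derivative deriv (\<lambda>t. F t p) u) (at u)"
    using u t by (intro F'(1)) simp
  show "((\<lambda>t. poisson_denom t (p \<bullet> y)) has_real_derivative 2 * (u - p \<bullet> y)) (at u)"
    unfolding poisson_denom_def by (auto intro!: derivative_eq_intros)
  show "u * (poisson_denom u (p \<bullet> y) * deriv (\<lambda>t. F t p) u)
      = u * ((1 - u\<^sup>2) * ((index + 1) * (2 / (1 + u\<^sup>2)) * (p \<bullet> y)) * F u p) - (1 - u\<^sup>2) * refl_diff (F u) p"
    using F'(2)[of u] u t by (simp add: tanh_double_def algebra_simps)
  show "2 * (u - p \<bullet> y) + 2 * ((1 - u\<^sup>2) * ((index + 1) * (2 / (1 + u\<^sup>2)) * (p \<bullet> y)))
      \<le> (4 + 4 * (index + 1)) / (1 - t)\<^sup>2 * poisson_denom u (p \<bullet> y)"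
    using u t by (intro radial_poisson_growth py) auto
qed (use t in \<open>auto simp: abs_square_le_1\<close>)

lemma closed_form_has_derivative:
  assumes x: "cmod x = 1" and y: "cmod y = 1" and t: "\<bar>t\<bar> < 1"
    and M': "(klein_poisson (re_prod x y) (im_prod x y) has_real_derivative M') (at (t ^ k))"
  defines "S \<equiv> closed_form y t x" and "D \<equiv> poisson_denom t (x \<bullet> y)"
  shows "((\<lambda>t. closed_form y t x) has_real_derivative ((index + 1) * tanh_double t * (S * D)
    + (1 + t\<^sup>2) powr (index + 1) * (real k * t ^ (k - 1) * M') - 2 * (t - x \<bullet> y) * S) / D) (at t)"
proof -
  define E M where "E = (1 + t\<^sup>2) powr (index + 1)" and "M = klein_poisson (re_prod x y) (im_prod x y) (t ^ k)"
  have pos: "0 < 1 + t\<^sup>2" "0 < D"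
    using t unfolding D_def by (auto intro!: poisson_denom_pos abs_inner_unit_le x y one_plus_square_pos)
  have SD: "E * M = S * D"
    using pos by (simp add: S_def closed_form_def E_def M_def D_def)
  have dE: "((\<lambda>t. (1 + t\<^sup>2) powr (index + 1)) has_real_derivative (index + 1) * tanh_double t * E) (at t)"
    by (rule DERIV_cong[OF DERIV_fun_powr[where m = "2 * t"]])
      (use pos in \<open>auto intro!: derivative_eq_intros simp: E_def powr_add tanh_double_def\<close>)
  have dM: "((\<lambda>t. klein_poisson (re_prod x y) (im_prod x y) (t ^ k)) has_real_derivative
      M' * (real k * t ^ (k - 1))) (at t)"
    using M' by (rule DERIV_chain2) (auto intro!: derivative_eq_intros)
  have dD: "((\<lambda>t. poisson_denom t (x \<bullet> y)) has_real_derivative 2 * (t - x \<bullet> y)) (at t)"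
    unfolding poisson_denom_def by (auto intro!: derivative_eq_intros)
  have "((\<lambda>t. closed_form y t x) has_real_derivative
      (((index + 1) * tanh_double t * E * M + M' * (real k * t ^ (k - 1)) * E) * D
          - E * M * (2 * (t - x \<bullet> y))) / (D * D)) (at t)"
    unfolding closed_form_def using DERIV_divide[OF DERIV_mult[OF dE dM] dD] pos
    by (simp add: E_def M_def D_def)
  also have "(((index + 1) * tanh_double t * E * M + M' * (real k * t ^ (k - 1)) * E) * D
      - E * M * (2 * (t - x \<bullet> y))) / (D * D)
      = ((index + 1) * tanh_double t * (S * D) + E * (real k * t ^ (k - 1) * M') - 2 * (t - x \<bullet> y) * S) / D"
    using pos unfolding mult.assoc[of _ E M] SD by (simp add: field_simps)
  finally show ?thesis by (simp only: E_def)
qed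

lemma closed_form_solves_radial_poisson:
  assumes x: "cmod x = 1" and y: "cmod y = 1" and t: "\<bar>t\<bar> < 1"
  shows "solves_radial_poisson y (closed_form y) t x"
proof -
  define p s c where "p = re_prod x y" and "s = im_prod x y" and "c = x \<bullet> y"
  define E D S where "E = (1 + t\<^sup>2) powr (index + 1)" and "D = poisson_denom t c" and "S = closed_form y t x"
  define R where "R = t ^ k"
  define J where "J = a * gegenbauer_integral (- 1) 1 p s R + b * gegenbauer_integral 1 (- 1) p s R"
  obtain M' where M': "(klein_poisson p s has_real_derivative M') (at R)"
    "R * M' = (1 - R\<^sup>2) * J - lam * klein_poisson p s R"
    using klein_poisson_radial[OF abs_re_prod_im_prod_le[OF x y] abs_power_lt_1[OF t k_pos]]
    unfolding p_def s_def J_def R_def by blast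
  define m where "m = E * (real k * t ^ (k - 1) * M')"
  define S' where "S' = ((index + 1) * tanh_double t * (S * D) + m - 2 * (t - c) * S) / D"
  have deriv: "((\<lambda>t. closed_form y t x) has_real_derivative S') (at t)"
    using closed_form_has_derivative[OF x y t] M'(1) unfolding p_def s_def R_def
    by (simp only: S'_def m_def E_def D_def S_def c_def)
  have pos: "0 < 1 + t\<^sup>2" "0 < 1 - t\<^sup>2" "0 < D"
    using t by (auto simp: one_plus_square_pos abs_square_less_1 D_def c_def
        intro!: poisson_denom_pos abs_inner_unit_le x y)
  have "t * t ^ (k - 1) = R" unfolding R_def using k_pos by (metis power_eq_if mult.commute not_gr0)
  then have "t * m = real k * E * (R * M')" by (simp add: m_def mult_ac)
  also have "\<dots> = (1 - t\<^sup>2) * (real k * coset_factor t * J) - index * (S * D)"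
  proof -
    have "(1 - t\<^sup>2) * coset_factor t = E * (1 - R\<^sup>2)" "S * D = E * klein_poisson p s R"
      using pos by (simp_all add: coset_factor_def closed_form_def E_def R_def S_def D_def p_def s_def c_def)
    then show ?thesis unfolding M'(2) by algebra
  qed
  also have "real k * coset_factor t * J = index * S - refl_diff (closed_form y t) x"
    using sum_kappa_closed_form[OF x y t] by (simp add: refl_diff_eq J_def R_def p_def s_def S_def)
  finally have "t * m = (1 - t\<^sup>2) * (index * S - refl_diff (closed_form y t) x) - index * (S * D)" .
  moreover have "D * S' = (index + 1) * tanh_double t * (S * D) + m - 2 * (t - c) * S"
    using pos by (simp add: S'_def)
  moreover have "(1 + t\<^sup>2) * tanh_double t = 2 * t" using pos by (simp add: tanh_double_def)
  ultimately have "t * (D * S') = (1 - t\<^sup>2) * ((index + 1) * tanh_double t * c * S - refl_diff (closed_form y t) x)"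
    unfolding D_def poisson_denom_def by algebra
  with deriv show ?thesis unfolding solves_radial_poisson_def D_def S_def c_def by blast
qed

lemma closed_form_at_0: "closed_form y 0 x = 1"
  by (simp add: closed_form_def klein_poisson_def gegenbauer_integral_at_0 poisson_denom_def zero_power)

end

section \<open>The generating function as a power series\<close>

lemma pochhammer_binomial_sums:
  fixes z q :: real
  assumes "\<bar>z\<bar> < 1"
  shows "(\<lambda>n. pochhammer q n / fact n * z ^ n) sums (1 - z) powr (- q)"
proof -
  have "((- q) gchoose n) * (- z) ^ n = pochhammer q n / fact n * z ^ n" for n
    by (cases "even n") (simp_all add: gbinomial_pochhammer)
  then show ?thesis using gen_binomial_real[of "- z" "- q"] assms by simp
qed

lemma powser_Euler_derivative:
  fixes c :: "nat \<Rightarrow> real"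
  assumes summable: "\<And>r. \<bar>r\<bar> < R \<Longrightarrow> summable (\<lambda>n. c n * r ^ n)" and r: "\<bar>r\<bar> < R"
  obtains S' where "((\<lambda>r. \<Sum>n. c n * r ^ n) has_real_derivative S') (at r)"
    "(\<lambda>n. real n * c n * r ^ n) sums (r * S')"
proof -
  define K where "K = (\<bar>r\<bar> + R) / 2"
  have K: "\<bar>r\<bar> < K" "\<bar>K\<bar> < R" using r by (auto simp: K_def)
  have "(\<lambda>n. diffs c n * r ^ n) sums (\<Sum>n. diffs c n * r ^ n)"
    using K by (intro summable_sums termdiff_converges[where K = K] summable) auto
  from sums_mult[OF this, of r]
  have "(\<lambda>n. real (Suc n) * c (Suc n) * r ^ Suc n) sums (r * (\<Sum>n. diffs c n * r ^ n))"
    by (simp add: diffs_def mult_ac)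
  then have "(\<lambda>n. real n * c n * r ^ n) sums (r * (\<Sum>n. diffs c n * r ^ n))"
    by (subst (asm) sums_Suc_iff) simp
  moreover have "((\<lambda>r. \<Sum>n. c n * r ^ n) has_real_derivative (\<Sum>n. diffs c n * r ^ n)) (at r)"
    using K by (intro termdiffs_strong[OF summable[of K]]) auto
  ultimately show thesis by (rule that[rotated])
qed

context dihedral
begin

definition genfun_coeff :: "complex \<Rightarrow> nat \<Rightarrow> complex \<Rightarrow> real" where
  "genfun_coeff y n x = pochhammer (index + 1) n * kernel_comp y n x"

definition genfun :: "complex \<Rightarrow> real \<Rightarrow> complex \<Rightarrow> real" where
  "genfun y r x = (\<Sum>n. genfun_coeff y n x * r ^ n)"

lemma genfun_sums:
  assumes x: "cmod x = 1" and y: "cmod y = 1" and r: "\<bar>r\<bar> < 1"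
  shows "(\<lambda>n. genfun_coeff y n x * r ^ n) sums genfun y r x"
proof -
  have "summable (\<lambda>n. pochhammer (index + 1) n / fact n * \<bar>r\<bar> ^ n)"
    using pochhammer_binomial_sums[of "\<bar>r\<bar>" "index + 1"] r by (auto simp: sums_iff)
  then have "summable (\<lambda>n. genfun_coeff y n x * r ^ n)"
  proof (rule summable_comparison_test[rotated], intro exI allI impI)
    fix n
    have "0 \<le> pochhammer (index + 1) n" using index_pos by (simp add: pochhammer_nonneg)
    moreover have "\<bar>kernel_comp y n x\<bar> \<le> 1 / fact n" using kernel_comp_bound[of y n x] x y by simp
    ultimately have "pochhammer (index + 1) n * \<bar>kernel_comp y n x\<bar> \<le> pochhammer (index + 1) n * (1 / fact n)"
      by (rule mult_left_mono[rotated])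
    then have "\<bar>genfun_coeff y n x\<bar> \<le> pochhammer (index + 1) n / fact n"
      using \<open>0 \<le> pochhammer (index + 1) n\<close> by (simp add: genfun_coeff_def abs_mult)
    then show "norm (genfun_coeff y n x * r ^ n) \<le> pochhammer (index + 1) n / fact n * \<bar>r\<bar> ^ n"
      unfolding real_norm_def abs_mult power_abs by (rule mult_right_mono) simp
  qed
  then show ?thesis unfolding genfun_def by (rule summable_sums)
qed

lemma genfun_coeff_radial:
  "real (Suc n) * genfun_coeff y (Suc n) x + refl_diff (genfun_coeff y (Suc n)) x
    = (index + 1 + real n) * (x \<bullet> y) * genfun_coeff y n x"
proof -
  have "real (Suc n) * genfun_coeff y (Suc n) x + refl_diff (genfun_coeff y (Suc n)) x
      = pochhammer (index + 1) (Suc n) * (real (Suc n) * kernel_comp y (Suc n) x + refl_diff (kernel_comp y (Suc n)) x)"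
    unfolding genfun_coeff_def[abs_def] refl_diff_cmult by (simp only: algebra_simps)
  also have "\<dots> = (index + 1 + real n) * (x \<bullet> y) * genfun_coeff y n x"
    unfolding kernel_comp_radial genfun_coeff_def by (simp only: pochhammer_Suc mult_ac)
  finally show ?thesis .
qed

lemma refl_diff_genfun_sums:
  assumes "cmod x = 1" "cmod y = 1" "\<bar>r\<bar> < 1"
  shows "(\<lambda>n. refl_diff (genfun_coeff y n) x * r ^ n) sums refl_diff (genfun y r) x"
proof -
  have "(\<lambda>n. \<Sum>j<2 * k. kappa (int j) * (genfun_coeff y n x * r ^ n - genfun_coeff y n (rfl (int j) x) * r ^ n))
      sums refl_diff (genfun y r) x"
    unfolding refl_diff_def using assms by (intro sums_sum sums_mult sums_diff genfun_sums) auto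
  then show ?thesis by (simp only: refl_diff_def sum_distrib_right left_diff_distrib mult.assoc)
qed

lemma genfun_radial:
  assumes x: "cmod x = 1" and y: "cmod y = 1" and r: "\<bar>r\<bar> < 1"
  obtains S' where "((\<lambda>r. genfun y r x) has_real_derivative S') (at r)"
    "r * (1 - r * (x \<bullet> y)) * S' = (index + 1) * r * (x \<bullet> y) * genfun y r x - refl_diff (genfun y r) x"
proof -
  obtain S' where S': "((\<lambda>r. genfun y r x) has_real_derivative S') (at r)"
    and Euler: "(\<lambda>n. real n * genfun_coeff y n x * r ^ n) sums (r * S')"
    unfolding genfun_def
    by (rule powser_Euler_derivative[where R = 1 and r = r and c = "\<lambda>n. genfun_coeff y n x"])
      (use genfun_sums[OF x y] r in \<open>auto intro: sums_summable\<close>)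
  have "(\<lambda>n. real n * genfun_coeff y n x * r ^ n + refl_diff (genfun_coeff y n) x * r ^ n)
      sums (r * S' + refl_diff (genfun y r) x)"
    by (intro sums_add Euler refl_diff_genfun_sums x y r)
  then have "(\<lambda>n. real (Suc n) * genfun_coeff y (Suc n) x * r ^ Suc n
      + refl_diff (genfun_coeff y (Suc n)) x * r ^ Suc n) sums (r * S' + refl_diff (genfun y r) x)"
    by (subst sums_Suc_iff) (simp add: genfun_coeff_def[abs_def] refl_diff_const)
  also have "(\<lambda>n. real (Suc n) * genfun_coeff y (Suc n) x * r ^ Suc n
      + refl_diff (genfun_coeff y (Suc n)) x * r ^ Suc n)
    = (\<lambda>n. r * (x \<bullet> y) * ((index + 1) * (genfun_coeff y n x * r ^ n) + real n * genfun_coeff y n x * r ^ n))"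
    unfolding distrib_right[symmetric] genfun_coeff_radial by (simp add: algebra_simps)
  finally have "(\<lambda>n. r * (x \<bullet> y) * ((index + 1) * (genfun_coeff y n x * r ^ n)
      + real n * genfun_coeff y n x * r ^ n))
      sums (r * S' + refl_diff (genfun y r) x)" .
  moreover have "(\<lambda>n. r * (x \<bullet> y) * ((index + 1) * (genfun_coeff y n x * r ^ n)
      + real n * genfun_coeff y n x * r ^ n))
      sums (r * (x \<bullet> y) * ((index + 1) * genfun y r x + r * S'))"
    by (intro sums_mult sums_add Euler genfun_sums x y r)
  ultimately have "r * S' + refl_diff (genfun y r) x = r * (x \<bullet> y) * ((index + 1) * genfun y r x + r * S')"
    by (rule sums_unique2)
  then show thesis using that[OF S'] by (simp add: algebra_simps)
qed

lemma genfun_solves_radial_poisson: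
  assumes x: "cmod x = 1" and y: "cmod y = 1" and t: "\<bar>t\<bar> < 1"
  shows "solves_radial_poisson y (\<lambda>t. genfun y (tanh_double t)) t x"
proof -
  let ?r = "tanh_double t" and ?r' = "2 * (1 - t\<^sup>2) / (1 + t\<^sup>2)\<^sup>2"
  obtain S' where S': "((\<lambda>r. genfun y r x) has_real_derivative S') (at ?r)"
    and eq: "?r * (1 - ?r * (x \<bullet> y)) * S' = (index + 1) * ?r * (x \<bullet> y) * genfun y ?r x - refl_diff (genfun y ?r) x"
    using genfun_radial[OF x y abs_tanh_double_lt_1[OF t]] .
  have "t * ?r' = (1 - t\<^sup>2) * ?r / (1 + t\<^sup>2)"
    by (simp add: tanh_double_def power2_eq_square)
  moreover have "t * (poisson_denom t (x \<bullet> y) * (S' * ?r')) = t * ?r' * (poisson_denom t (x \<bullet> y) * S')"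
    by (simp only: mult_ac)
  ultimately have "t * (poisson_denom t (x \<bullet> y) * (S' * ?r')) = (1 - t\<^sup>2) * (?r * (1 - ?r * (x \<bullet> y)) * S')"
    unfolding one_minus_tanh_double_mult by simp
  with DERIV_chain2[OF S' DERIV_tanh_double] show ?thesis
    unfolding eq solves_radial_poisson_def by blast
qed

lemma genfun_at_0: "cmod x = 1 \<Longrightarrow> cmod y = 1 \<Longrightarrow> genfun y 0 x = 1"
  using sums_unique2[OF genfun_sums[of x y 0] powser_sums_zero[of "\<lambda>n. genfun_coeff y n x"]]
  by (simp add: genfun_coeff_def)

lemma genfun_eq_closed_form:
  assumes x: "cmod x = 1" and y: "cmod y = 1" and t: "0 \<le> t" "t < 1"
  shows "genfun y (tanh_double t) x = closed_form y t x"
proof -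
  let ?F = "\<lambda>t x. genfun y (tanh_double t) x - closed_form y t x"
  have "?F t x = 0"
  proof (rule solves_radial_poisson_zero[where F = ?F, OF x y t])
    show "solves_radial_poisson y ?F s p" if "\<bar>s\<bar> < 1" "cmod p = 1" for s p
      using that y
      by (intro solves_radial_poisson_diff genfun_solves_radial_poisson closed_form_solves_radial_poisson)
    show "?F 0 p = 0" if "cmod p = 1" for p
      using genfun_at_0[OF that y] by (simp add: tanh_double_def closed_form_at_0)
  qed
  then show ?thesis by simp
qed

end

section \<open>Dirichlet distributions on the simplex\<close>

lemma emeasure_lborel_vimage_scale:
  fixes A :: "real set"
  assumes "0 < r" "A \<in> sets borel"
  shows "ennreal r * emeasure lborel ((*) r -` A) = emeasure lborel A"
proof -
  have [measurable]: "A \<in> sets borel" by fact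
  have "emeasure lborel A = ennreal \<bar>r\<bar> * (\<integral>\<^sup>+x. indicator A (0 + r * x) \<partial>lborel)"
    using assms by (subst nn_integral_indicator[symmetric], simp, intro nn_integral_real_affine) auto
  also have "(\<integral>\<^sup>+x. indicator A (0 + r * x) \<partial>lborel) = (\<integral>\<^sup>+x. indicator ((*) r -` A) x \<partial>lborel)"
    by (simp add: indicator_def)
  also have "\<dots> = emeasure lborel ((*) r -` A)"
    using measurable_sets_borel[of "(*) r" borel A] by (intro nn_integral_indicator) (simp add: assms)
  finally show ?thesis using assms by simp
qed

lemma PiM_lborel_scale:
  fixes I :: "'i set" and r :: real
  assumes I: "finite I" and r: "0 < r"
  shows "density (distr (PiM I (\<lambda>_. lborel)) (PiM I (\<lambda>_. lborel)) (\<lambda>x. \<lambda>i\<in>I. r * x i))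
      (\<lambda>_. ennreal (r ^ card I))
    = PiM I (\<lambda>_. lborel)" (is "density ?D _ = ?P")
proof -
  interpret product_sigma_finite "\<lambda>_. lborel :: real measure" by standard
  show ?thesis
  proof (rule PiM_eqI[OF I])
    fix A :: "'i \<Rightarrow> real set"
    assume A: "\<And>i. i \<in> I \<Longrightarrow> A i \<in> sets lborel"
    then have meas: "Pi\<^sub>E I A \<in> sets ?P" by (intro sets_PiM_I_finite I)
    have "emeasure ?D (Pi\<^sub>E I A) = emeasure ?P (Pi\<^sub>E I (\<lambda>i. (*) r -` A i))"
      by (subst emeasure_distr[OF _ meas])
        (auto simp: space_PiM PiE_def Pi_def extensional_def intro!: arg_cong[where f = "emeasure ?P"])
    also have "\<dots> = (\<Prod>i\<in>I. emeasure lborel ((*) r -` A i))"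
    proof (rule emeasure_PiM[OF I])
      show "(*) r -` A i \<in> sets lborel" if "i \<in> I" for i
        using measurable_sets_borel[of "(*) r" borel "A i"] A[OF that] by simp
    qed
    finally have "emeasure (density ?D (\<lambda>_. ennreal (r ^ card I))) (Pi\<^sub>E I A)
        = (\<Prod>i\<in>I. ennreal r * emeasure lborel ((*) r -` A i))"
      using meas r by (simp add: emeasure_density_const prod.distrib ennreal_power)
    also have "\<dots> = (\<Prod>i\<in>I. emeasure lborel (A i))"
      using A r by (intro prod.cong refl emeasure_lborel_vimage_scale) auto
    finally show "emeasure (density ?D (\<lambda>_. ennreal (r ^ card I))) (Pi\<^sub>E I A) = (\<Prod>i\<in>I. emeasure lborel (A i))" .
  qed simp
qed

lemma nn_integral_PiM_scale:
  assumes I: "finite I" and r: "(0::real) < r" and [measurable]: "f \<in> borel_measurable (PiM I (\<lambda>_. lborel))"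
  shows "(\<integral>\<^sup>+x. f x \<partial>PiM I (\<lambda>_. lborel)) = ennreal (r ^ card I) * (\<integral>\<^sup>+x. f (\<lambda>i\<in>I. r * x i) \<partial>PiM I (\<lambda>_. lborel))"
  by (subst PiM_lborel_scale[OF I r, symmetric])
    (simp add: nn_integral_density nn_integral_distr nn_integral_cmult)

definition gamma_weight :: "real \<Rightarrow> real \<Rightarrow> real \<Rightarrow> real" where
  "gamma_weight \<alpha> c y = indicator {0<..} y * (y powr (\<alpha> - 1) * exp (- (c * y)))"

lemma gamma_weight_measurable [measurable (raw)]:
  assumes [measurable]: "f \<in> borel_measurable M" "g \<in> borel_measurable M"
  shows "(\<lambda>x. gamma_weight \<alpha> (f x) (g x)) \<in> borel_measurable M"
  unfolding gamma_weight_def by measurable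

lemma gamma_weight_nonneg: "0 \<le> gamma_weight \<alpha> c y"
  by (simp add: gamma_weight_def)

lemma nn_integral_gamma_weight:
  assumes \<alpha>_pos: "\<alpha> > 0" and c: "c > 0"
  shows "(\<integral>\<^sup>+y. ennreal (gamma_weight \<alpha> c y) \<partial>lborel) = ennreal (Gamma \<alpha> * c powr (- \<alpha>))"
proof -
  have "(\<integral>\<^sup>+y. ennreal (gamma_weight \<alpha> c y) \<partial>lborel)
      = ennreal (1 / c) * (\<integral>\<^sup>+y. ennreal (gamma_weight \<alpha> c (y / c)) \<partial>lborel)"
    using c by (subst nn_integral_real_affine[where c = "1 / c" and t = 0]) (auto simp: abs_divide)
  also have "(\<integral>\<^sup>+y. ennreal (gamma_weight \<alpha> c (y / c)) \<partial>lborel)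
      = (\<integral>\<^sup>+y. ennreal (c powr (1 - \<alpha>)) * ennreal (indicator {0..} y * (y powr (\<alpha> - 1) / exp y)) \<partial>lborel)"
    using c unfolding gamma_weight_def
    by (intro nn_integral_cong)
      (auto simp: indicator_def powr_divide powr_diff exp_minus field_simps zero_less_divide_iff ennreal_mult'[symmetric])
  also have "\<dots> = ennreal (c powr (1 - \<alpha>)) * ennreal (Gamma \<alpha>)"
    using nn_integral_has_integral_lebesgue[OF _ Gamma_integral_real[OF \<alpha>_pos]]
    by (subst nn_integral_cmult) (auto simp: mult_ac)
  also have "ennreal (1 / c) * (ennreal (c powr (1 - \<alpha>)) * ennreal (Gamma \<alpha>))
      = ennreal (Gamma \<alpha> * c powr (- \<alpha>))"
    using c \<alpha>_pos by (simp add: ennreal_mult[symmetric] powr_diff powr_minus field_simps)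
  finally show ?thesis .
qed

lemma sum_atMost_head: "(\<Sum>j\<le>n. g j) = g 0 + (\<Sum>j=1..n. g j)" for g :: "nat \<Rightarrow> 'a::comm_monoid_add"
  by (simp add: sum.atLeast1_atMost_eq sum.atMost_shift)

lemma prod_atMost_head: "(\<Prod>j\<le>n. g j) = g 0 * (\<Prod>j=1..n. g j)" for g :: "nat \<Rightarrow> 'a::comm_monoid_mult"
  by (simp add: prod.atLeast1_atMost_eq prod.atMost_shift)

lemma simplex_ext_measurable [measurable (raw)]:
  assumes "j \<le> n"
  shows "(\<lambda>t. simplex_ext n t j) \<in> borel_measurable (PiM {1..n} (\<lambda>_. lborel))"
proof (cases "j = 0")
  case False
  then have "j \<in> {1..n}" using assms by auto
  then show ?thesis using False by (simp add: simplex_ext_def)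
qed (simp add: simplex_ext_def)

lemma unit_simplex_measurable [measurable]: "unit_simplex n \<in> sets (PiM {1..n} (\<lambda>_. lborel))"
proof -
  have "unit_simplex n = {t \<in> space (PiM {1..n} (\<lambda>_. lborel :: real measure)).
      (\<forall>j\<in>{1..n}. 0 < t j) \<and> (\<Sum>j=1..n. t j) < 1}"
    by (auto simp: unit_simplex_def space_PiM)
  then show ?thesis by simp
qed

lemma sum_simplex_ext: "(\<Sum>j\<le>n. simplex_ext n t j) = 1"
  by (simp add: sum_atMost_head simplex_ext_def)

lemma simplex_ext_pos: "t \<in> unit_simplex n \<Longrightarrow> j \<le> n \<Longrightarrow> 0 < simplex_ext n t j"
  by (auto simp: unit_simplex_def simplex_ext_def)

lemma sum_mult_simplex_ext_pos:
  assumes "t \<in> unit_simplex n" "\<And>j. j \<le> n \<Longrightarrow> 0 < c j"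
  shows "0 < (\<Sum>j\<le>n. c j * simplex_ext n t j)"
  using assms by (intro sum_pos mult_pos_pos simplex_ext_pos) auto

text \<open>Polar coordinates $x = r t$ on the orthant, where $r$ is the sum of the coordinates.\<close>

lemma prod_polar_eq:
  fixes f :: "nat \<Rightarrow> real \<Rightarrow> ennreal"
  assumes f0: "\<And>j y. y \<le> 0 \<Longrightarrow> f j y = 0" and r: "0 < r"
    and t: "t \<in> space (PiM {1..n} (\<lambda>_. lborel :: real measure))"
  shows "(\<Prod>j=1..n. f j (r * t j)) * f 0 (r - (\<Sum>j=1..n. r * t j))
    = indicator (unit_simplex n) t * (\<Prod>j\<le>n. f j (r * simplex_ext n t j))"
proof (cases "t \<in> unit_simplex n")
  case True
  have "(\<Prod>j=1..n. f j (r * t j)) = (\<Prod>j=1..n. f j (r * simplex_ext n t j))"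
    by (intro prod.cong) (auto simp: simplex_ext_def)
  moreover have "r - (\<Sum>j=1..n. r * t j) = r * simplex_ext n t 0"
    by (simp add: simplex_ext_def algebra_simps sum_distrib_left)
  ultimately show ?thesis using True by (simp add: prod_atMost_head mult.commute)
next
  case False
  then consider j where "j \<in> {1..n}" "t j \<le> 0" | "1 \<le> (\<Sum>j=1..n. t j)"
    using t by (force simp: unit_simplex_def space_PiM not_less)
  then have "(\<Prod>j=1..n. f j (r * t j)) * f 0 (r - (\<Sum>j=1..n. r * t j)) = 0"
  proof cases
    case 1
    then have "f j (r * t j) = 0" using r by (intro f0) (simp add: mult_nonneg_nonpos)
    then show ?thesis using 1(1) by (auto intro!: prod_zero)
  next
    case 2
    then have "r * 1 \<le> r * (\<Sum>j=1..n. t j)" using r by (intro mult_left_mono) auto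
    then show ?thesis by (simp add: sum_distrib_left f0)
  qed
  then show ?thesis using False by simp
qed

lemma prod_polar_eq_0:
  fixes f :: "nat \<Rightarrow> real \<Rightarrow> ennreal"
  assumes f0: "\<And>j y. y \<le> 0 \<Longrightarrow> f j y = 0" and r: "r \<le> 0"
  shows "(\<Prod>j=1..n. f j (x j)) * f 0 (r - (\<Sum>j=1..n. x j)) = 0"
proof (cases "\<forall>j\<in>{1..n}. 0 < x j")
  case True
  then have "0 \<le> (\<Sum>j=1..n. x j)" by (intro sum_nonneg) (auto intro: less_imp_le)
  then show ?thesis using r by (simp add: f0)
next
  case False
  then obtain j where "j \<in> {1..n}" "x j \<le> 0" by (auto simp: not_less)
  then have "(\<Prod>j=1..n. f j (x j)) = 0" by (intro prod_zero) (auto intro: f0)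
  then show ?thesis by simp
qed

lemma nn_integral_orthant_polar:
  fixes f :: "nat \<Rightarrow> real \<Rightarrow> ennreal"
  assumes f [measurable]: "\<And>j. f j \<in> borel_measurable borel" and f0: "\<And>j y. y \<le> 0 \<Longrightarrow> f j y = 0"
  shows "(\<Prod>j\<le>n. \<integral>\<^sup>+y. f j y \<partial>lborel)
    = (\<integral>\<^sup>+r. indicator {0<..} r * (ennreal (r ^ n) *
        (\<integral>\<^sup>+t. indicator (unit_simplex n) t * (\<Prod>j\<le>n. f j (r * simplex_ext n t j))
            \<partial>PiM {1..n} (\<lambda>_. lborel))) \<partial>lborel)"
proof -
  interpret product_sigma_finite "\<lambda>_. lborel :: real measure" by standard
  let ?X = "PiM {1..n} (\<lambda>_. lborel :: real measure)"
  interpret X: sigma_finite_measure ?X by (rule sigma_finite) simp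
  interpret XL: pair_sigma_finite ?X "lborel :: real measure" by standard
  let ?F = "\<lambda>x r. (\<Prod>j=1..n. f j (x j)) * f 0 (r - (\<Sum>j=1..n. x j))"
  have "(\<Prod>j\<le>n. \<integral>\<^sup>+y. f j y \<partial>lborel) = (\<integral>\<^sup>+x. (\<Prod>j=1..n. f j (x j)) \<partial>?X) * (\<integral>\<^sup>+y. f 0 y \<partial>lborel)"
    by (subst product_nn_integral_prod) (simp_all add: prod_atMost_head mult.commute)
  also have "\<dots> = (\<integral>\<^sup>+x. (\<Prod>j=1..n. f j (x j)) * (\<integral>\<^sup>+r. f 0 (r - (\<Sum>j=1..n. x j)) \<partial>lborel) \<partial>?X)"
    using nn_integral_real_affine[OF f[of 0], of 1 "- (\<Sum>j=1..n. x j)" for x]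
    by (simp add: nn_integral_multc)
  also have "\<dots> = (\<integral>\<^sup>+x. \<integral>\<^sup>+r. ?F x r \<partial>lborel \<partial>?X)"
    by (simp add: nn_integral_cmult)
  also have "\<dots> = (\<integral>\<^sup>+r. \<integral>\<^sup>+x. ?F x r \<partial>?X \<partial>lborel)"
    by (rule XL.Fubini'[symmetric]) measurable
  also have "\<dots> = (\<integral>\<^sup>+r. indicator {0<..} r * (ennreal (r ^ n) *
      (\<integral>\<^sup>+t. indicator (unit_simplex n) t * (\<Prod>j\<le>n. f j (r * simplex_ext n t j)) \<partial>?X)) \<partial>lborel)"
  proof (rule nn_integral_cong)
    fix r :: real
    show "(\<integral>\<^sup>+x. ?F x r \<partial>?X) = indicator {0<..} r * (ennreal (r ^ n) *
        (\<integral>\<^sup>+t. indicator (unit_simplex n) t * (\<Prod>j\<le>n. f j (r * simplex_ext n t j)) \<partial>?X))"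
    proof (cases "0 < r")
      case True
      then have "(\<integral>\<^sup>+x. ?F x r \<partial>?X)
          = ennreal (r ^ card {1..n}) * (\<integral>\<^sup>+t. ?F (\<lambda>i\<in>{1..n}. r * t i) r \<partial>?X)"
        by (intro nn_integral_PiM_scale) (simp_all, measurable)
      also have "(\<integral>\<^sup>+t. ?F (\<lambda>i\<in>{1..n}. r * t i) r \<partial>?X)
          = (\<integral>\<^sup>+t. indicator (unit_simplex n) t * (\<Prod>j\<le>n. f j (r * simplex_ext n t j)) \<partial>?X)"
        using prod_polar_eq[of f, OF f0 True] by (intro nn_integral_cong) simp
      finally show ?thesis using True by simp
    next
      case False
      then have "(\<integral>\<^sup>+x. ?F x r \<partial>?X) = (\<integral>\<^sup>+x. 0 \<partial>?X)"
        by (intro nn_integral_cong prod_polar_eq_0 f0) auto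
      then show ?thesis using False by simp
    qed
  qed
  finally show ?thesis .
qed

definition simplex_weight :: "nat \<Rightarrow> (nat \<Rightarrow> real) \<Rightarrow> (nat \<Rightarrow> real) \<Rightarrow> real" where
  "simplex_weight n \<alpha> t = indicator (unit_simplex n) t * (\<Prod>j\<le>n. simplex_ext n t j powr (\<alpha> j - 1))"

definition dirichlet_density :: "nat \<Rightarrow> (nat \<Rightarrow> real) \<Rightarrow> (nat \<Rightarrow> real) \<Rightarrow> real" where
  "dirichlet_density n \<alpha> t = Gamma (\<Sum>j\<le>n. \<alpha> j) / (\<Prod>j\<le>n. Gamma (\<alpha> j)) * simplex_weight n \<alpha> t"

definition dirichlet :: "nat \<Rightarrow> (nat \<Rightarrow> real) \<Rightarrow> (nat \<Rightarrow> real) measure" where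
  "dirichlet n \<alpha> = density (PiM {1..n} (\<lambda>_. lborel)) (\<lambda>t. ennreal (dirichlet_density n \<alpha> t))"

lemma simplex_weight_measurable [measurable]:
  "simplex_weight n \<alpha> \<in> borel_measurable (PiM {1..n} (\<lambda>_. lborel))"
  unfolding simplex_weight_def[abs_def] by measurable

lemma simplex_weight_nonneg: "0 \<le> simplex_weight n \<alpha> t"
  by (simp add: simplex_weight_def prod_nonneg)

lemma dirichlet_density_measurable [measurable]:
  "dirichlet_density n \<alpha> \<in> borel_measurable (PiM {1..n} (\<lambda>_. lborel))"
  unfolding dirichlet_density_def[abs_def] by measurable

lemma sum_atMost_pos: "0 < (\<Sum>j\<le>n. \<alpha> j)" if "\<And>j. j \<le> n \<Longrightarrow> 0 < \<alpha> j" for \<alpha> :: "nat \<Rightarrow> real"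
  using that by (intro sum_pos) auto

lemma dirichlet_density_nonneg:
  assumes "\<And>j. j \<le> n \<Longrightarrow> 0 < \<alpha> j"
  shows "0 \<le> dirichlet_density n \<alpha> t"
  using assms sum_atMost_pos[of n \<alpha>] unfolding dirichlet_density_def
  by (intro mult_nonneg_nonneg divide_nonneg_nonneg prod_nonneg simplex_weight_nonneg) (auto intro: less_imp_le)

lemma sets_dirichlet [measurable_cong, simp]: "sets (dirichlet n \<alpha>) = sets (PiM {1..n} (\<lambda>_. lborel))"
  by (simp add: dirichlet_def)

lemma AE_dirichlet: "AE t in dirichlet n \<alpha>. t \<in> unit_simplex n"
  unfolding dirichlet_def
proof (subst AE_density)
  show "AE t in PiM {1..n} (\<lambda>_. lborel). 0 < ennreal (dirichlet_density n \<alpha> t) \<longrightarrow> t \<in> unit_simplex n"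
    by (auto simp: dirichlet_density_def simplex_weight_def indicator_def)
qed measurable

lemma prod_gamma_weight_polar:
  assumes t: "t \<in> unit_simplex n" and r: "0 < r"
  shows "r ^ n * (\<Prod>j\<le>n. gamma_weight (\<alpha> j) (c j) (r * simplex_ext n t j))
    = simplex_weight n \<alpha> t * gamma_weight (\<Sum>j\<le>n. \<alpha> j) (\<Sum>j\<le>n. c j * simplex_ext n t j) r"
proof -
  have "(\<Prod>j\<le>n. gamma_weight (\<alpha> j) (c j) (r * simplex_ext n t j))
      = (\<Prod>j\<le>n. r powr (\<alpha> j - 1)) * (\<Prod>j\<le>n. simplex_ext n t j powr (\<alpha> j - 1))
        * (\<Prod>j\<le>n. exp (- (c j * simplex_ext n t j * r)))"
    unfolding prod.distrib[symmetric] using r simplex_ext_pos[OF t]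
    by (intro prod.cong) (auto simp: gamma_weight_def powr_mult mult_ac)
  also have "(\<Prod>j\<le>n. exp (- (c j * simplex_ext n t j * r))) = exp (- ((\<Sum>j\<le>n. c j * simplex_ext n t j) * r))"
    by (simp add: exp_sum[symmetric] sum_negf sum_distrib_right)
  also have "(\<Prod>j\<le>n. r powr (\<alpha> j - 1)) = r powr ((\<Sum>j\<le>n. \<alpha> j) - 1 - real n)"
    using r by (simp add: powr_sum[symmetric] sum_subtractf algebra_simps)
  finally have "r ^ n * (\<Prod>j\<le>n. gamma_weight (\<alpha> j) (c j) (r * simplex_ext n t j))
      = (r ^ n * r powr ((\<Sum>j\<le>n. \<alpha> j) - 1 - real n)) * ((\<Prod>j\<le>n. simplex_ext n t j powr (\<alpha> j - 1))
        * exp (- ((\<Sum>j\<le>n. c j * simplex_ext n t j) * r)))"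
    by (simp only: mult_ac)
  also have "r ^ n * r powr ((\<Sum>j\<le>n. \<alpha> j) - 1 - real n) = r powr ((\<Sum>j\<le>n. \<alpha> j) - 1)"
    using r by (simp add: powr_realpow[symmetric] powr_add[symmetric])
  finally show ?thesis using t r by (simp add: gamma_weight_def simplex_weight_def mult_ac)
qed

lemma prod_nn_integral_gamma_weight:
  "(\<Prod>j\<le>n. \<integral>\<^sup>+y. ennreal (gamma_weight (\<alpha> j) (c j) y) \<partial>lborel)
    = (\<integral>\<^sup>+t. \<integral>\<^sup>+r. ennreal (simplex_weight n \<alpha> t)
        * ennreal (gamma_weight (\<Sum>j\<le>n. \<alpha> j) (\<Sum>j\<le>n. c j * simplex_ext n t j) r) \<partial>lborel
            \<partial>PiM {1..n} (\<lambda>_. lborel))"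
proof -
  interpret product_sigma_finite "\<lambda>_. lborel :: real measure" by standard
  let ?X = "PiM {1..n} (\<lambda>_. lborel :: real measure)"
  interpret X: sigma_finite_measure ?X by (rule sigma_finite) simp
  interpret XL: pair_sigma_finite ?X "lborel :: real measure" by standard
  note One_nat_def [simp del]
  define A where "A = (\<Sum>j\<le>n. \<alpha> j)"
  define S where "S t = (\<Sum>j\<le>n. c j * simplex_ext n t j)" for t
  have [measurable]: "S \<in> borel_measurable ?X" unfolding S_def[abs_def] by measurable
  define f where "f j y = ennreal (gamma_weight (\<alpha> j) (c j) y)" for j y
  have f [measurable]: "f j \<in> borel_measurable borel" for j unfolding f_def[abs_def] by measurable
  have f0: "f j y = 0" if "y \<le> 0" for j y using that by (simp add: f_def gamma_weight_def)
  have polar: "indicator {0<..} r *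
        (ennreal (r ^ n) * (indicator (unit_simplex n) t * (\<Prod>j\<le>n. f j (r * simplex_ext n t j))))
      = ennreal (simplex_weight n \<alpha> t) * ennreal (gamma_weight A (S t) r)" for r t
  proof (cases "0 < r \<and> t \<in> unit_simplex n")
    case True
    then show ?thesis using prod_gamma_weight_polar[of t n r \<alpha> c]
      by (simp add: f_def A_def S_def prod_ennreal ennreal_mult[symmetric] prod_nonneg
          gamma_weight_nonneg simplex_weight_nonneg)
  qed (auto simp: simplex_weight_def gamma_weight_def)
  have "(\<Prod>j\<le>n. \<integral>\<^sup>+y. f j y \<partial>lborel)
      = (\<integral>\<^sup>+r. \<integral>\<^sup>+t. ennreal (simplex_weight n \<alpha> t) * ennreal (gamma_weight A (S t) r) \<partial>?X \<partial>lborel)"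
    unfolding polar[symmetric]
    by (subst nn_integral_orthant_polar) (simp_all add: nn_integral_cmult f0)
  also have "\<dots> = (\<integral>\<^sup>+t. \<integral>\<^sup>+r. ennreal (simplex_weight n \<alpha> t) * ennreal (gamma_weight A (S t) r) \<partial>lborel \<partial>?X)"
    by (rule XL.Fubini') measurable
  finally show ?thesis by (simp only: f_def A_def S_def)
qed

lemma nn_integral_dirichlet_powr:
  fixes \<alpha> c :: "nat \<Rightarrow> real"
  assumes \<alpha>_pos: "\<And>j. j \<le> n \<Longrightarrow> 0 < \<alpha> j" and c: "\<And>j. j \<le> n \<Longrightarrow> 0 < c j"
  shows "(\<integral>\<^sup>+t. ennreal ((\<Sum>j\<le>n. c j * simplex_ext n t j) powr (- (\<Sum>j\<le>n. \<alpha> j))) \<partial>dirichlet n \<alpha>)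
    = ennreal (\<Prod>j\<le>n. c j powr (- \<alpha> j))"
proof -
  let ?X = "PiM {1..n} (\<lambda>_. lborel :: real measure)"
  define A G where "A = (\<Sum>j\<le>n. \<alpha> j)" and "G = (\<Prod>j\<le>n. Gamma (\<alpha> j))"
  define S where "S t = (\<Sum>j\<le>n. c j * simplex_ext n t j)" for t
  let ?polar = "\<lambda>t. \<integral>\<^sup>+r. ennreal (simplex_weight n \<alpha> t) * ennreal (gamma_weight A (S t) r) \<partial>lborel"
  have pos: "0 < A" "0 < G" using \<alpha>_pos by (auto simp: A_def G_def intro!: sum_atMost_pos prod_pos)
  have [measurable]: "S \<in> borel_measurable ?X" unfolding S_def[abs_def] by measurable
  have "ennreal (dirichlet_density n \<alpha> t) * ennreal (S t powr (- A)) = ennreal (1 / G) * ?polar t" for t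
  proof (cases "t \<in> unit_simplex n")
    case True
    then have "0 < S t" unfolding S_def by (intro sum_mult_simplex_ext_pos c)
    then have "?polar t = ennreal (simplex_weight n \<alpha> t) * ennreal (Gamma A * S t powr (- A))"
      using pos by (simp add: nn_integral_cmult nn_integral_gamma_weight)
    then show ?thesis
      using pos Gamma_real_pos[OF pos(1)] simplex_weight_nonneg[of n \<alpha> t]
      by (simp add: dirichlet_density_def ennreal_mult[symmetric] mult_ac flip: A_def G_def)
  qed (simp add: dirichlet_density_def simplex_weight_def)
  then have "(\<integral>\<^sup>+t. ennreal (S t powr (- A)) \<partial>dirichlet n \<alpha>) = (\<integral>\<^sup>+t. ennreal (1 / G) * ?polar t \<partial>?X)"
    by (simp add: dirichlet_def nn_integral_density del: One_nat_def)
  also have "\<dots> = ennreal (1 / G) * (\<integral>\<^sup>+t. ?polar t \<partial>?X)"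
    by (rule nn_integral_cmult) measurable
  also have "(\<integral>\<^sup>+t. ?polar t \<partial>?X) = (\<Prod>j\<le>n. \<integral>\<^sup>+y. ennreal (gamma_weight (\<alpha> j) (c j) y) \<partial>lborel)"
    unfolding prod_nn_integral_gamma_weight A_def S_def ..
  also have "\<dots> = (\<Prod>j\<le>n. ennreal (Gamma (\<alpha> j) * c j powr (- \<alpha> j)))"
    using \<alpha>_pos c by (intro prod.cong refl nn_integral_gamma_weight) auto
  also have "\<dots> = ennreal (G * (\<Prod>j\<le>n. c j powr (- \<alpha> j)))"
    using \<alpha>_pos by (subst prod_ennreal) (auto simp: G_def prod.distrib intro!: mult_nonneg_nonneg less_imp_le)
  also have "ennreal (1 / G) * \<dots> = ennreal (\<Prod>j\<le>n. c j powr (- \<alpha> j))"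
    using pos by (simp add: ennreal_mult'[symmetric])
  finally show ?thesis by (simp only: S_def A_def)
qed

lemma sum_atMost_fun_upd:
  fixes f :: "nat \<Rightarrow> 'a :: ab_group_add"
  assumes "i \<le> n"
  shows "(\<Sum>j\<le>n. (f(i := z)) j) = (\<Sum>j\<le>n. f j) + (z - f i)"
proof -
  have "(\<Sum>j\<le>n. (f(i := z)) j) = (\<Sum>j\<le>n. f j + (if j = i then z - f i else 0))"
    by (intro sum.cong) auto
  then show ?thesis using assms by (simp add: sum.distrib)
qed

lemma prod_atMost_fun_upd:
  fixes g :: "nat \<Rightarrow> 'a \<Rightarrow> 'b :: comm_monoid_mult"
  assumes "i \<le> n" "g i z = g i (f i) * d"
  shows "(\<Prod>j\<le>n. g j ((f(i := z)) j)) = (\<Prod>j\<le>n. g j (f j)) * d"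
proof -
  have "(\<Prod>j\<le>n. g j ((f(i := z)) j)) = (\<Prod>j\<le>n. g j (f j) * (if j = i then d else 1))"
    using assms(2) by (intro prod.cong) auto
  then show ?thesis using assms(1) by (simp add: prod.distrib)
qed

lemma Gamma_plus1_pos: "0 < z \<Longrightarrow> Gamma (z + 1) = z * Gamma z" for z :: real
  by (rule Gamma_plus1) auto

lemma dirichlet_density_fun_upd:
  assumes \<alpha>_pos: "\<And>j. j \<le> n \<Longrightarrow> 0 < \<alpha> j" and i: "i \<le> n"
  shows "\<alpha> i / (\<Sum>j\<le>n. \<alpha> j) * dirichlet_density n (\<alpha>(i := \<alpha> i + 1)) t
      = simplex_ext n t i * dirichlet_density n \<alpha> t"
proof (cases "t \<in> unit_simplex n")
  case True
  define A where "A = (\<Sum>j\<le>n. \<alpha> j)"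
  have A: "0 < A" unfolding A_def by (intro sum_atMost_pos \<alpha>_pos)
  let ?\<alpha> = "\<alpha>(i := \<alpha> i + 1)"
  have "Gamma (\<Sum>j\<le>n. ?\<alpha> j) = A * Gamma A"
    unfolding sum_atMost_fun_upd[OF i] using A by (simp add: Gamma_plus1_pos A_def)
  moreover have "(\<Prod>j\<le>n. Gamma (?\<alpha> j)) = (\<Prod>j\<le>n. Gamma (\<alpha> j)) * \<alpha> i"
    using \<alpha>_pos[OF i] by (intro prod_atMost_fun_upd i) (simp add: Gamma_plus1_pos)
  moreover have "(\<Prod>j\<le>n. simplex_ext n t j powr (?\<alpha> j - 1))
      = (\<Prod>j\<le>n. simplex_ext n t j powr (\<alpha> j - 1)) * simplex_ext n t i"
    using simplex_ext_pos[OF True i] by (intro prod_atMost_fun_upd i) (simp add: powr_diff)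
  ultimately show ?thesis
    using True A \<alpha>_pos[OF i] unfolding dirichlet_density_def simplex_weight_def A_def[symmetric] by simp
qed (simp add: dirichlet_density_def simplex_weight_def)

lemma dirichlet_density_eq_sum:
  assumes "\<And>j. j \<le> n \<Longrightarrow> 0 < \<alpha> j"
  shows "dirichlet_density n \<alpha> t
    = (\<Sum>i\<le>n. \<alpha> i / (\<Sum>j\<le>n. \<alpha> j) * dirichlet_density n (\<alpha>(i := \<alpha> i + 1)) t)"
proof -
  have "(\<Sum>i\<le>n. \<alpha> i / (\<Sum>j\<le>n. \<alpha> j) * dirichlet_density n (\<alpha>(i := \<alpha> i + 1)) t)
      = (\<Sum>i\<le>n. simplex_ext n t i * dirichlet_density n \<alpha> t)"
    by (intro sum.cong refl dirichlet_density_fun_upd assms) auto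
  then show ?thesis by (simp add: sum_distrib_right[symmetric] sum_simplex_ext)
qed

lemma nn_integral_dirichlet_eq_sum:
  assumes \<alpha>_pos: "\<And>j. j \<le> n \<Longrightarrow> 0 < \<alpha> j" and [measurable]: "f \<in> borel_measurable (PiM {1..n} (\<lambda>_. lborel))"
  shows "(\<integral>\<^sup>+t. f t \<partial>dirichlet n \<alpha>)
    = (\<Sum>i\<le>n. ennreal (\<alpha> i / (\<Sum>j\<le>n. \<alpha> j)) * (\<integral>\<^sup>+t. f t \<partial>dirichlet n (\<alpha>(i := \<alpha> i + 1))))"
proof -
  let ?A = "\<Sum>j\<le>n. \<alpha> j" and ?\<alpha> = "\<lambda>i. \<alpha>(i := \<alpha> i + 1)"
  have A: "0 < ?A" by (intro sum_atMost_pos \<alpha>_pos)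
  have "0 < ?\<alpha> i j" if "j \<le> n" for i j using \<alpha>_pos[of i] \<alpha>_pos[OF that] that by (cases "j = i") auto
  then have nonneg: "0 \<le> dirichlet_density n (?\<alpha> i) t" for i t by (intro dirichlet_density_nonneg)
  have "ennreal (dirichlet_density n \<alpha> t) * f t
      = (\<Sum>i\<le>n. ennreal (\<alpha> i / ?A) * (ennreal (dirichlet_density n (?\<alpha> i) t) * f t))" for t
  proof -
    have "ennreal (dirichlet_density n \<alpha> t) = ennreal (\<Sum>i\<le>n. \<alpha> i / ?A * dirichlet_density n (?\<alpha> i) t)"
      by (rule arg_cong[OF dirichlet_density_eq_sum[OF \<alpha>_pos]])
    also have "\<dots> = (\<Sum>i\<le>n. ennreal (\<alpha> i / ?A * dirichlet_density n (?\<alpha> i) t))"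
      using \<alpha>_pos A nonneg
      by (intro sum_ennreal[symmetric] mult_nonneg_nonneg divide_nonneg_nonneg) (auto simp: less_imp_le)
    also have "\<dots> = (\<Sum>i\<le>n. ennreal (\<alpha> i / ?A) * ennreal (dirichlet_density n (?\<alpha> i) t))"
      using \<alpha>_pos A nonneg by (intro sum.cong refl ennreal_mult divide_nonneg_nonneg) (auto simp: less_imp_le)
    finally show ?thesis by (simp only: sum_distrib_right mult.assoc)
  qed
  then show ?thesis
    by (simp add: dirichlet_def nn_integral_density nn_integral_sum nn_integral_cmult del: One_nat_def)
qed

lemma nn_integral_dirichlet_powr_Suc:
  fixes \<alpha> c :: "nat \<Rightarrow> real"
  assumes \<alpha>_pos: "\<And>j. j \<le> n \<Longrightarrow> 0 < \<alpha> j" and c: "\<And>j. j \<le> n \<Longrightarrow> 0 < c j"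
  shows "(\<integral>\<^sup>+t. ennreal ((\<Sum>j\<le>n. c j * simplex_ext n t j) powr (- ((\<Sum>j\<le>n. \<alpha> j) + 1))) \<partial>dirichlet n \<alpha>)
    = ennreal ((\<Prod>j\<le>n. c j powr (- \<alpha> j)) * (\<Sum>i\<le>n. \<alpha> i / c i) / (\<Sum>j\<le>n. \<alpha> j))"
proof -
  let ?\<alpha> = "\<lambda>i. \<alpha>(i := \<alpha> i + 1)"
  define A P where "A = (\<Sum>j\<le>n. \<alpha> j)" and "P = (\<Prod>j\<le>n. c j powr (- \<alpha> j))"
  define S where "S t = (\<Sum>j\<le>n. c j * simplex_ext n t j)" for t
  have A: "0 < A" unfolding A_def by (intro sum_atMost_pos \<alpha>_pos)
  have P: "0 \<le> P" unfolding P_def by (intro prod_nonneg) simp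
  have [measurable]: "S \<in> borel_measurable (PiM {1..n} (\<lambda>_. lborel))" unfolding S_def[abs_def] by measurable
  have raised: "(\<integral>\<^sup>+t. ennreal (S t powr (- (A + 1))) \<partial>dirichlet n (?\<alpha> i))
      = ennreal (P / c i)" if i: "i \<le> n" for i
  proof -
    have "0 < ?\<alpha> i j" if "j \<le> n" for j using \<alpha>_pos[OF i] \<alpha>_pos[OF that] by (cases "j = i") auto
    then have "(\<integral>\<^sup>+t. ennreal (S t powr (- (\<Sum>j\<le>n. ?\<alpha> i j))) \<partial>dirichlet n (?\<alpha> i))
        = ennreal (\<Prod>j\<le>n. c j powr (- ?\<alpha> i j))"
      unfolding S_def by (intro nn_integral_dirichlet_powr c)
    moreover have "(\<Sum>j\<le>n. ?\<alpha> i j) = A + 1"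
      unfolding sum_atMost_fun_upd[OF i] by (simp add: A_def)
    moreover have "(\<Prod>j\<le>n. c j powr (- ?\<alpha> i j)) = P * (1 / c i)"
      unfolding P_def using c[OF i] by (intro prod_atMost_fun_upd i) (simp add: powr_diff)
    ultimately show ?thesis by simp
  qed
  have "(\<integral>\<^sup>+t. ennreal (S t powr (- (A + 1))) \<partial>dirichlet n \<alpha>)
      = (\<Sum>i\<le>n. ennreal (\<alpha> i / A) * (\<integral>\<^sup>+t. ennreal (S t powr (- (A + 1))) \<partial>dirichlet n (?\<alpha> i)))"
    unfolding A_def by (rule nn_integral_dirichlet_eq_sum[OF \<alpha>_pos]) measurable
  also have "\<dots> = (\<Sum>i\<le>n. ennreal (\<alpha> i / A) * ennreal (P / c i))"
    by (intro sum.cong refl arg_cong2[where f = times] raised) simp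
  also have "\<dots> = ennreal (\<Sum>i\<le>n. \<alpha> i / A * (P / c i))"
    using \<alpha>_pos c A P by (subst sum_ennreal[symmetric])
      (auto simp: ennreal_mult[symmetric] less_imp_le intro!: sum.cong)
  also have "(\<Sum>i\<le>n. \<alpha> i / A * (P / c i)) = P * (\<Sum>i\<le>n. \<alpha> i / c i) / A"
    by (simp add: sum_distrib_left sum_divide_distrib mult_ac)
  finally show ?thesis by (simp only: S_def A_def P_def)
qed

lemma prob_space_dirichlet:
  assumes "\<And>j. j \<le> n \<Longrightarrow> 0 < \<alpha> j"
  shows "prob_space (dirichlet n \<alpha>)"
proof
  have "emeasure (dirichlet n \<alpha>) (space (dirichlet n \<alpha>)) = (\<integral>\<^sup>+t. 1 \<partial>dirichlet n \<alpha>)" by simp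
  also have "\<dots> = (\<integral>\<^sup>+t. ennreal ((\<Sum>j\<le>n. 1 * simplex_ext n t j) powr (- (\<Sum>j\<le>n. \<alpha> j))) \<partial>dirichlet n \<alpha>)"
    by (simp add: sum_simplex_ext)
  also have "\<dots> = 1"
    using nn_integral_dirichlet_powr[where \<alpha> = \<alpha> and c = "\<lambda>_. 1", OF assms] by simp
  finally show "emeasure (dirichlet n \<alpha>) (space (dirichlet n \<alpha>)) = 1" .
qed

lemma LINT_dirichlet:
  fixes f :: "(nat \<Rightarrow> real) \<Rightarrow> real"
  assumes "\<And>j. j \<le> n \<Longrightarrow> 0 < \<alpha> j" "f \<in> borel_measurable (PiM {1..n} (\<lambda>_. lborel))"
  shows "(LINT t|dirichlet n \<alpha>. f t) = Gamma (\<Sum>j\<le>n. \<alpha> j) / (\<Prod>j\<le>n. Gamma (\<alpha> j)) *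
    (LINT t:unit_simplex n|PiM {1..n} (\<lambda>_. lborel). f t * (\<Prod>j\<le>n. simplex_ext n t j powr (\<alpha> j - 1)))"
proof -
  have "(LINT t|dirichlet n \<alpha>. f t) = (LINT t|PiM {1..n} (\<lambda>_. lborel). dirichlet_density n \<alpha> t * f t)"
    unfolding dirichlet_def using assms(2) dirichlet_density_nonneg[of n \<alpha>, OF assms(1)]
    by (subst integral_real_density) (simp_all only: AE_I2, measurable)
  also have "\<dots> = (LINT t|PiM {1..n} (\<lambda>_. lborel). Gamma (\<Sum>j\<le>n. \<alpha> j) / (\<Prod>j\<le>n. Gamma (\<alpha> j)) *
      (indicator (unit_simplex n) t * (f t * (\<Prod>j\<le>n. simplex_ext n t j powr (\<alpha> j - 1)))))"
    by (intro Bochner_Integration.integral_cong)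
      (simp_all add: dirichlet_density_def simplex_weight_def mult_ac)
  finally show ?thesis by (simp add: set_lebesgue_integral_def)
qed

section \<open>Moments and generating functions\<close>

lemma borel_measurable_arccos [measurable]: "arccos \<in> borel_measurable borel"
proof -
  have "arccos y = (THE x. False)" if "y \<in> - {-1..1}" for y
  proof -
    have "(\<lambda>x. 0 \<le> x \<and> x \<le> pi \<and> cos x = y) = (\<lambda>x. False)"
      using that by (auto simp: fun_eq_iff)
    then show ?thesis unfolding arccos_def by (rule arg_cong)
  qed
  then have "continuous_on (- {-1..1}) arccos"
    by (subst continuous_on_cong[OF refl]) auto
  with borel_measurable_continuous_on_if[of "{-1..1}" arccos arccos] show ?thesis
    by (simp add: continuous_on_arccos')
qed

lemma power_series_eq_0_imp_coeff_eq_0: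
  fixes d :: "nat \<Rightarrow> real"
  assumes "\<And>r. 0 \<le> r \<Longrightarrow> r < 1 \<Longrightarrow> (\<lambda>n. d n * r ^ n) sums 0"
  shows "d n = 0"
proof (rule ccontr)
  assume nz: "d n \<noteq> 0"
  define f where "f r = (\<Sum>n. d n * r ^ n)" for r
  have f0: "f r = 0" if "0 \<le> r" "r < 1" for r
    using assms[OF that] by (simp add: f_def sums_iff)
  have sums: "(\<lambda>n. d n * (r - 0) ^ n) sums f r" if r: "norm (r - 0) < 1" for r
  proof -
    obtain s where s: "\<bar>r\<bar> < s" "s < 1" using r dense[of "\<bar>r\<bar>" 1] by auto
    then have "summable (\<lambda>n. d n * s ^ n)" by (intro sums_summable[OF assms]) auto
    moreover have "norm r < norm s" using s by simp
    ultimately show ?thesis unfolding f_def diff_0_right by (rule summable_sums[OF powser_inside])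
  qed
  have "d 0 = 0" using sums_unique2[OF powser_sums_zero assms[of 0]] by simp
  with nz have "n > 0" by (cases n) auto
  obtain s where s: "0 < s" "\<And>r. r \<in> cball 0 s - {0} \<Longrightarrow> f r \<noteq> 0"
    by (rule powser_0_nonzero[OF zero_less_one sums _ nz \<open>n > 0\<close>]) (simp_all add: f0)
  then have "f (min s (1/2)) \<noteq> 0" by (intro s(2)) auto
  then show False using f0[of "min s (1/2)"] s(1) by auto
qed

context prob_space
begin

lemma expectation_power_series_sums:
  assumes [measurable]: "random_variable borel L" and bound: "AE x in M. \<bar>L x\<bar> \<le> (1::real)"
    and summable: "summable (\<lambda>n. \<bar>c n\<bar>)"
  shows "(\<lambda>n. c n * expectation (\<lambda>x. L x ^ n)) sums expectation (\<lambda>x. \<Sum>n. c n * L x ^ n)"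
proof -
  have le: "AE x in M. norm (c n * L x ^ n) \<le> \<bar>c n\<bar>" for n
    using bound by eventually_elim (simp add: abs_mult power_abs power_le_one mult_left_le)
  have int: "integrable M (\<lambda>x. c n * L x ^ n)" for n
    by (rule integrable_const_bound[OF le]) measurable
  have "(\<lambda>n. expectation (\<lambda>x. c n * L x ^ n)) sums expectation (\<lambda>x. \<Sum>n. c n * L x ^ n)"
  proof (rule sums_integral[OF int])
    have "AE x in M. \<forall>n. norm (c n * L x ^ n) \<le> \<bar>c n\<bar>"
      unfolding AE_all_countable using le by blast
    then show "AE x in M. summable (\<lambda>n. norm (c n * L x ^ n))"
      by eventually_elim (rule summable_comparison_test[OF _ summable], auto)
    show "summable (\<lambda>n. expectation (\<lambda>x. norm (c n * L x ^ n)))"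
    proof (rule summable_comparison_test[OF _ summable], intro exI allI impI)
      fix n
      have "expectation (\<lambda>x. norm (c n * L x ^ n)) \<le> expectation (\<lambda>x. \<bar>c n\<bar>)"
        using le[of n] int by (intro integral_mono_AE) auto
      then show "norm (expectation (\<lambda>x. norm (c n * L x ^ n))) \<le> \<bar>c n\<bar>"
        by (simp add: prob_space)
    qed
  qed
  then show ?thesis by simp
qed

lemma expectation_binomial_sums:
  assumes "random_variable borel L" "AE x in M. \<bar>L x\<bar> \<le> (1::real)" and r: "\<bar>r\<bar> < 1" and q: "0 < q"
  shows "(\<lambda>n. pochhammer q n / fact n * r ^ n * expectation (\<lambda>x. L x ^ n)) sums
    expectation (\<lambda>x. (1 - r * L x) powr (- q))"
proof -
  have "summable (\<lambda>n. \<bar>pochhammer q n / fact n * r ^ n\<bar>)"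
    using pochhammer_binomial_sums[of "\<bar>r\<bar>" q] r q
    by (simp add: sums_iff abs_mult power_abs pochhammer_nonneg)
  note sums = expectation_power_series_sums[OF assms(1,2) this]
  have "expectation (\<lambda>x. \<Sum>n. pochhammer q n / fact n * r ^ n * L x ^ n)
      = expectation (\<lambda>x. (1 - r * L x) powr (- q))"
  proof (rule integral_cong_AE)
    show "AE x in M. (\<Sum>n. pochhammer q n / fact n * r ^ n * L x ^ n) = (1 - r * L x) powr (- q)"
      using assms(2)
    proof eventually_elim
      case (elim x)
      then have "\<bar>r * L x\<bar> < 1" using r mult_left_le[of "\<bar>L x\<bar>" "\<bar>r\<bar>"] by (simp add: abs_mult)
      from pochhammer_binomial_sums[OF this, of q] show ?case
        by (simp add: sums_iff power_mult_distrib mult.assoc)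
    qed
  qed (use assms(1) in measurable)
  with sums show ?thesis by simp
qed

lemma expectation_exp_sums:
  assumes "random_variable borel L" "AE x in M. \<bar>L x\<bar> \<le> (1::real)"
  shows "(\<lambda>n. r ^ n / fact n * expectation (\<lambda>x. L x ^ n)) sums expectation (\<lambda>x. exp (r * L x))"
proof -
  have "summable (\<lambda>n. \<bar>r ^ n / fact n\<bar>)"
    using summable_exp[of "\<bar>r\<bar>"] by (simp add: abs_mult power_abs field_simps)
  moreover have "(\<Sum>n. r ^ n / fact n * L x ^ n) = exp (r * L x)" for x
    by (simp add: exp_def power_mult_distrib field_simps)
  ultimately show ?thesis using expectation_power_series_sums[OF assms, of "\<lambda>n. r ^ n / fact n"] by simp
qed

text \<open>The generating function determines the moments of a bounded random variable, hence its Laplace transform.\<close>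

lemma exp_sums_of_binomial_sums:
  assumes L: "random_variable borel L" "AE x in M. \<bar>L x\<bar> \<le> (1::real)" and q: "0 < q"
    and "\<And>r. 0 \<le> r \<Longrightarrow> r < 1 \<Longrightarrow>
      (\<lambda>n. pochhammer q n * m n * r ^ n) sums expectation (\<lambda>x. (1 - r * L x) powr (- q))"
  shows "(\<lambda>n. m n * s ^ n) sums expectation (\<lambda>x. exp (s * L x))"
proof -
  have "m n = expectation (\<lambda>x. L x ^ n) / fact n" for n
  proof -
    have "pochhammer q n * m n - pochhammer q n / fact n * expectation (\<lambda>x. L x ^ n) = 0"
    proof (rule power_series_eq_0_imp_coeff_eq_0)
      fix r :: real assume "0 \<le> r" "r < 1"
      with sums_diff[OF assms(4)[of r] expectation_binomial_sums[OF L _ q, of r]]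
      show "(\<lambda>n. (pochhammer q n * m n - pochhammer q n / fact n * expectation (\<lambda>x. L x ^ n)) * r ^ n) sums 0"
        by (simp add: algebra_simps)
    qed
    then show ?thesis using pochhammer_pos[OF q, of n] by (simp add: field_simps)
  qed
  then show ?thesis using expectation_exp_sums[OF L, of s] by (simp add: mult_ac)
qed

end

section \<open>The integral representation of the generalized Bessel function\<close>

context dihedral
begin

abbreviation simplex_measure :: "(nat \<Rightarrow> real) measure" where
  "simplex_measure \<equiv> dirichlet (k - 1) (\<lambda>_. lam)"

sublocale simplex: prob_space simplex_measure
  by (rule prob_space_dirichlet) (rule lam_pos)

sublocale phase_space: pair_prob_space nu_pair simplex_measure ..

definition simplex_phase :: "real \<Rightarrow> (nat \<Rightarrow> real) \<Rightarrow> real" where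
  "simplex_phase q t = (\<Sum>j<k. cos ((q - 2 * real j * pi) / real k) * simplex_ext (k - 1) t j)"

definition phase :: "(real \<times> real \<Rightarrow> real) \<Rightarrow> (real \<times> real) \<times> (nat \<Rightarrow> real) \<Rightarrow> real" where
  "phase Q X = simplex_phase (Q (fst X)) (snd X)"

lemma lessThan_k: "{..<k} = {..k - 1}"
  using k_pos by (metis Suc_pred' lessThan_Suc_atMost)

lemma simplex_phase_measurable [measurable (raw)]:
  assumes [measurable]: "f \<in> borel_measurable M" and g: "g \<in> M \<rightarrow>\<^sub>M PiM {1..k - 1} (\<lambda>_. lborel)"
  shows "(\<lambda>x. simplex_phase (f x) (g x)) \<in> borel_measurable M"
  unfolding simplex_phase_def lessThan_k
proof (intro borel_measurable_sum borel_measurable_times)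
  show "(\<lambda>x. simplex_ext (k - 1) (g x) j) \<in> borel_measurable M" if "j \<in> {..k - 1}" for j
    using that by (intro measurable_compose[OF g simplex_ext_measurable]) simp
qed measurable

lemma phase_measurable [measurable]:
  assumes [measurable]: "Q \<in> borel_measurable (borel \<Otimes>\<^sub>M borel)"
  shows "phase Q \<in> borel_measurable (nu_pair \<Otimes>\<^sub>M simplex_measure)"
  unfolding phase_def[abs_def] by measurable

lemma abs_simplex_phase_le:
  assumes "t \<in> unit_simplex (k - 1)"
  shows "\<bar>simplex_phase q t\<bar> \<le> 1"
proof -
  have "\<bar>simplex_phase q t\<bar> \<le> (\<Sum>j\<le>k - 1. \<bar>cos ((q - 2 * real j * pi) / real k) * simplex_ext (k - 1) t j\<bar>)"
    unfolding simplex_phase_def lessThan_k by (rule sum_abs)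
  also have "\<dots> \<le> (\<Sum>j\<le>k - 1. simplex_ext (k - 1) t j)"
    using simplex_ext_pos[OF assms] by (intro sum_mono)
      (auto simp: abs_mult less_imp_le intro!: mult_left_le_one_le)
  finally show ?thesis by (simp only: sum_simplex_ext)
qed

lemma AE_phase_space: "AE X in nu_pair \<Otimes>\<^sub>M simplex_measure. fst X \<in> unit_square \<and> snd X \<in> unit_simplex (k - 1)"
proof (rule phase_space.AE_pair_measure)
  show "{X \<in> space (nu_pair \<Otimes>\<^sub>M simplex_measure). fst X \<in> unit_square \<and> snd X \<in> unit_simplex (k - 1)}
      \<in> sets (nu_pair \<Otimes>\<^sub>M simplex_measure)"
    by measurable
  show "AE q in nu_pair. AE t in simplex_measure. fst (q, t) \<in> unit_square \<and> snd (q, t) \<in> unit_simplex (k - 1)"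
    using AE_nu_pair by eventually_elim (use AE_dirichlet[of "k - 1" "\<lambda>_. lam"] in \<open>auto simp del: One_nat_def\<close>)
qed

lemma AE_phase_le: "AE X in nu_pair \<Otimes>\<^sub>M simplex_measure. \<bar>phase Q X\<bar> \<le> 1"
  using AE_phase_space by eventually_elim (simp add: phase_def abs_simplex_phase_le)

lemma coset_factor_nonneg: "\<bar>t\<bar> < 1 \<Longrightarrow> 0 \<le> coset_factor t"
  using abs_power_lt_1[of t k] unfolding coset_factor_def
  by (intro mult_nonneg_nonneg divide_nonneg_nonneg) (auto simp: abs_square_le_1 less_imp_le)

lemma cos_phase_eq_Re:
  "cos ((q - 2 * real j * pi) / real k) = Re (cis (- (q / real k)) * cis (2 * pi * real j / real k))"
proof -
  have "Re (cis (- (q / real k)) * cis (2 * pi * real j / real k)) = cos (- ((q - 2 * real j * pi) / real k))"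
    by (simp add: cis_mult diff_divide_distrib mult_ac)
  then show ?thesis by simp
qed

lemma prod_one_minus_phase:
  "(\<Prod>j<k. 1 - tanh_double t * cos ((q - 2 * real j * pi) / real k))
      = poisson_denom (t ^ k) (cos q) / (1 + t\<^sup>2) ^ k"
  using prod_poisson_denom[OF k_pos, of "cis (- (q / real k))" t]
  unfolding one_minus_tanh_double_mult prod_dividef cos_phase_eq_Re by (simp add: Complex.DeMoivre)

lemma sum_inverse_one_minus_phase:
  assumes t: "\<bar>t\<bar> < 1"
  shows "(\<Sum>j<k. 1 / (1 - tanh_double t * cos ((q - 2 * real j * pi) / real k)))
    = real k * ((1 + t\<^sup>2) * ((1 - (t ^ k)\<^sup>2) / (1 - t\<^sup>2)) / poisson_denom (t ^ k) (cos q))"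
proof -
  let ?D = "\<lambda>j. poisson_denom t (Re (cis (- (q / real k)) * cis (2 * pi * real j / real k)))"
  have "1 - t\<^sup>2 > 0" using t by (simp add: abs_square_less_1)
  then have "1 / (1 - tanh_double t * cos ((q - 2 * real j * pi) / real k))
      = (1 + t\<^sup>2) / (1 - t\<^sup>2) * ((1 - t\<^sup>2) / ?D j)" for j
    unfolding one_minus_tanh_double_mult cos_phase_eq_Re by simp
  then have "(\<Sum>j<k. 1 / (1 - tanh_double t * cos ((q - 2 * real j * pi) / real k)))
      = (1 + t\<^sup>2) / (1 - t\<^sup>2) * (\<Sum>j<k. (1 - t\<^sup>2) / ?D j)"
    by (simp only: sum_distrib_left)
  also have "(\<Sum>j<k. (1 - t\<^sup>2) / ?D j) = real k * (1 - (t ^ k)\<^sup>2) / poisson_denom (t ^ k) (cos q)"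
    using sum_poisson_kernel[OF k_pos _ t, of "cis (- (q / real k))"] by (simp add: Complex.DeMoivre)
  finally show ?thesis by (simp add: mult_ac)
qed

lemma LINT_simplex_phase:
  assumes t: "\<bar>t\<bar> < 1"
  shows "(LINT u|simplex_measure. (1 - tanh_double t * simplex_phase q u) powr (- (index + 1)))
    = coset_factor t * poisson_denom (t ^ k) (cos q) powr (- lam - 1)"
proof -
  define c where "c j = 1 - tanh_double t * cos ((q - 2 * real j * pi) / real k)" for j
  let ?D = "poisson_denom (t ^ k) (cos q)"
  have pos: "0 < 1 + t\<^sup>2" "0 < ?D" "0 < c j" for j
    using t unfolding c_def one_minus_tanh_double_mult
    by (auto intro!: poisson_denom_pos divide_pos_pos abs_power_lt_1 one_plus_square_pos)
  have linear: "1 - tanh_double t * simplex_phase q u = (\<Sum>j\<le>k - 1. c j * simplex_ext (k - 1) u j)" for u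
    using sum_simplex_ext[of "k - 1" u]
    by (simp add: c_def simplex_phase_def lessThan_k left_diff_distrib sum_subtractf sum_distrib_left mult.assoc)
  have prod_c: "(\<Prod>j<k. c j powr (- lam)) = ?D powr (- lam) * (1 + t\<^sup>2) powr index"
  proof -
    have "((1 + t\<^sup>2) ^ k) powr (- lam) = inverse ((1 + t\<^sup>2) powr index)"
      using pos(1) by (simp add: powr_powr powr_minus[symmetric] algebra_simps flip: powr_realpow)
    then have "(?D / (1 + t\<^sup>2) ^ k) powr (- lam) = ?D powr (- lam) * (1 + t\<^sup>2) powr index"
      unfolding powr_divide by (simp only: divide_inverse inverse_inverse_eq)
    then show ?thesis
      by (simp only: c_def prod_powr_distrib[symmetric] prod_one_minus_phase)
  qed
  have sum_c: "(\<Sum>j<k. lam / c j) / index = (1 + t\<^sup>2) * ((1 - (t ^ k)\<^sup>2) / (1 - t\<^sup>2)) / ?D"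
  proof -
    have "(\<Sum>j<k. lam / c j) = lam * (\<Sum>j<k. 1 / c j)" by (simp add: sum_distrib_left)
    then show ?thesis
      unfolding c_def sum_inverse_one_minus_phase[OF t] using lam_pos k_pos by simp
  qed
  have index: "(\<Sum>j<k. lam) = index" by simp
  have "(\<integral>\<^sup>+u. ennreal ((1 - tanh_double t * simplex_phase q u) powr (- (index + 1))) \<partial>simplex_measure)
      = ennreal ((\<Prod>j<k. c j powr (- lam)) * ((\<Sum>j<k. lam / c j) / index))"
    using nn_integral_dirichlet_powr_Suc[of "k - 1" "\<lambda>_. lam" c, OF lam_pos pos(3), folded linear]
    by (simp only: lessThan_k[symmetric] index times_divide_eq_right)
  also have "(\<Prod>j<k. c j powr (- lam)) * ((\<Sum>j<k. lam / c j) / index) = coset_factor t * ?D powr (- lam - 1)"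
    unfolding prod_c sum_c coset_factor_def using pos by (simp add: powr_diff powr_add mult_ac)
  finally have "(\<integral>\<^sup>+u. ennreal ((1 - tanh_double t * simplex_phase q u) powr (- (index + 1))) \<partial>simplex_measure)
      = ennreal (coset_factor t * ?D powr (- lam - 1))" .
  moreover have "(\<lambda>u. (1 - tanh_double t * simplex_phase q u) powr (- (index + 1)))
      \<in> borel_measurable simplex_measure"
    by measurable
  ultimately show ?thesis
    using coset_factor_nonneg[OF t] by (subst integral_eq_nn_integral) (simp_all del: One_nat_def)
qed

lemma expectation_phase:
  assumes Q [measurable]: "Q \<in> borel_measurable (borel \<Otimes>\<^sub>M borel)"
    and cos_Q: "\<And>q. q \<in> unit_square \<Longrightarrow> cos (Q q) = xi_form p s q" and t: "\<bar>t\<bar> < 1"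
  shows "(LINT X|(nu_pair \<Otimes>\<^sub>M simplex_measure). (1 - tanh_double t * phase Q X) powr (- (index + 1)))
    = coset_factor t * gegenbauer_integral 0 0 p s (t ^ k)"
proof -
  let ?f = "\<lambda>X. (1 - tanh_double t * phase Q X) powr (- (index + 1))"
  have "integrable (nu_pair \<Otimes>\<^sub>M simplex_measure) ?f"
  proof (rule phase_space.integrable_const_bound)
    show "AE X in nu_pair \<Otimes>\<^sub>M simplex_measure. norm (?f X) \<le> (1 - \<bar>tanh_double t\<bar>) powr (- (index + 1))"
      using AE_phase_le[of Q]
    proof eventually_elim
      case (elim X)
      then have "tanh_double t * phase Q X \<le> \<bar>tanh_double t\<bar>"
        using mult_left_le[of "\<bar>phase Q X\<bar>" "\<bar>tanh_double t\<bar>"] abs_ge_self[of "tanh_double t * phase Q X"]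
        by (simp add: abs_mult)
      then show ?case using abs_tanh_double_lt_1[OF t] index_pos by (auto intro!: powr_mono2')
    qed
  qed measurable
  then have "(LINT X|(nu_pair \<Otimes>\<^sub>M simplex_measure). ?f X) = (LINT q|nu_pair. LINT u|simplex_measure. ?f (q, u))"
    by (rule phase_space.integral_fst'[symmetric])
  also have "\<dots> = (LINT q|nu_pair. coset_factor t * poisson_denom (t ^ k) (cos (Q q)) powr (- lam - 1))"
    unfolding phase_def fst_conv snd_conv LINT_simplex_phase[OF t] ..
  also have "\<dots> = (LINT q|nu_pair. coset_factor t * gegenbauer_kernel 1 p s (t ^ k) q)"
    by (rule LINT_nu_pair_cong) (simp_all add: cos_Q gegenbauer_kernel_def)
  finally show ?thesis by (simp add: gegenbauer_integral_def)
qed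

definition bessel_coeff :: "complex \<Rightarrow> nat \<Rightarrow> complex \<Rightarrow> real" where
  "bessel_coeff y n x = orbit_sum (\<lambda>y. kernel_comp y n x) y / (4 * real k)"

lemma gen_bessel_eq_orbit_sum: "gen_bessel k a b x y = orbit_sum (\<lambda>y. dunkl_kernel k a b x y) y / (4 * real k)"
  by (simp add: gen_bessel_def orbit_sum_def dih_rot_def dih_refl_def rot_def rfl_def zeta_def)

lemma gen_bessel_sums:
  "(\<lambda>n. bessel_coeff y n x * (m * l) ^ n) sums gen_bessel k a b (m *\<^sub>R x) (l *\<^sub>R y)"
proof -
  have "orbit_sum (\<lambda>y. kernel_comp y n (m *\<^sub>R x)) (l *\<^sub>R y)
      = orbit_sum (\<lambda>y. (m * l) ^ n * kernel_comp y n x) y" for n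
    by (simp add: orbit_sum_def rot_scaleR rfl_scaleR kernel_comp_scaleR kernel_comp_scaleR_right
        power_mult_distrib mult_ac)
  then have "bessel_coeff y n x * (m * l) ^ n
      = orbit_sum (\<lambda>y. kernel_comp y n (m *\<^sub>R x)) (l *\<^sub>R y) / (4 * real k)" for n
    by (simp add: bessel_coeff_def orbit_sum_cmult)
  then show ?thesis
    unfolding gen_bessel_eq_orbit_sum dunkl_kernel_eq_series
    by (auto intro!: sums_divide sums_orbit_sum kernel_series_sums)
qed

lemma bessel_coeff_generating_function:
  assumes x: "cmod x = 1" and y: "cmod y = 1" and t: "0 \<le> t" "t < 1"
  shows "(\<lambda>n. pochhammer (index + 1) n * bessel_coeff y n x * tanh_double t ^ n) sums
    (coset_factor t * gegenbauer_integral 0 0 (re_prod x y) (im_prod x y) (t ^ k))"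
proof -
  have t': "\<bar>t\<bar> < 1" using t by simp
  have "(\<lambda>n. orbit_sum (\<lambda>y. genfun_coeff y n x * tanh_double t ^ n) y) sums orbit_sum (\<lambda>y. closed_form y t x) y"
  proof (rule sums_orbit_sum)
    fix p assume "p \<in> orbit y"
    then have p: "cmod p = 1" using y by (simp add: norm_orbit)
    show "(\<lambda>n. genfun_coeff p n x * tanh_double t ^ n) sums closed_form p t x"
      using genfun_sums[OF x p abs_tanh_double_lt_1[OF t']] unfolding genfun_eq_closed_form[OF x p t] .
  qed
  then have "(\<lambda>n. orbit_sum (\<lambda>y. genfun_coeff y n x * tanh_double t ^ n) y / (4 * real k)) sums
      (orbit_sum (\<lambda>y. closed_form y t x) y / (4 * real k))"
    by (rule sums_divide)
  moreover have "orbit_sum (\<lambda>y. genfun_coeff y n x * tanh_double t ^ n) y / (4 * real k)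
      = pochhammer (index + 1) n * bessel_coeff y n x * tanh_double t ^ n" for n
    using orbit_sum_cmult[of "pochhammer (index + 1) n * tanh_double t ^ n" "\<lambda>y. kernel_comp y n x" y]
    by (simp add: genfun_coeff_def bessel_coeff_def mult_ac)
  ultimately show ?thesis
    using k_pos by (simp add: orbit_sum_closed_form[OF x y t'])
qed

lemma gen_bessel_eq_expectation:
  assumes x: "cmod x = 1" and y: "cmod y = 1" and Q: "Q \<in> borel_measurable (borel \<Otimes>\<^sub>M borel)"
    and e: "e \<in> {1, -1}"
    and cos_Q: "\<And>q. q \<in> unit_square \<Longrightarrow> cos (Q q) = e * xi_form (re_prod x y) (im_prod x y) q"
  shows "gen_bessel k a b (m *\<^sub>R x) (l *\<^sub>R y) = (LINT X|(nu_pair \<Otimes>\<^sub>M simplex_measure). exp (m * l * phase Q X))"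
proof -
  let ?p = "re_prod x y" and ?s = "im_prod x y"
  have flip: "gegenbauer_integral 0 0 (e * ?p) (e * ?s) r = gegenbauer_integral 0 0 ?p ?s r" for r
    using e by (auto simp: gegenbauer_integral_flip_fst gegenbauer_integral_flip_snd)
  have cos_Q': "cos (Q q) = xi_form (e * ?p) (e * ?s) q" if "q \<in> unit_square" for q
    using cos_Q[OF that] by (simp add: xi_form_def algebra_simps)
  have "(\<lambda>n. bessel_coeff y n x * (m * l) ^ n)
      sums (LINT X|(nu_pair \<Otimes>\<^sub>M simplex_measure). exp (m * l * phase Q X))"
  proof (rule phase_space.exp_sums_of_binomial_sums[OF phase_measurable[OF Q] AE_phase_le])
    show "0 < index + 1" using index_pos by simp
    fix r :: real assume "0 \<le> r" "r < 1"
    then obtain t where t: "0 \<le> t" "t < 1" "tanh_double t = r" by (rule tanh_double_surj)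
    then have "\<bar>t\<bar> < 1" by simp
    then show "(\<lambda>n. pochhammer (index + 1) n * bessel_coeff y n x * r ^ n) sums
        (LINT X|(nu_pair \<Otimes>\<^sub>M simplex_measure). (1 - r * phase Q X) powr (- (index + 1)))"
      using bessel_coeff_generating_function[OF x y t(1,2)] expectation_phase[OF Q cos_Q', of t]
      unfolding t(3) flip by simp
  qed
  with gen_bessel_sums show ?thesis by (rule sums_unique2)
qed

lemma LINT_phase_space:
  fixes f :: "(real \<times> real) \<times> (nat \<Rightarrow> real) \<Rightarrow> real"
  assumes "integrable (nu_pair \<Otimes>\<^sub>M simplex_measure) f"
  shows "(LINT X|(nu_pair \<Otimes>\<^sub>M simplex_measure). f X) = (LINT u:{-1..1}|lborel. LINT v:{-1..1}|lborel.
    nu_density a u * nu_density b v * (LINT t|simplex_measure. f ((u, v), t)))"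
proof -
  define H where "H q = (LINT t|simplex_measure. f (q, t))" for q
  have H: "integrable nu_pair H" and f: "(LINT X|(nu_pair \<Otimes>\<^sub>M simplex_measure). f X) = (LINT q|nu_pair. H q)"
    using phase_space.integrable_fst'[OF assms] phase_space.integral_fst'[OF assms]
    by (simp_all add: H_def[abs_def])
  then have [measurable]: "H \<in> borel_measurable (borel \<Otimes>\<^sub>M borel)"
    by (simp add: borel_measurable_integrable cong: measurable_cong_sets)
  have "(LINT q|nu_pair. H q) = (LINT u|nu_measure a. LINT v|nu_measure b. H (u, v))"
    using nu_ab.integral_fst'[of H] H unfolding nu_pair_def by simp
  also have "\<dots> = (LINT u:{-1..1}|lborel. nu_density a u * (LINT v|nu_measure b. H (u, v)))"
    by (rule LINT_nu_measure[OF a_pos]) measurable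
  also have "\<dots> = (LINT u:{-1..1}|lborel. LINT v:{-1..1}|lborel. nu_density a u * nu_density b v * H (u, v))"
    by (simp add: LINT_nu_measure[OF b_pos] mult.assoc)
  finally show ?thesis unfolding f H_def .
qed

lemma integrable_exp_phase:
  assumes [measurable]: "Q \<in> borel_measurable (borel \<Otimes>\<^sub>M borel)"
  shows "integrable (nu_pair \<Otimes>\<^sub>M simplex_measure) (\<lambda>X. exp (r * phase Q X))"
proof (rule phase_space.integrable_const_bound)
  show "AE X in nu_pair \<Otimes>\<^sub>M simplex_measure. norm (exp (r * phase Q X)) \<le> exp \<bar>r\<bar>"
    using AE_phase_le[of Q]
  proof eventually_elim
    case (elim X)
    then show ?case
      using mult_left_le[of "\<bar>phase Q X\<bar>" "\<bar>r\<bar>"] abs_ge_self[of "r * phase Q X"] by (simp add: abs_mult)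
  qed
qed measurable

text \<open>The angles $q$ and $\pi - q$ both represent the generalized Bessel function.\<close>

lemma gen_bessel_integral_representation:
  assumes x: "cmod x = 1" and y: "cmod y = 1"
  defines "Q \<equiv> \<lambda>q. arccos (xi_form (re_prod x y) (im_prod x y) q)"
  shows "gen_bessel k a b (m *\<^sub>R x) (l *\<^sub>R y) = Gamma (real k * lam) / (2 * Gamma lam ^ k) *
    (LINT u:{-1..1}|lborel. LINT v:{-1..1}|lborel. nu_density a u * nu_density b v *
      (LINT t:unit_simplex (k - 1)|PiM {1..k - 1} (\<lambda>_. lborel).
        (exp (m * l * simplex_phase (Q (u, v)) t) + exp (m * l * simplex_phase (pi - Q (u, v)) t))
          * (\<Prod>j<k. simplex_ext (k - 1) t j powr (lam - 1))))"
proof -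
  let ?M = "nu_pair \<Otimes>\<^sub>M simplex_measure" and ?Q' = "\<lambda>q. pi - Q q"
  let ?f = "\<lambda>X. exp (m * l * phase Q X) + exp (m * l * phase ?Q' X)"
  have Q [measurable]: "Q \<in> borel_measurable (borel \<Otimes>\<^sub>M borel)" unfolding Q_def by measurable
  have cos_Q: "cos (Q q) = xi_form (re_prod x y) (im_prod x y) q" if "q \<in> unit_square" for q
    using abs_xi_form_le[OF abs_re_prod_im_prod_le[OF x y] that] by (simp add: Q_def cos_arccos_abs)
  have inner: "(LINT t|simplex_measure. ?f ((u, v), t)) = Gamma (real k * lam) / Gamma lam ^ k *
      (LINT t:unit_simplex (k - 1)|PiM {1..k - 1} (\<lambda>_. lborel).
        ?f ((u, v), t) * (\<Prod>j<k. simplex_ext (k - 1) t j powr (lam - 1)))" for u v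
  proof -
    have "(\<lambda>t. ?f ((u, v), t)) \<in> borel_measurable (PiM {1..k - 1} (\<lambda>_. lborel))"
      unfolding phase_def fst_conv snd_conv by measurable
    from LINT_dirichlet[of "k - 1" "\<lambda>_. lam", OF lam_pos this] show ?thesis
      by (simp only: lessThan_k[symmetric] sum_constant prod_constant card_lessThan)
  qed
  have "gen_bessel k a b (m *\<^sub>R x) (l *\<^sub>R y) = (LINT X|?M. exp (m * l * phase Q X))"
    by (rule gen_bessel_eq_expectation[OF x y Q, where e = 1]) (simp_all add: cos_Q)
  moreover have "gen_bessel k a b (m *\<^sub>R x) (l *\<^sub>R y) = (LINT X|?M. exp (m * l * phase ?Q' X))"
    by (rule gen_bessel_eq_expectation[OF x y, where e = "-1"]) (simp_all add: cos_Q)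
  moreover have "(LINT X|?M. ?f X) = (LINT X|?M. exp (m * l * phase Q X)) + (LINT X|?M. exp (m * l * phase ?Q' X))"
    by (intro Bochner_Integration.integral_add integrable_exp_phase) measurable
  ultimately have "gen_bessel k a b (m *\<^sub>R x) (l *\<^sub>R y) = (LINT X|?M. ?f X) / 2"
    by simp
  also have "(LINT X|?M. ?f X) = (LINT u:{-1..1}|lborel. LINT v:{-1..1}|lborel.
      nu_density a u * nu_density b v * (LINT t|simplex_measure. ?f ((u, v), t)))"
    by (intro LINT_phase_space Bochner_Integration.integrable_add integrable_exp_phase) measurable
  finally show ?thesis
    unfolding inner mult.left_commute[of _ "Gamma (real k * lam) / Gamma lam ^ k"] set_integral_mult_right
    by (simp add: phase_def del: One_nat_def)
qed

end

theorem mainTheorem7: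
  fixes k :: nat and a b :: real and z w :: complex
  assumes "k \<ge> 2" and "a > 0" and "b > 0"
  shows "gen_bessel k a b z w =
    Gamma (real k * (a + b)) / (2 * Gamma (a + b) ^ k) *
    (LINT u:{-1..1}|lborel. LINT v:{-1..1}|lborel.
       nu_density a u * nu_density b v *
       (LINT t:unit_simplex (k - 1)|PiM {1..k - 1} (\<lambda>_. lborel).
          (let q = q_uv u v (real k * Arg z) (real k * Arg w);
               ap = (\<lambda>j. cmod z * cmod w * cos ((q - 2 * real j * pi) / real k));
               am = (\<lambda>j. cmod z * cmod w * cos ((pi - q - 2 * real j * pi) / real k));
               s = simplex_ext (k - 1) t
           in (exp (\<Sum>j<k. ap j * s j) + exp (\<Sum>j<k. am j * s j))
              * (\<Prod>j<k. s j powr (a + b - 1)))))"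
proof -
  interpret dihedral k a b by unfold_locales (use assms in auto)
  let ?x = "cis (Arg z)" and ?y = "cis (Arg w)"
  have polar: "z = cmod z *\<^sub>R ?x" "w = cmod w *\<^sub>R ?y"
    using rcis_cmod_Arg[of z] rcis_cmod_Arg[of w] by (simp_all add: rcis_def scaleR_conv_of_real)
  have angle: "q_uv u v (real k * Arg z) (real k * Arg w)
      = arccos (xi_form (re_prod ?x ?y) (im_prod ?x ?y) (u, v))" for u v
    by (simp add: q_uv_def xi_uv_def xi_form_def re_prod_def im_prod_def Complex.DeMoivre mult.assoc)
  have phase: "(\<Sum>j<k. cmod z * cmod w * cos ((q - 2 * real j * pi) / real k) * simplex_ext (k - 1) t j)
      = cmod z * cmod w * simplex_phase q t" for q t
    by (simp only: simplex_phase_def sum_distrib_left mult.assoc)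
  show ?thesis
    using gen_bessel_integral_representation[of ?x ?y "cmod z" "cmod w"]
    unfolding polar[symmetric] Let_def angle phase by simp
qed

end
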